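(* For all real $t>0$, the functions $A(t) = -t^2 \phi_0(i/t) - \frac{36}{\pi^2}\psi_I(it)$ and $B(t) = -t^2\phi_0(i/t) + \frac{36}{\pi^2}\psi_I(it)$ satisfy $$A(t) < 0 \qquad\text{and}\qquad B(t) > 0 .$$
   Context: Let $z$ be a complex variable in the upper half plane and put $q = e^{\pi i z}$ (so that $q^{1/4}$ is understood as $e^{\pi i z/4}$, and so on). Let $\sigma_\alpha(n) = \sum_{d\mid n} d^\alpha$. Define the Eisenstein series $$E_2(z) = 1 - 24\sum_{n=1}^\infty \sigma_1(n) q^{2n},\quad E_4(z) = 1 + 240\sum_{n=1}^\infty \sigma_3(n) q^{2n},\quad E_6(z) = 1 - 504\sum_{n=1}^\infty \sigma_5(n) q^{2n},$$ and the Jacobi thetanull functions $$\theta_2(z) = \sum_{n=-\infty}^\infty q^{(n+1/2)^2},\quad \theta_3(z) = \sum_{n=-\infty}^\infty q^{n^2},\quad \theta_4(z) = \sum_{n=-\infty}^\infty (-1)^n q^{n^2}.$$ Define $$\phi_0(z) = 1728\,\frac{(E_2(z)E_4(z) - E_6(z))^2}{E_4(z)^3 - E_6(z)^2},$$ $$\psi_I(z) = 128\left(\frac{\theta_3(z)^4+\theta_4(z)^4}{\theta_2(z)^8} + \frac{\theta_4(z)^4 - \theta_2(z)^4}{\theta_3(z)^8}\right).$$ On the positive imaginary axis these functions take real values, so $A(t)$ and $B(t)$ are real for $t>0$. *)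

theory Defs
  imports "HOL-Analysis.Analysis"
begin

(* The power q^r of q = e^(pi i z). For fractional r it has to be read off from z;
   "q powr r" would take the principal branch, which is a different number in general. *)
definition qpow :: "complex \<Rightarrow> real \<Rightarrow> complex" where
  "qpow z r = exp (complex_of_real (pi * r) * \<i> * z)"

definition divisor_sigma :: "nat \<Rightarrow> nat \<Rightarrow> nat" where
  "divisor_sigma \<alpha> n = (\<Sum>d | d dvd n. d ^ \<alpha>)"

(* The series sum over n >= 1 of sigma_alpha(n) q^(2n), shifted to start at index 0. *)
definition sigma_series :: "nat \<Rightarrow> complex \<Rightarrow> complex" where
  "sigma_series \<alpha> z =
     (\<Sum>n. of_nat (divisor_sigma \<alpha> (Suc n)) * qpow z (2 * real (Suc n)))"

definition E2 :: "complex \<Rightarrow> complex" where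
  "E2 z = 1 - 24 * sigma_series 1 z"

definition E4 :: "complex \<Rightarrow> complex" where
  "E4 z = 1 + 240 * sigma_series 3 z"

definition E6 :: "complex \<Rightarrow> complex" where
  "E6 z = 1 - 504 * sigma_series 5 z"

definition theta2 :: "complex \<Rightarrow> complex" where
  "theta2 z = (\<Sum>\<^sub>\<infinity>n::int. qpow z ((of_int n + 1/2)\<^sup>2))"

definition theta3 :: "complex \<Rightarrow> complex" where
  "theta3 z = (\<Sum>\<^sub>\<infinity>n::int. qpow z ((of_int n)\<^sup>2))"

definition theta4 :: "complex \<Rightarrow> complex" where
  "theta4 z = (\<Sum>\<^sub>\<infinity>n::int. (-1) powi n * qpow z ((of_int n)\<^sup>2))"

definition phi0 :: "complex \<Rightarrow> complex" where
  "phi0 z = 1728 * ((E2 z * E4 z - E6 z)\<^sup>2 / (E4 z ^ 3 - E6 z ^ 2))"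

definition psiI :: "complex \<Rightarrow> complex" where
  "psiI z = 128 * ((theta3 z ^ 4 + theta4 z ^ 4) / theta2 z ^ 8
                 + (theta4 z ^ 4 - theta2 z ^ 4) / theta3 z ^ 8)"

definition A :: "real \<Rightarrow> complex" where
  "A t = - (complex_of_real t)\<^sup>2 * phi0 (\<i> / complex_of_real t)
         - complex_of_real (36 / pi\<^sup>2) * psiI (\<i> * complex_of_real t)"

definition B :: "real \<Rightarrow> complex" where
  "B t = - (complex_of_real t)\<^sup>2 * phi0 (\<i> / complex_of_real t)
         + complex_of_real (36 / pi\<^sup>2) * psiI (\<i> * complex_of_real t)"

end

theory Submission
  imports Defs "HOL-Real_Asymp.Real_Asymp"
begin

text \<open>
  Everything happens on the imaginary axis \<open>z = it\<close>, where all series are real; put \<open>q = exp (- \<pi>t)\<close>.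
  The functions \<open>E2, E4, E6\<close> and the three thetas satisfy inversion formulas under \<open>t \<mapsto> 1/t\<close>, so in
  either of the cases \<open>t \<ge> 1\<close> and \<open>t \<le> 1\<close> both sides of \<open>t\<^sup>2 \<phi>\<^sub>0(i/t) < (36/\<pi>\<^sup>2) \<psi>\<^sub>I(it)\<close> can be expanded at a
  point where \<open>q \<le> 1/20\<close>, and two or three terms of each series decide the inequality.
  For \<open>t \<ge> 1\<close> the poles \<open>q\<^sup>-\<^sup>2\<close> of the two sides cancel, and the inequality comes down to
  \<open>(E4 - (\<pi>t/6)(E2 E4 - E6))\<^sup>2 < \<psi>\<^sub>I \<cdot> (E4\<^sup>3 - E6\<^sup>2) / 1728\<close>, whose sides are about \<open>1 + (480 - 240\<pi>t) q\<^sup>2\<close>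
  and \<open>1 + 120 q\<^sup>2\<close>; for \<open>t \<le> 1\<close>, with \<open>q\<close> formed at \<open>1/t\<close>, division by \<open>t\<^sup>2\<close> leaves about \<open>518400 q\<^sup>2\<close>
  against \<open>(36/\<pi>\<^sup>2) \<cdot> 10240 q\<close>.

  The inversion of the Eisenstein series comes from the double series over \<open>1/(n + imt)\<^sup>k\<close>, that of the thetas from
  Polya's argument: sum \<open>(2 cos x)\<^sup>2\<^sup>m\<close> over equidistant \<open>x\<close> and let the binomial coefficients become Gaussian.
\<close>

section \<open>The Lipschitz formula\<close>

text \<open>The claim on \<open>A\<close> needs only the signs of its two terms; the inequality
  itself is what \<open>B\<close> needs. For fixed \<open>t\<close> the points \<open>i/t\<close>
  and \<open>it\<close> lie on opposite sides of the fixed point \<open>i\<close> of the inversion,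
  so one of the two functions has to be moved before both can be expanded in the same small nome.
  The bound \<open>1/20\<close> is \<open>exp (- 3)\<close> rounded up, from \<open>pi > 3\<close>
  at the fixed point, where the two cases meet. The coefficients quoted above come from
  \<open>E4 = 1 + 240 q^2 + ...\<close>, \<open>E2 E4 - E6 = 720 q^2 + ...\<close>,
  \<open>psi_I = q^(-2) + 144 + ...\<close> and
  \<open>E4^3 - E6^2 = 1728 q^2 (1 - 24 q^2 + ...)\<close>: thus \<open>120 = 144 - 24\<close> and
  \<open>518400 = 720^2\<close>. For \<open>t <= 1\<close> the two quotients in the inverted
  \<open>psi_I\<close> start with \<open>1\<close> and \<open>-1\<close>; these cancel, and the
  linear terms add up to \<open>80 q\<close>, whence \<open>10240 = 128 * 80\<close>. So in both
  cases the leading terms decide nothing and the next coefficients do; every truncation is made just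
  precise enough to keep those.\<close>

lemma Digamma_reflection_complex:
  fixes z :: complex
  assumes "z \<notin> \<int>"
  shows "Digamma (1 - z) - Digamma z = pi * cot (pi * z)"
proof -
  let ?w = "complex_of_real pi * z"
  have sin0: "sin ?w \<noteq> 0"
    using assms by (auto simp: sin_eq_0 Ints_def)
  have z: "z \<notin> \<int>\<^sub>\<le>\<^sub>0" and z': "1 - z \<notin> \<int>\<^sub>\<le>\<^sub>0"
    using assms by (auto elim!: nonpos_Ints_cases simp: algebra_simps)
      (metis Ints_1 Ints_add Ints_diff Ints_of_int add_diff_cancel_left' diff_add_cancel)
  \<comment> \<open>The reflection formula equates this product with \<open>pi / sin (pi z)\<close>;
    differentiating both forms and comparing gives the claim.\<close>
  have "((\<lambda>z. Gamma z * Gamma (1 - z)) has_field_derivative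
          Gamma z * Gamma (1 - z) * (Digamma z - Digamma (1 - z))) (at z)"
    using z z' by (auto intro!: derivative_eq_intros simp: algebra_simps)
  moreover have "((\<lambda>z. complex_of_real pi / sin (of_real pi * z)) has_field_derivative
                   - (of_real pi * (of_real pi * cos ?w)) / (sin ?w)\<^sup>2) (at z)"
    using sin0 by (auto intro!: derivative_eq_intros simp: power2_eq_square)
  ultimately have "of_real pi / sin ?w * (Digamma z - Digamma (1 - z)) =
      - (of_real pi * (of_real pi * cos ?w)) / (sin ?w)\<^sup>2"
    unfolding Gamma_reflection_complex by (rule DERIV_unique)
  thus ?thesis
    using sin0
    by (simp add: cot_def divide_simps power2_eq_square)
       (simp add: algebra_simps, metis (no_types, lifting) distrib_left mult_cancel_left of_real_eq_0_iff pi_neq_zero)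
qed

text \<open>The polylogarithm of order \<open>- j\<close>. Since \<open>0 ^ 0 = 1\<close>, the term
  \<open>r = 0\<close> counts for \<open>j = 0\<close> and vanishes for all other \<open>j\<close>;
  hence order 0 is \<open>1 / (1 - y)\<close> and the operator \<open>y d/dy\<close> raises the
  order by one throughout.\<close>

definition power_lambert :: "nat \<Rightarrow> 'a \<Rightarrow> 'a :: {real_normed_field, banach}" where
  "power_lambert j y = (\<Sum>r. of_nat r ^ j * y ^ r)"

lemma summable_power_lambert:
  fixes y :: "'a :: {real_normed_field, banach}"
  assumes "norm y < 1"
  shows "summable (\<lambda>r. of_nat r ^ j * y ^ r)"
proof (cases "y = 0")
  case True
  show ?thesis by (rule summable_finite[of "{0}"]) (auto simp: True)
next
  case False
  have "(\<lambda>n. norm y * (1 + 1 / real (Suc n)) ^ j) \<longlonglongrightarrow> norm y * (1 + 0) ^ j"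
    by (intro tendsto_intros LIMSEQ_Suc lim_1_over_n)
  then have "\<forall>\<^sub>F n in sequentially. norm y * (1 + 1 / real (Suc n)) ^ j < (1 + norm y) / 2"
    using assms by (intro order_tendstoD) auto
  then obtain N where N: "norm y * (1 + 1 / real (Suc n)) ^ j < (1 + norm y) / 2" if "n \<ge> N" for n
    by (auto simp: eventually_sequentially)
  show ?thesis
  proof (rule summable_ratio_test[of "(1 + norm y) / 2" "Suc N"])
    show "(1 + norm y) / 2 < 1" using assms by simp
    fix n assume n: "n \<ge> Suc N"
    then obtain m where m: "n = Suc m" "m \<ge> N" by (metis Suc_le_D Suc_le_mono)
    have "norm (of_nat (Suc n) ^ j * y ^ Suc n) =
        norm y * (1 + 1 / real (Suc m)) ^ j * norm (of_nat n ^ j * y ^ n)"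
      by (simp add: m norm_mult norm_power field_simps flip: power_mult_distrib del: of_nat_Suc)
         (simp add: add_divide_distrib field_simps flip: power_mult_distrib)
    also have "\<dots> \<le> (1 + norm y) / 2 * norm (of_nat n ^ j * y ^ n)"
      using N[OF m(2)] by (intro mult_right_mono) auto
    finally show "norm (of_nat (Suc n) ^ j * y ^ Suc n) \<le> (1 + norm y) / 2 * norm (of_nat n ^ j * y ^ n)" .
  qed
qed

lemma DERIV_power_lambert:
  fixes y :: "'a :: {real_normed_field, banach}"
  assumes "norm y < 1" "y \<noteq> 0"
  shows "(power_lambert j has_field_derivative power_lambert (Suc j) y / y) (at y)"
proof -
  have "((\<lambda>y. \<Sum>r. of_nat r ^ j * y ^ r) has_field_derivative (\<Sum>r. diffs (\<lambda>r. of_nat r ^ j) r * y ^ r)) (at y)"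
    by (rule termdiffs_strong'[where K = 1]) (use assms in \<open>auto intro: summable_power_lambert\<close>)
  also have "(\<Sum>r. diffs (\<lambda>r. of_nat r ^ j) r * y ^ r) = (\<Sum>r. of_nat (Suc r) ^ Suc j * y ^ Suc r / y)"
    using assms by (simp add: diffs_def mult.assoc)
  also have "\<dots> = (\<Sum>r. of_nat (Suc r) ^ Suc j * y ^ Suc r) / y"
    by (intro suminf_divide) (subst summable_Suc_iff, rule summable_power_lambert, fact)
  also have "(\<Sum>r. of_nat (Suc r) ^ Suc j * y ^ Suc r) = power_lambert (Suc j) y"
    using suminf_split_head[OF summable_power_lambert[OF assms(1), of "Suc j"]]
    by (simp add: power_lambert_def)
  finally show ?thesis
    by (simp add: power_lambert_def [abs_def])
qed

lemma power_lambert_0: "norm y < 1 \<Longrightarrow> power_lambert 0 y = 1 / (1 - y)"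
  by (simp add: power_lambert_def suminf_geometric)

lemma norm_nome_less_1:
  fixes z :: complex
  assumes "Im z > 0" shows "norm (exp (2 * pi * \<i> * z)) < 1"
  using assms by (simp add: mult.assoc)

lemma pi_cot_eq_exp:
  fixes z :: complex
  assumes "Im z > 0"
  shows "pi * cot (pi * z) = pi * \<i> - 2 * pi * \<i> / (1 - exp (2 * pi * \<i> * z))"
proof -
  define e where "e = exp (\<i> * (pi * z))"
  have e0: "e \<noteq> 0" by (simp add: e_def)
  have ee: "exp (2 * pi * \<i> * z) = e ^ 2"
    by (simp add: e_def mult_ac flip: exp_double)
  have e1: "e ^ 2 \<noteq> 1"
    by (metis ee norm_one less_irrefl norm_nome_less_1[OF assms])
  have c: "cos (pi * z) = (e + 1 / e) / 2" "sin (pi * z) = (e - 1 / e) / (2 * \<i>)"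
    unfolding cos_exp_eq sin_exp_eq by (simp_all add: e_def exp_minus field_simps)
  have "e - 1 / e \<noteq> 0"
    using e0 e1 by (simp add: field_simps power2_eq_square)
  then have "cot (pi * z) = \<i> * (e^2 + 1) / (e^2 - 1)"
    unfolding cot_def c using e0 e1 by (simp add: field_simps power2_eq_square)
  then show ?thesis
    unfolding ee using e1 by (simp add: field_simps) 
qed

text \<open>For \<open>n > 0\<close> the left side is \<open>(-1)^n n!\<close> times the sum of
  \<open>1 / (z + k)^(n + 1)\<close> over all integers \<open>k\<close>: one Polygamma value
  supplies \<open>k >= 0\<close>, the other \<open>k < 0\<close>. The case \<open>n = 0\<close> is
  the Fourier expansion of the cotangent; each differentiation raises \<open>n\<close> by one, and
  the first removes the constant \<open>pi * \<i>\<close>.\<close>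

lemma Lipschitz_formula:
  fixes z :: complex
  assumes "Im z > 0"
  shows "(-1) ^ n * Polygamma n (1 - z) - Polygamma n z =
           (if n = 0 then pi * \<i> else 0) - (2 * pi * \<i>) ^ Suc n * power_lambert n (exp (2 * pi * \<i> * z))"
  using assms
proof (induction n arbitrary: z)
  case 0
  then have "z \<notin> \<int>" by (auto elim!: Ints_cases)
  then show ?case
    using pi_cot_eq_exp[OF 0] norm_nome_less_1[OF 0]
    by (simp add: Digamma_reflection_complex power_lambert_0)
next
  case (Suc n)
  let ?e = "\<lambda>z. exp (2 * pi * \<i> * z)"
  have z: "z \<notin> \<int>\<^sub>\<le>\<^sub>0" and z': "1 - z \<notin> \<int>\<^sub>\<le>\<^sub>0"
    using Suc.prems by (auto elim!: nonpos_Ints_cases simp: complex_eq_iff)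
  have "((\<lambda>z. (-1) ^ n * Polygamma n (1 - z) - Polygamma n z) has_field_derivative
          (-1) ^ Suc n * Polygamma (Suc n) (1 - z) - Polygamma (Suc n) z) (at z)"
    using z z' by (auto intro!: derivative_eq_intros)
  moreover have "((\<lambda>z. (if n = 0 then pi * \<i> else 0) - (2 * pi * \<i>) ^ Suc n * power_lambert n (?e z))
       has_field_derivative - ((2 * pi * \<i>) ^ Suc (Suc n) * power_lambert (Suc n) (?e z))) (at z)"
    by (rule derivative_eq_intros DERIV_chain2[OF DERIV_power_lambert] norm_nome_less_1 Suc.prems refl | simp)+
  then have "((\<lambda>z. (-1) ^ n * Polygamma n (1 - z) - Polygamma n z) has_field_derivative
       - ((2 * pi * \<i>) ^ Suc (Suc n) * power_lambert (Suc n) (?e z))) (at z)"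
    by (rule has_field_derivative_transform_within_open[where S = "{z. Im z > 0}"])
       (use Suc in \<open>auto intro: open_halfspace_Im_gt\<close>)
  ultimately show ?case
    by (subst DERIV_unique) auto
qed

lemma power_lambert_of_real:
  assumes "\<bar>y\<bar> < 1"
  shows "power_lambert n (complex_of_real y) = complex_of_real (power_lambert n y)"
proof -
  have "(\<lambda>r. real r ^ n * y ^ r) sums power_lambert n y"
    unfolding power_lambert_def using assms by (intro summable_sums summable_power_lambert) auto
  from sums_of_real[OF this, where 'a = complex] show ?thesis
    by (simp add: power_lambert_def sums_iff)
qed

lemma i_power_even: "\<i> ^ (2 * p + 2) = (-1) ^ (p + 1)"
  by (simp add: power_mult)

text \<open>In even weight the terms of \<open>n\<close> and \<open>- n\<close> at
  \<open>z = \<i> * x\<close> are complex conjugates, so the sum over all integers is twice this sum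
  plus the term of \<open>n = 0\<close>. That term accounts for \<open>1 / x ^ (2 * p + 2)\<close>
  on the right, and the sign is a power of \<open>\<i>\<close>. Summed over the multiples of
  \<open>t\<close>, this will cover one quadrant of the lattice.\<close>

lemma quarter_sum:
  fixes x :: real
  assumes x: "x > 0"
  shows "(\<lambda>j. Re (1 / (of_nat (Suc j) + \<i> * of_real x) ^ (2 * p + 2))) sums
           ((-1) ^ (p + 1) / 2 * ((2 * pi) ^ (2 * p + 2) / fact (2 * p + 1) * power_lambert (2 * p + 1) (exp (- 2 * pi * x))
              - 1 / x ^ (2 * p + 2)))"
proof -
  define n where "n = 2 * p + 1"
  have n: "n > 0" "odd n" by (auto simp: n_def)
  define z where "z = \<i> * complex_of_real x"
  have z0: "z \<noteq> 0" using x by (simp add: z_def)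
  have nonint: "1 + z \<notin> \<int>\<^sub>\<le>\<^sub>0" "1 - z \<notin> \<int>\<^sub>\<le>\<^sub>0"
    using x by (auto elim!: nonpos_Ints_cases simp: z_def complex_eq_iff)
  have nz: "1 + z \<noteq> 0" "1 - z \<noteq> 0"
    using nonint by force+
  have "(\<lambda>k. inverse ((1 + z + of_nat k) ^ Suc n) + inverse ((1 - z + of_nat k) ^ Suc n)) sums
        ((-1) ^ Suc n * Polygamma n (1 + z) / fact n + (-1) ^ Suc n * Polygamma n (1 - z) / fact n)"
    by (intro sums_add Polygamma_LIMSEQ nz n)
  moreover have "inverse ((1 + z + of_nat k) ^ Suc n) + inverse ((1 - z + of_nat k) ^ Suc n) =
      complex_of_real (2 * Re (1 / (of_nat (Suc k) + \<i> * of_real x) ^ (2 * p + 2)))" for k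
  proof -
    define u where "u = of_nat (Suc k) + \<i> * complex_of_real x"
    have "1 + z + of_nat k = u" "1 - z + of_nat k = cnj u"
      by (simp_all add: u_def z_def)
    then have "inverse ((1 + z + of_nat k) ^ Suc n) + inverse ((1 - z + of_nat k) ^ Suc n) =
       1 / u ^ Suc n + cnj (1 / u ^ Suc n)"
      by (simp add: inverse_eq_divide)
    also have "\<dots> = complex_of_real (2 * Re (1 / u ^ Suc n))"
      by (rule complex_add_cnj)
    finally show ?thesis by (simp add: u_def n_def)
  qed
  moreover have "(-1) ^ Suc n * Polygamma n (1 + z) / fact n + (-1) ^ Suc n * Polygamma n (1 - z) / fact n =
      complex_of_real ((-1) ^ (p + 1) * ((2 * pi) ^ (2 * p + 2) / fact (2 * p + 1) * power_lambert (2 * p + 1) (exp (- 2 * pi * x))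
              - 1 / x ^ (2 * p + 2)))"
  proof -
    have "exp (2 * pi * \<i> * z) = complex_of_real (exp (- 2 * pi * x))"
      by (simp add: z_def mult_ac flip: exp_of_real)
    then have pl: "power_lambert n (exp (2 * pi * \<i> * z)) = complex_of_real (power_lambert n (exp (- 2 * pi * x)))"
      using x by (simp only:) (subst power_lambert_of_real, auto)
    have L: "Polygamma n (1 - z) + Polygamma n z = (2 * pi * \<i>) ^ Suc n * power_lambert n (exp (2 * pi * \<i> * z))"
      using Lipschitz_formula[of z n] n x by (simp add: z_def algebra_simps)
    have P: "Polygamma n (1 + z) = Polygamma n z - fact n / z ^ Suc n"
      using Polygamma_plus1[OF z0, of n] n by (simp add: add.commute)
    have "(-1) ^ Suc n * Polygamma n (1 + z) / fact n + (-1) ^ Suc n * Polygamma n (1 - z) / fact n =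
        (Polygamma n (1 - z) + Polygamma n z) / fact n - 1 / z ^ Suc n"
      using n by (simp add: P field_simps)
    also have "\<dots> = (2 * pi * \<i>) ^ (2 * p + 2) * power_lambert n (exp (- 2 * pi * x)) / fact n
        - 1 / (\<i> * of_real x) ^ (2 * p + 2)"
      unfolding L pl by (simp add: n_def z_def)
    also have "\<dots> = complex_of_real ((-1) ^ (p + 1) * ((2 * pi) ^ (2 * p + 2) / fact n * power_lambert n (exp (- 2 * pi * x))
              - 1 / x ^ (2 * p + 2)))"
      unfolding power_mult_distrib i_power_even
      using x by (cases "even p") (simp_all add: field_simps)
    finally show ?thesis by (simp add: n_def)
  qed
  ultimately have "(\<lambda>j. complex_of_real (2 * Re (1 / (of_nat (Suc j) + \<i> * of_real x) ^ (2 * p + 2)))) sums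
     complex_of_real ((-1) ^ (p + 1) * ((2 * pi) ^ (2 * p + 2) / fact (2 * p + 1) * power_lambert (2 * p + 1) (exp (- 2 * pi * x))
              - 1 / x ^ (2 * p + 2)))"
    by (simp only:)
  then have "(\<lambda>j. 2 * Re (1 / (of_nat (Suc j) + \<i> * of_real x) ^ (2 * p + 2))) sums
     ((-1) ^ (p + 1) * ((2 * pi) ^ (2 * p + 2) / fact (2 * p + 1) * power_lambert (2 * p + 1) (exp (- 2 * pi * x))
              - 1 / x ^ (2 * p + 2)))"
    by (subst (asm) sums_of_real_iff)
  from sums_divide[OF this, of 2] show ?thesis
    by (simp only: nonzero_mult_div_cancel_left[OF zero_neq_numeral[symmetric]] times_divide_eq_left)
qed

section \<open>Divisor sums as Lambert series\<close>

definition sigma_sum :: "nat \<Rightarrow> real \<Rightarrow> real" where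
  "sigma_sum j t = (\<Sum>n. real (divisor_sigma j (Suc n)) * exp (- 2 * pi * t) ^ Suc n)"

lemma divisor_sigma_le: "divisor_sigma j n \<le> n ^ Suc j"
proof (cases "n = 0")
  case False
  have "divisor_sigma j n \<le> (\<Sum>d | d dvd n. n ^ j)"
    unfolding divisor_sigma_def using False by (intro sum_mono power_mono) (auto intro: dvd_imp_le)
  also have "\<dots> = card {d. d dvd n} * n ^ j" by simp
  also have "card {d. d dvd n} \<le> card {1..n}"
    using False by (intro card_mono) (auto intro: dvd_imp_le Suc_leI dvd_pos_nat)
  finally show ?thesis by simp
qed (simp add: divisor_sigma_def)

lemma summable_sigma:
  assumes "0 \<le> y" "y < (1 :: real)"
  shows "summable (\<lambda>n. real (divisor_sigma j n) * y ^ n)"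
proof (rule summable_comparison_test')
  show "summable (\<lambda>n. real n ^ Suc j * y ^ n)"
    using assms by (intro summable_power_lambert) auto
  show "norm (real (divisor_sigma j n) * y ^ n) \<le> real n ^ Suc j * y ^ n" for n
    using assms divisor_sigma_le[of j n, folded of_nat_le_iff[where 'a = real]]
    by (auto simp: abs_mult intro!: mult_right_mono)
qed

lemma sums_Suc_imp_has_sum:
  fixes f :: "nat \<Rightarrow> real"
  assumes "(\<lambda>n. f (Suc n)) sums s" "\<And>n. f n \<ge> 0"
  shows "(f has_sum s) {1..}"
proof -
  have "((\<lambda>n. f (Suc n)) has_sum s) UNIV"
    using assms by (intro norm_summable_imp_has_sum) (auto simp: sums_iff)
  also have "?this \<longleftrightarrow> (f has_sum s) (Suc ` UNIV)"
    by (subst has_sum_reindex) (auto simp: o_def)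
  also have "range Suc = {1..}"
    by (auto simp: image_iff) (metis Suc_le_D One_nat_def)
  finally show ?thesis .
qed

lemma sums_power_lambert_sigma:
  assumes t: "t > 0" and j: "j > 0"
  shows "(\<lambda>m. power_lambert j (exp (- 2 * pi * (real (Suc m) * t)))) sums sigma_sum j t"
proof -
  define y where "y = exp (- 2 * pi * t)"
  have y: "0 < y" "y < 1" using t by (auto simp: y_def)
  have y': "y ^ m < 1" if "m \<ge> 1" for m
    using that y by (simp add: power_less_one_iff)
  have 1: "((\<lambda>n. real (divisor_sigma j n) * y ^ n) has_sum sigma_sum j t) {1..}"
    unfolding sigma_sum_def y_def [symmetric]
    using summable_Suc_iff[of "\<lambda>n. real (divisor_sigma j n) * y ^ n"] summable_sigma[of y j] y
    by (intro sums_Suc_imp_has_sum summable_sums) auto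
  define D where "D = (SIGMA n:{1..}. {d::nat. d dvd n})"
  have fin: "finite {d. d dvd n}" if "n \<in> {1..}" for n :: nat
    using that by (intro finite_divisors_nat) auto
  have inner: "((\<lambda>d. real d ^ j * y ^ n) has_sum real (divisor_sigma j n) * y ^ n) {d. d dvd n}"
    if "n \<in> {1..}" for n
    using has_sum_finite[OF fin[OF that], of "\<lambda>d. real d ^ j * y ^ n"]
    by (simp add: divisor_sigma_def sum_distrib_right)
  have "(\<lambda>(n, d). real d ^ j * y ^ n) summable_on D"
    unfolding D_def
    by (rule summable_on_SigmaI[where g = "\<lambda>n. real (divisor_sigma j n) * y ^ n"])
       (use inner y has_sum_imp_summable[OF 1] in auto)
  then have "((\<lambda>(n, d). real d ^ j * y ^ n) has_sum sigma_sum j t) D"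
    unfolding D_def
    by (intro has_sum_SigmaI[where g = "\<lambda>n. real (divisor_sigma j n) * y ^ n"] 1) (use inner in auto)
  \<comment> \<open>A pair of \<open>n\<close> and a divisor \<open>d\<close> is the same as a pair
    \<open>(m, d)\<close> with \<open>n = m * d\<close>; summing over \<open>d\<close> first now
    gives a polylogarithm for each \<open>m\<close>.\<close>
  also have "?this \<longleftrightarrow> ((\<lambda>(m, d). real d ^ j * y ^ (m * d)) has_sum sigma_sum j t) ({1..} \<times> {1..})"
    by (rule has_sum_reindex_bij_witness[of _ "\<lambda>(m, d). (m * d, d)" "\<lambda>(n, d). (n div d, d)"])
       (auto simp: D_def dvd_def mult.commute)
  finally have 2: "((\<lambda>m. power_lambert j (y ^ m)) has_sum sigma_sum j t) {1..}"
  proof (rule has_sum_SigmaD)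
    fix m :: nat assume m: "m \<in> {1..}"
    have s: "summable (\<lambda>d. real d ^ j * (y ^ m) ^ d)"
      using y'[of m] m y by (intro summable_power_lambert) auto
    have "(\<lambda>d. real (Suc d) ^ j * (y ^ m) ^ Suc d) sums power_lambert j (y ^ m)"
      using s j by (subst sums_Suc_iff) (auto simp: power_lambert_def zero_power intro!: summable_sums)
    then have "((\<lambda>d. real d ^ j * (y ^ m) ^ d) has_sum power_lambert j (y ^ m)) {1..}"
      by (rule sums_Suc_imp_has_sum) (use y in auto)
    then show "((\<lambda>d. case (m, d) of (m, d) \<Rightarrow> real d ^ j * y ^ (m * d)) has_sum power_lambert j (y ^ m)) {1..}"
      by (simp add: power_mult)
  qed
  have "((\<lambda>m. power_lambert j (y ^ Suc m)) has_sum sigma_sum j t) UNIV"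
  proof -
    have "range Suc = {1..}"
      by (auto simp: image_iff) (metis Suc_le_D One_nat_def)
    then have "((\<lambda>m. power_lambert j (y ^ m)) has_sum sigma_sum j t) (Suc ` UNIV)"
      using 2 by simp
    then show ?thesis
      by (subst (asm) has_sum_reindex) (auto simp: o_def)
  qed
  then have "(\<lambda>m. power_lambert j (y ^ Suc m)) sums sigma_sum j t"
    by (rule has_sum_imp_sums)
  moreover have "y ^ Suc m = exp (- 2 * pi * (real (Suc m) * t))" for m
    unfolding y_def exp_of_nat_mult [symmetric] by (simp add: algebra_simps)
  ultimately show ?thesis by simp
qed

section \<open>Inversion of the Eisenstein series\<close>

text \<open>The indices are shifted: \<open>m, n \<ge> 0\<close> stand for the lattice point \<open>(n + 1) + i(m + 1)t\<close>, and the weight is \<open>k = 2p + 2\<close>.\<close>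

definition lattice_term :: "nat \<Rightarrow> real \<Rightarrow> nat \<Rightarrow> nat \<Rightarrow> real" where
  "lattice_term p t m n = Re (1 / (of_nat (Suc n) + \<i> * of_real (real (Suc m) * t)) ^ (2 * p + 2))"

text \<open>Exchanging the two coordinates and replacing \<open>t\<close> by \<open>1 / t\<close>
  conjugates the lattice point and multiplies it by \<open>\<i> / t\<close>. Homogeneity pulls out
  the factor, and the real part does not see the conjugation.\<close>

lemma lattice_term_inverse:
  assumes "t > 0"
  shows "lattice_term p (1 / t) m n = (-1) ^ (p + 1) * t ^ (2 * p + 2) * lattice_term p t n m"
proof -
  define u where "u = of_nat (Suc m) + \<i> * of_real (real (Suc n) * t)"
  have "of_nat (Suc n) + \<i> * of_real (real (Suc m) * (1 / t)) = \<i> / of_real t * cnj u"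
    using assms by (simp add: u_def complex_eq_iff field_simps)
  then have "1 / (of_nat (Suc n) + \<i> * of_real (real (Suc m) * (1 / t))) ^ (2 * p + 2) =
       of_real t ^ (2 * p + 2) / \<i> ^ (2 * p + 2) * cnj (1 / u ^ (2 * p + 2))"
    by (simp only: power_mult_distrib power_divide) simp
  also have "\<dots> = of_real ((-1) ^ (p + 1) * t ^ (2 * p + 2)) * cnj (1 / u ^ (2 * p + 2))"
    unfolding i_power_even by (cases "even p") simp_all
  finally have *: "1 / (of_nat (Suc n) + \<i> * of_real (real (Suc m) * (1 / t))) ^ (2 * p + 2) =
     of_real ((-1) ^ (p + 1) * t ^ (2 * p + 2)) * cnj (1 / u ^ (2 * p + 2))" .
  have Re: "Re (of_real c * cnj w) = c * Re w" for c w by simp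
  show ?thesis
    unfolding lattice_term_def u_def [symmetric] * Re ..
qed

text \<open>The inequality of arithmetic and geometric means; it separates the two indices, so that
  the double series can be compared with a product of single ones.\<close>

lemma norm_lattice_ge:
  assumes "t > 0"
  shows "norm (of_nat (Suc n) + \<i> * of_real (real (Suc m) * t)) ^ 2 \<ge> 2 * t * (real (Suc m) * real (Suc n))"
proof -
  have "norm (of_nat (Suc n) + \<i> * of_real (real (Suc m) * t)) ^ 2 = real (Suc n) ^ 2 + (real (Suc m) * t) ^ 2"
    by (simp add: cmod_power2)
  moreover have "0 \<le> (real (Suc n) - real (Suc m) * t) ^ 2" by simp
  ultimately show ?thesis by (simp only: power2_diff) (simp add: algebra_simps)
qed

lemma inverse_square_product_summable:
  "(\<lambda>(m, n). c / (real (Suc m) * real (Suc n)) ^ 2) summable_on (UNIV \<times> UNIV)"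
proof -
  have *: "(\<lambda>n. 1 / real (Suc n) ^ 2) summable_on UNIV"
    using summable_Suc_iff[of "\<lambda>n. 1 / real n ^ 2"] inverse_power_summable[of 2, where 'a = real]
    by (intro norm_summable_imp_summable_on) (auto simp: field_simps)
  let ?Z = "\<Sum>\<^sub>\<infinity>n. 1 / real (Suc n) ^ 2"
  have inner: "((\<lambda>n. 1 / real (Suc m) ^ 2 * (1 / real (Suc n) ^ 2)) has_sum 1 / real (Suc m) ^ 2 * ?Z) UNIV" for m
    using * by (intro has_sum_cmult_right has_sum_infsum)
  have outer: "(\<lambda>m. 1 / real (Suc m) ^ 2 * ?Z) summable_on UNIV"
    using * by (rule summable_on_cmult_left)
  have "(\<lambda>(m, n). 1 / real (Suc m) ^ 2 * (1 / real (Suc n) ^ 2)) summable_on (UNIV \<times> UNIV)"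
    by (rule summable_on_SigmaI[OF _ outer]) (use inner in \<open>simp_all only: prod.case, simp_all\<close>)
  from summable_on_cmult_right[OF this, of c] show ?thesis
    by (simp add: power_mult_distrib case_prod_unfold)
qed

lemma summable_on_inverse_square_product_comparison:
  fixes f :: "nat \<Rightarrow> nat \<Rightarrow> real"
  assumes "\<And>m n. \<bar>f m n\<bar> \<le> c / (real (Suc m) * real (Suc n)) ^ 2"
  shows "(\<lambda>(m, n). f m n) summable_on (UNIV \<times> UNIV)"
proof -
  have "(\<lambda>x. norm ((\<lambda>(m, n). f m n) x)) summable_on (UNIV \<times> UNIV)"
    by (rule summable_on_comparison_test[OF inverse_square_product_summable[of c]])
       (use assms in \<open>auto simp del: of_nat_Suc\<close>)
  then show ?thesis by (rule abs_summable_summable)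
qed

lemma iterated_sums_swap:
  fixes f :: "nat \<Rightarrow> nat \<Rightarrow> real"
  assumes "(\<lambda>(m, n). f m n) summable_on (UNIV \<times> UNIV)"
  assumes "\<And>m. f m sums a m" "\<And>n. (\<lambda>m. f m n) sums b n"
  obtains S where "a sums S" "b sums S"
proof -
  obtain S where S: "((\<lambda>(m, n). f m n) has_sum S) (UNIV \<times> UNIV)"
    using assms(1) by (auto simp: summable_on_def)
  have S': "((\<lambda>(n, m). f m n) has_sum S) (UNIV \<times> UNIV)"
    using S by (subst (asm) has_sum_swap) auto
  have "f m summable_on UNIV" for m
    using summable_on_SigmaD1[OF assms(1), of m] by simp
  then have a: "(f m has_sum a m) UNIV" for m
    using assms(2)[of m] has_sum_imp_sums[of "f m"] sums_unique2 by (fastforce simp: summable_on_def)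
  have "(\<lambda>m. f m n) summable_on UNIV" for n
    using summable_on_SigmaD1[of "\<lambda>n m. f m n" UNIV "\<lambda>_. UNIV" n] S' by (auto simp: summable_on_def)
  then have b: "((\<lambda>m. f m n) has_sum b n) UNIV" for n
    using assms(3)[of n] has_sum_imp_sums[of "\<lambda>m. f m n"] sums_unique2 by (fastforce simp: summable_on_def)
  have "(a has_sum S) UNIV" using S by (rule has_sum_SigmaD) (use a in auto)
  moreover have "(b has_sum S) UNIV" using S' by (rule has_sum_SigmaD) (use b in auto)
  ultimately show ?thesis by (intro that has_sum_imp_sums)
qed

lemma sums_lattice_row:
  assumes "t > 0"
  shows "lattice_term p t m sums
    ((-1) ^ (p + 1) / 2 * ((2 * pi) ^ (2 * p + 2) / fact (2 * p + 1) * power_lambert (2 * p + 1) (exp (- 2 * pi * (real (Suc m) * t)))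
              - 1 / (real (Suc m) * t) ^ (2 * p + 2)))"
  unfolding lattice_term_def [abs_def] using assms by (intro quarter_sum) auto

definition zeta_even :: "nat \<Rightarrow> real" where
  "zeta_even p = (\<Sum>n. 1 / real (Suc n) ^ (2 * p + 2))"

lemma sums_zeta_even: "(\<lambda>n. 1 / real (Suc n) ^ (2 * p + 2)) sums zeta_even p"
  unfolding zeta_even_def
  using summable_Suc_iff[of "\<lambda>n. 1 / real n ^ (2 * p + 2)"] inverse_power_summable[of "2 * p + 2", where 'a = real]
  by (intro summable_sums) (auto simp: field_simps)

text \<open>The value of the quadrant sum with \<open>n\<close> inside and \<open>m\<close> outside.
  The order is part of the meaning: for \<open>p = 0\<close> the opposite order gives another
  value.\<close>

definition lattice_value :: "nat \<Rightarrow> real \<Rightarrow> real" where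
  "lattice_value p t = (-1) ^ (p + 1) / 2 * ((2 * pi) ^ (2 * p + 2) / fact (2 * p + 1) * sigma_sum (2 * p + 1) t
              - zeta_even p / t ^ (2 * p + 2))"

lemma sums_sums_lattice_row:
  assumes t: "t > 0"
  shows "(\<lambda>m. \<Sum>n. lattice_term p t m n) sums lattice_value p t"
proof -
  have "(\<lambda>m. (2 * pi) ^ (2 * p + 2) / fact (2 * p + 1) * power_lambert (2 * p + 1) (exp (- 2 * pi * (real (Suc m) * t)))
         - 1 / real (Suc m) ^ (2 * p + 2) / t ^ (2 * p + 2)) sums
         ((2 * pi) ^ (2 * p + 2) / fact (2 * p + 1) * sigma_sum (2 * p + 1) t - zeta_even p / t ^ (2 * p + 2))"
    using t by (intro sums_diff sums_divide sums_mult sums_zeta_even sums_power_lambert_sigma) auto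
  from sums_mult[OF this, of "(-1) ^ (p + 1) / 2"]
  show ?thesis
    unfolding lattice_value_def sums_lattice_row[OF t, THEN sums_unique, symmetric]
    by (simp add: power_mult_distrib del: of_nat_Suc power_Suc power_Suc2)
qed

text \<open>For \<open>p >= 1\<close> the terms are at most a constant times
  \<open>1 / (m n)^(p + 1)\<close>, hence at most a constant times \<open>1 / (m n)^2\<close>, and
  the series converges absolutely. Its two orders of summation then agree, and the inversion of the
  single terms turns one order into the other.\<close>

lemma lattice_value_inverse:
  assumes t: "t > 0" and p: "p \<ge> 1"
  shows "lattice_value p (1 / t) = (-1) ^ (p + 1) * t ^ (2 * p + 2) * lattice_value p t"
proof -
  have "\<bar>lattice_term p t m n\<bar> \<le> 1 / (2 * t) ^ (p + 1) / (real (Suc m) * real (Suc n)) ^ 2" for m n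
  proof -
    define u where "u = of_nat (Suc n) + \<i> * complex_of_real (real (Suc m) * t)"
    have "(2 * t * (real (Suc m) * real (Suc n))) ^ (p + 1) \<le> (norm u ^ 2) ^ (p + 1)"
      unfolding u_def using t by (intro power_mono norm_lattice_ge) auto
    moreover have "(2 * t) ^ (p + 1) * (real (Suc m) * real (Suc n)) ^ 2 \<le> (2 * t) ^ (p + 1) * (real (Suc m) * real (Suc n)) ^ (p + 1)"
      using p t by (intro mult_left_mono power_increasing) (auto simp: algebra_simps)
    ultimately have le: "(2 * t) ^ (p + 1) * (real (Suc m) * real (Suc n)) ^ 2 \<le> norm u ^ (2 * p + 2)"
      by (simp only: power_mult_distrib [of "2 * t"] power_mult [symmetric]) (simp add: algebra_simps)
    have "\<bar>lattice_term p t m n\<bar> \<le> norm (1 / u ^ (2 * p + 2))"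
      unfolding lattice_term_def u_def by (rule abs_Re_le_cmod)
    also have "\<dots> = 1 / norm u ^ (2 * p + 2)" by (simp only: norm_divide norm_power norm_one)
    also have "\<dots> \<le> 1 / ((2 * t) ^ (p + 1) * (real (Suc m) * real (Suc n)) ^ 2)"
    proof (rule divide_left_mono[OF le])
      have "Re u \<noteq> 0" by (simp add: u_def)
      then have "norm u > 0" by auto
      then show "0 < norm u ^ (2 * p + 2) * ((2 * t) ^ (p + 1) * (real (Suc m) * real (Suc n)) ^ 2)"
        using t by (intro mult_pos_pos zero_less_power) auto
    qed simp
    finally show ?thesis by (simp only: divide_divide_eq_left)
  qed
  then have summ: "(\<lambda>(m, n). lattice_term p t m n) summable_on (UNIV \<times> UNIV)"
    by (rule summable_on_inverse_square_product_comparison)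
  have row: "lattice_term p t m sums (\<Sum>n. lattice_term p t m n)" for m
    using sums_lattice_row[OF t, of p m] by (auto intro: summable_sums sums_summable)
  have C0: "(-1) ^ (p + 1) * t ^ (2 * p + 2) \<noteq> 0" using t by simp
  have inv: "lattice_term p t n m = lattice_term p (1 / t) m n / ((-1) ^ (p + 1) * t ^ (2 * p + 2))" for m n
    unfolding lattice_term_inverse[OF t] using t by simp
  have col: "(\<lambda>m. lattice_term p t m n) sums ((\<Sum>m. lattice_term p (1 / t) n m) / ((-1) ^ (p + 1) * t ^ (2 * p + 2)))" for n
    unfolding inv using sums_lattice_row[of "1 / t" p n] t
    by (intro sums_divide) (auto intro: summable_sums sums_summable)
  obtain S where S: "(\<lambda>m. \<Sum>n. lattice_term p t m n) sums S"
    "(\<lambda>n. (\<Sum>m. lattice_term p (1 / t) n m) / ((-1) ^ (p + 1) * t ^ (2 * p + 2))) sums S"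
    using iterated_sums_swap[OF summ row col] by blast
  have "S = lattice_value p t"
    by (rule sums_unique2[OF S(1) sums_sums_lattice_row[OF t]])
  moreover have "S = lattice_value p (1 / t) / ((-1) ^ (p + 1) * t ^ (2 * p + 2))"
    by (rule sums_unique2[OF S(2) sums_divide[OF sums_sums_lattice_row]]) (use t in simp)
  ultimately show ?thesis using C0 by (simp add: field_simps)
qed

text \<open>As \<open>x\<close> tends to 0 the terms of \<open>quarter_sum\<close> tend to
  \<open>1 / n ^ (2 * p + 2)\<close>, dominated by these same numbers. The zeta value thus becomes
  the constant term left when the pole of the polylogarithm at \<open>y = 1\<close> is
  subtracted.\<close>

lemma zeta_even_limit:
  "((\<lambda>x. (-1) ^ (p + 1) / 2 * ((2 * pi) ^ (2 * p + 2) / fact (2 * p + 1) * power_lambert (2 * p + 1) (exp (- 2 * pi * x))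
              - 1 / x ^ (2 * p + 2))) \<longlongrightarrow> zeta_even p) (at_right 0)"
proof -
  let ?a = "\<lambda>j (x::real). Re (1 / (of_nat (Suc j) + \<i> * of_real x) ^ (2 * p + 2))"
  have lim: "((\<lambda>x. ?a j x) \<longlongrightarrow> 1 / real (Suc j) ^ (2 * p + 2)) (at_right 0)" for j
  proof -
    have "((\<lambda>x. ?a j x) \<longlongrightarrow> Re (1 / (of_nat (Suc j) + \<i> * of_real 0) ^ (2 * p + 2))) (at_right 0)"
      by (intro tendsto_intros) (auto simp del: of_nat_Suc)
    moreover have "1 / (of_nat (Suc j) + \<i> * of_real 0) ^ (2 * p + 2) = complex_of_real (1 / real (Suc j) ^ (2 * p + 2))"
      by simp
    ultimately show ?thesis by (simp only: Re_complex_of_real)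
  qed
  have bound: "norm (?a j x) \<le> 1 / real (Suc j) ^ (2 * p + 2)" for j x
  proof -
    let ?u = "of_nat (Suc j) + \<i> * complex_of_real x"
    have "real (Suc j) \<le> norm ?u"
      using abs_Re_le_cmod[of ?u] by simp
    then have "1 / norm ?u ^ (2 * p + 2) \<le> 1 / real (Suc j) ^ (2 * p + 2)"
      by (intro divide_left_mono power_mono mult_pos_pos zero_less_power) auto
    moreover have "norm (?a j x) \<le> norm (1 / ?u ^ (2 * p + 2))"
      unfolding real_norm_def by (rule abs_Re_le_cmod)
    ultimately show ?thesis by (simp only: norm_divide norm_power norm_one)
  qed
  have "((\<lambda>x. \<Sum>j. ?a j x) \<longlongrightarrow> zeta_even p) (at_right 0)"
    unfolding zeta_even_def
    by (rule tannerys_theorem[THEN conjunct2, THEN conjunct2, OF lim always_eventually])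
       (use bound sums_summable[OF sums_zeta_even[of p]] in \<open>auto simp del: of_nat_Suc\<close>)
  moreover have "\<forall>\<^sub>F x in at_right 0. (\<Sum>j. ?a j x) = (-1) ^ (p + 1) / 2 * ((2 * pi) ^ (2 * p + 2) / fact (2 * p + 1) * power_lambert (2 * p + 1) (exp (- 2 * pi * x))
              - 1 / x ^ (2 * p + 2))"
    using eventually_at_right_less[of 0]
    by eventually_elim (rule sums_unique [symmetric], rule quarter_sum)
  ultimately show ?thesis
    by (rule Lim_transform_eventually)
qed

lemma power_lambert_Suc_eq:
  fixes y :: real
  assumes "0 < y" "y < 1"
  assumes "\<And>y::real. 0 < y \<Longrightarrow> y < 1 \<Longrightarrow> power_lambert j y = f y"
  assumes "(f has_real_derivative D) (at y)" "k = Suc j"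
  shows "power_lambert k y = y * D"
proof -
  have "(f has_real_derivative power_lambert (Suc j) y / y) (at y)"
    by (rule has_field_derivative_transform_within_open[OF DERIV_power_lambert, where S = "{0<..<1}"])
       (use assms in auto)
  from DERIV_unique[OF this assms(4)] show ?thesis using assms by (simp add: field_simps)
qed

text \<open>The numerators are \<open>y\<close> times the Eulerian polynomials; each order arises
  from the preceding one by the operator \<open>y d/dy\<close>, so the even orders 2 and 4 appear on
  the way.\<close>

lemma power_lambert_closed:
  fixes y :: real
  assumes "0 < y" "y < 1"
  shows "power_lambert 1 y = y / (1 - y) ^ 2"
    and "power_lambert 3 y = y * (1 + 4 * y + y ^ 2) / (1 - y) ^ 4"
    and "power_lambert 5 y = y * (1 + 26 * y + 66 * y ^ 2 + 26 * y ^ 3 + y ^ 4) / (1 - y) ^ 6"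
proof -
  have 0: "power_lambert 0 y = 1 / (1 - y)" if "0 < y" "y < 1" for y :: real
    using that by (simp add: power_lambert_0)
  have 1: "power_lambert 1 y = y / (1 - y) ^ 2" if y: "0 < y" "y < 1" for y :: real
  proof -
    have "((\<lambda>y. 1 / (1 - y)) has_real_derivative (1) / (1 - y) ^ 2) (at y)"
      using y by (auto intro!: derivative_eq_intros simp: divide_simps) (simp_all add: algebra_simps eval_nat_numeral)?
    from power_lambert_Suc_eq[OF y 0 this, of 1] show ?thesis by simp
  qed
  have 2: "power_lambert 2 y = y * (1 + y) / (1 - y) ^ 3" if y: "0 < y" "y < 1" for y :: real
  proof -
    have "((\<lambda>y. y / (1 - y) ^ 2) has_real_derivative (1 + y) / (1 - y) ^ 3) (at y)"
      using y by (auto intro!: derivative_eq_intros simp: divide_simps) (simp_all add: algebra_simps eval_nat_numeral)?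
    from power_lambert_Suc_eq[OF y 1 this, of 2] show ?thesis by simp
  qed
  have 3: "power_lambert 3 y = y * (1 + 4 * y + y ^ 2) / (1 - y) ^ 4" if y: "0 < y" "y < 1" for y :: real
  proof -
    have "((\<lambda>y. y * (1 + y) / (1 - y) ^ 3) has_real_derivative (1 + 4 * y + y ^ 2) / (1 - y) ^ 4) (at y)"
      using y by (auto intro!: derivative_eq_intros simp: divide_simps) (simp_all add: algebra_simps eval_nat_numeral)?
    from power_lambert_Suc_eq[OF y 2 this, of 3] show ?thesis by simp
  qed
  have 4: "power_lambert 4 y = y * (1 + 11 * y + 11 * y ^ 2 + y ^ 3) / (1 - y) ^ 5" if y: "0 < y" "y < 1" for y :: real
  proof -
    have "((\<lambda>y. y * (1 + 4 * y + y ^ 2) / (1 - y) ^ 4) has_real_derivative (1 + 11 * y + 11 * y ^ 2 + y ^ 3) / (1 - y) ^ 5) (at y)"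
      using y by (auto intro!: derivative_eq_intros simp: divide_simps) (simp_all add: algebra_simps eval_nat_numeral)?
    from power_lambert_Suc_eq[OF y 3 this, of 4] show ?thesis by simp
  qed
  have 5: "power_lambert 5 y = y * (1 + 26 * y + 66 * y ^ 2 + 26 * y ^ 3 + y ^ 4) / (1 - y) ^ 6" if y: "0 < y" "y < 1" for y :: real
  proof -
    have "((\<lambda>y. y * (1 + 11 * y + 11 * y ^ 2 + y ^ 3) / (1 - y) ^ 5) has_real_derivative (1 + 26 * y + 66 * y ^ 2 + 26 * y ^ 3 + y ^ 4) / (1 - y) ^ 6) (at y)"
      using y by (auto intro!: derivative_eq_intros simp: divide_simps) (simp_all add: algebra_simps eval_nat_numeral)?
    from power_lambert_Suc_eq[OF y 4 this, of 5] show ?thesis by simp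
  qed
  show "power_lambert 1 y = y / (1 - y) ^ 2"
    and "power_lambert 3 y = y * (1 + 4 * y + y ^ 2) / (1 - y) ^ 4"
    and "power_lambert 5 y = y * (1 + 26 * y + 66 * y ^ 2 + 26 * y ^ 3 + y ^ 4) / (1 - y) ^ 6"
    using 1 3 5 assms by auto
qed

text \<open>The substitution \<open>u = 2 * pi * x\<close> removes all powers of \<open>pi\<close>
  from the limit, which leaves a rational number \<open>L\<close> to be read off from an expansion
  at 0.\<close>

lemma zeta_even_eqI:
  assumes "\<And>y. 0 < y \<Longrightarrow> y < 1 \<Longrightarrow> power_lambert (2 * p + 1) y = f y"
  assumes "((\<lambda>u. f (exp (- u)) / fact (2 * p + 1) - 1 / u ^ (2 * p + 2)) \<longlongrightarrow> L) (at_right 0)"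
  shows "zeta_even p = (-1) ^ (p + 1) / 2 * (2 * pi) ^ (2 * p + 2) * L"
proof -
  have "filterlim (\<lambda>x::real. 2 * pi * x) (at_right 0) (at_right 0)"
    by real_asymp
  from tendsto_mult_left[OF filterlim_compose[OF assms(2) this], of "(-1) ^ (p + 1) / 2 * (2 * pi) ^ (2 * p + 2)"]
  have lim: "((\<lambda>x. (-1) ^ (p + 1) / 2 * (2 * pi) ^ (2 * p + 2) * (f (exp (- (2 * pi * x))) / fact (2 * p + 1) - 1 / (2 * pi * x) ^ (2 * p + 2)))
     \<longlongrightarrow> (-1) ^ (p + 1) / 2 * (2 * pi) ^ (2 * p + 2) * L) (at_right 0)" .
  have "\<forall>\<^sub>F x in at_right 0. (-1) ^ (p + 1) / 2 * ((2 * pi) ^ (2 * p + 2) / fact (2 * p + 1) * power_lambert (2 * p + 1) (exp (- 2 * pi * x)) - 1 / x ^ (2 * p + 2)) =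
     (-1) ^ (p + 1) / 2 * (2 * pi) ^ (2 * p + 2) * (f (exp (- (2 * pi * x))) / fact (2 * p + 1) - 1 / (2 * pi * x) ^ (2 * p + 2))"
    using eventually_at_right_less[of 0]
  proof eventually_elim
    case (elim x)
    then have "power_lambert (2 * p + 1) (exp (- 2 * pi * x)) = f (exp (- (2 * pi * x)))"
      using assms(1)[of "exp (- 2 * pi * x)"] by simp
    then show ?case
      using elim unfolding power_mult_distrib [of "2 * pi"] by (simp add: right_diff_distrib mult.assoc del: power_Suc)
  qed
  from Lim_transform_eventually[OF zeta_even_limit this] lim
  show ?thesis by (rule tendsto_unique[OF trivial_limit_at_right_real])
qed

text \<open>The three limits are \<open>- B / k!\<close>, with \<open>B\<close> the Bernoulli number
  of index \<open>k = 2, 4, 6\<close>.\<close>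

lemma zeta_even_values: "zeta_even 0 = pi ^ 2 / 6" "zeta_even 1 = pi ^ 4 / 90" "zeta_even 2 = pi ^ 6 / 945"
proof -
  have "((\<lambda>u::real. exp (- u) / (1 - exp (- u)) ^ 2 - 1 / u ^ 2) \<longlongrightarrow> - 1 / 12) (at_right 0)"
    by real_asymp
  then show "zeta_even 0 = pi ^ 2 / 6"
    using zeta_even_eqI[of 0 "\<lambda>y. y / (1 - y) ^ 2" "- 1 / 12"] power_lambert_closed(1) by (simp add: power2_eq_square)
  have "((\<lambda>u::real. exp (- u) * (1 + 4 * exp (- u) + exp (- u) ^ 2) / (1 - exp (- u)) ^ 4 / 6 - 1 / u ^ 4) \<longlongrightarrow> 1 / 720) (at_right 0)"
    by real_asymp
  then show "zeta_even 1 = pi ^ 4 / 90"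
    using zeta_even_eqI[of 1 "\<lambda>y. y * (1 + 4 * y + y ^ 2) / (1 - y) ^ 4" "1 / 720"] power_lambert_closed(2)
    by (simp add: fact_numeral power_mult_distrib)
  have "((\<lambda>u::real. exp (- u) * (1 + 26 * exp (- u) + 66 * exp (- u) ^ 2 + 26 * exp (- u) ^ 3 + exp (- u) ^ 4) / (1 - exp (- u)) ^ 6 / 120 - 1 / u ^ 6)
      \<longlongrightarrow> - 1 / 30240) (at_right 0)"
  proof -
    \<comment> \<open>For weight 6 the pole is removed algebraically. The quotient
      \<open>exp (- u) / (1 - exp (- u)) ^ 2\<close> equals \<open>1 / (4 sinh (u/2)^2) = 1/u^2 -
      1/12 + u^2/240 - u^4/6048 + ...\<close>; \<open>d\<close> is the scaled remainder after three
      terms and \<open>r\<close> everything after the pole.\<close>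
    define d where "d = (\<lambda>u::real. (exp (- u) / (1 - exp (- u)) ^ 2 - 1 / u ^ 2 + 1 / 12 - u ^ 2 / 240) / u ^ 4)"
    define r where "r = (\<lambda>u. - 1 / 12 + u ^ 2 / 240 + d u * u ^ 4)"
    have d: "(d \<longlongrightarrow> - 1 / 6048) (at_right 0)"
      unfolding d_def by real_asymp
    have u: "((\<lambda>u::real. u) \<longlongrightarrow> 0) (at_right 0)"
      by (rule tendsto_ident_at)
    have r: "(r \<longlongrightarrow> - 1 / 12 + 0 ^ 2 / 240 + - 1 / 6048 * 0 ^ 4) (at_right 0)"
      unfolding r_def by (intro tendsto_intros d u) auto
    have "((\<lambda>u. 3 * d u + 3 * u ^ 2 * (1 / 240 + d u * u ^ 2) ^ 2 + r u ^ 3 + r u ^ 2 / 4 + r u / 120) \<longlongrightarrow>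
        3 * (- 1 / 6048) + 3 * 0 ^ 2 * (1 / 240 + - 1 / 6048 * 0 ^ 2) ^ 2 + (- 1 / 12 + 0 ^ 2 / 240 + - 1 / 6048 * 0 ^ 4) ^ 3
           + (- 1 / 12 + 0 ^ 2 / 240 + - 1 / 6048 * 0 ^ 4) ^ 2 / 4 + (- 1 / 12 + 0 ^ 2 / 240 + - 1 / 6048 * 0 ^ 4) / 120) (at_right 0)"
      by (intro tendsto_intros d u r) auto
    then have "((\<lambda>u. 3 * d u + 3 * u ^ 2 * (1 / 240 + d u * u ^ 2) ^ 2 + r u ^ 3 + r u ^ 2 / 4 + r u / 120) \<longlongrightarrow> - 1 / 30240) (at_right 0)"
      by (simp add: power2_eq_square power3_eq_cube)
    moreover have "\<forall>\<^sub>F u in at_right 0. 3 * d u + 3 * u ^ 2 * (1 / 240 + d u * u ^ 2) ^ 2 + r u ^ 3 + r u ^ 2 / 4 + r u / 120 =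
       exp (- u) * (1 + 26 * exp (- u) + 66 * exp (- u) ^ 2 + 26 * exp (- u) ^ 3 + exp (- u) ^ 4) / (1 - exp (- u)) ^ 6 / 120 - 1 / u ^ 6"
      using eventually_at_right_less[of 0]
    proof eventually_elim
      case (elim u)
      define y w where "y = exp (- u)" and "w = 1 / u ^ 2"
      define s where "s = y / (1 - y) ^ 2"
      have y: "y \<noteq> 1" using elim by (simp add: y_def)
      have wu: "w * u ^ 2 = 1" using elim by (simp add: w_def)
      have sr: "s = w + r u"
        using elim by (simp add: s_def y_def r_def d_def w_def)
      define e where "e = 1 / 240 + d u * u ^ 2"
      have re: "r u = u ^ 2 * e - 1 / 12"
        by (simp add: r_def e_def algebra_simps eval_nat_numeral)
      \<comment> \<open>The palindromic numerator makes order 5 a cubic polynomial in order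
        1.\<close>
      have "y * (1 + 26 * y + 66 * y ^ 2 + 26 * y ^ 3 + y ^ 4) / (1 - y) ^ 6 = s * (1 + 30 * s + 120 * s ^ 2)"
        using y unfolding s_def by (simp add: divide_simps) (simp add: algebra_simps eval_nat_numeral)
      \<comment> \<open>With \<open>s = w + r u\<close>, the terms in \<open>w ^ 2\<close> cancel
        because \<open>r\<close> starts with \<open>- 1 / 12\<close>. In the next step those in
        \<open>w\<close> cancel because \<open>360 / 240 = 3 / 2\<close>, so that only the pole
        \<open>120 * w ^ 3\<close> survives.\<close>
      also have "\<dots> = 120 * w ^ 3 + (w * (360 * (w * u ^ 2) * (1 / 240 + d u * u ^ 2) + (- 3 / 2 + 360 * u ^ 4 * (1 / 240 + d u * u ^ 2) ^ 2))
          + (120 * r u ^ 3 + 30 * r u ^ 2 + r u))"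
        unfolding sr e_def [symmetric] re by (simp add: algebra_simps eval_nat_numeral)
      also have "\<dots> = 120 * w ^ 3 + 360 * d u * (w * u ^ 2) + 360 * u ^ 2 * (w * u ^ 2) * (1 / 240 + d u * u ^ 2) ^ 2
          + (120 * r u ^ 3 + 30 * r u ^ 2 + r u)"
      proof -
        have "w * (360 * 1 * e + (- 3 / 2 + 360 * u ^ 4 * e ^ 2)) = 360 * d u * (w * u ^ 2) + 360 * u ^ 2 * (w * u ^ 2) * e ^ 2"
          by (simp add: e_def algebra_simps eval_nat_numeral)
        then show ?thesis unfolding wu e_def [symmetric] by linarith
      qed
      finally have E: "y * (1 + 26 * y + 66 * y ^ 2 + 26 * y ^ 3 + y ^ 4) / (1 - y) ^ 6 =
          120 * w ^ 3 + 360 * d u * (w * u ^ 2) + 360 * u ^ 2 * (w * u ^ 2) * (1 / 240 + d u * u ^ 2) ^ 2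
          + (120 * r u ^ 3 + 30 * r u ^ 2 + r u)" .
      have "w ^ 3 = 1 / u ^ 6" by (simp add: w_def power_divide)
      then show ?case
        unfolding y_def [symmetric] E wu by (simp add: add_divide_distrib)
    qed
    ultimately show ?thesis by (rule Lim_transform_eventually)
  qed
  then show "zeta_even 2 = pi ^ 6 / 945"
    using zeta_even_eqI[of 2 "\<lambda>y. y * (1 + 26 * y + 66 * y ^ 2 + 26 * y ^ 3 + y ^ 4) / (1 - y) ^ 6" "- 1 / 30240"] power_lambert_closed(3)
    by (simp add: fact_numeral power_mult_distrib)
qed

text \<open>Comparison with an integral: the summand is the value at \<open>x = m + 1\<close> of a
  decreasing function with antiderivative \<open>arctan (x * t / a) / t\<close>, so the sum lies
  between its integrals from 1 and from 0 to infinity.\<close>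

lemma sums_arctan_kernel_bounds:
  fixes a t :: real
  assumes "a > 0" "t > 0"
  obtains S where "(\<lambda>m. a / (a ^ 2 + (real (Suc m) * t) ^ 2)) sums S"
    "(pi / 2 - arctan (t / a)) / t \<le> S" "S \<le> pi / (2 * t)"
proof -
  define F where "F = (\<lambda>x. arctan (x * t / a) / t)"
  define g where "g = (\<lambda>m. a / (a ^ 2 + (real m * t) ^ 2))"
  have F': "(F has_real_derivative a / (a ^ 2 + (x * t) ^ 2)) (at x)" for x
    unfolding F_def using assms
    by (auto intro!: derivative_eq_intros simp: divide_simps add_nonneg_eq_0_iff)
       (simp_all add: algebra_simps power2_eq_square add_nonneg_eq_0_iff)
  have anti: "a / (a ^ 2 + (x * t) ^ 2) \<le> a / (a ^ 2 + (y * t) ^ 2)" if "0 \<le> y" "y \<le> x" for x y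
    using assms that by (intro divide_left_mono add_left_mono power_mono mult_right_mono mult_pos_pos add_pos_nonneg) auto
  have step: "F (real (Suc m)) - F (real m) \<le> g m" "g (Suc m) \<le> F (real (Suc m)) - F (real m)" for m
  proof -
    obtain z where z: "real m < z" "z < real (Suc m)"
      "F (real (Suc m)) - F (real m) = (real (Suc m) - real m) * (a / (a ^ 2 + (z * t) ^ 2))"
      using MVT2[of "real m" "real (Suc m)" F "\<lambda>x. a / (a ^ 2 + (x * t) ^ 2)"] F' by auto
    show "F (real (Suc m)) - F (real m) \<le> g m" "g (Suc m) \<le> F (real (Suc m)) - F (real m)"
      using z anti[of "real m" z] anti[of z "real (Suc m)"] by (auto simp: g_def)
  qed
  have "filterlim (\<lambda>m. real m * t / a) at_top sequentially"
    using assms by real_asymp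
  then have F: "(\<lambda>m. F (real m)) \<longlonglongrightarrow> pi / 2 / t"
    unfolding F_def by (intro tendsto_divide filterlim_compose[OF tendsto_arctan_at_top]) (use assms in auto)
  have F1: "(\<lambda>m. F (real (Suc m)) - F (real m)) sums (pi / 2 / t - F (real 0))"
    by (rule telescope_sums[OF F])
  have F2: "(\<lambda>m. F (real (Suc (Suc m))) - F (real (Suc m))) sums (pi / 2 / t - F (real (Suc 0)))"
    by (rule telescope_sums[OF LIMSEQ_Suc[OF F]])
  have "summable (\<lambda>m. g (Suc m))"
    by (rule summable_comparison_test'[OF sums_summable[OF F1], of 0]) (use step assms in \<open>auto simp: g_def\<close>)
  then have S: "(\<lambda>m. g (Suc m)) sums (\<Sum>m. g (Suc m))" by (rule summable_sums)
  show ?thesis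
  proof (rule that)
    show "(\<lambda>m. a / (a ^ 2 + (real (Suc m) * t) ^ 2)) sums (\<Sum>m. g (Suc m))"
      using S unfolding g_def .
    show "(pi / 2 - arctan (t / a)) / t \<le> (\<Sum>m. g (Suc m))"
    proof -
      have "pi / 2 / t - F (real (Suc 0)) \<le> (\<Sum>m. g (Suc m))"
        by (rule sums_le[OF _ F2 S]) (rule step(1))
      then show ?thesis by (simp add: F_def diff_divide_distrib)
    qed
    show "(\<Sum>m. g (Suc m)) \<le> pi / (2 * t)"
      using sums_le[OF _ S F1] step(2) by (simp add: F_def)
  qed
qed

text \<open>
  In weight 2 the double series converges only conditionally. It differs by an absolutely convergent one from
  the series over \<open>1/(u - 1/2) - 1/(u + 1/2)\<close>, \<open>u\<close> the lattice point, whose iterated sums telescope;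
  there the two orders of summation differ by \<open>\<pi>/(2t)\<close>.
\<close>

lemma lattice_value_inverse_0:
  assumes t: "t > 0"
  shows "lattice_value 0 (1 / t) = - (t ^ 2) * (lattice_value 0 t - pi / (2 * t))"
proof -
  define u where "u = (\<lambda>m n. of_nat (Suc n) + \<i> * complex_of_real (real (Suc m) * t))"
  \<comment> \<open>Real part of the reciprocal at the midpoint \<open>k + 1/2\<close> of the row:
    \<open>u - 1/2\<close> is the point of index \<open>n\<close> and \<open>u + 1/2\<close> that of
    index \<open>n + 1\<close>, so \<open>h\<close> telescopes along rows.\<close>
  define g where "g = (\<lambda>k m. (real k + 1 / 2) / ((real k + 1 / 2) ^ 2 + (real (Suc m) * t) ^ 2))"
  define h where "h = (\<lambda>m n. g n m - g (Suc n) m)"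
  define G where "G = (\<lambda>k. \<Sum>m. g k m)"
  have g_eq: "g k m = Re (1 / (of_nat k + 1 / 2 + \<i> * of_real (real (Suc m) * t)))" for k m
    by (simp add: g_def Re_divide cmod_power2 power2_eq_square)
  have G: "g k sums G k" "(pi / 2 - arctan (t / (real k + 1 / 2))) / t \<le> G k" "G k \<le> pi / (2 * t)" for k
    using sums_arctan_kernel_bounds[of "real k + 1 / 2" t] t sums_unique unfolding g_def G_def by (metis add_nonneg_pos half_gt_zero_iff of_nat_0_le_iff zero_less_one)+
  have G_lim: "G \<longlonglongrightarrow> pi / (2 * t)"
  proof (rule tendsto_sandwich)
    show "(\<lambda>k. (pi / 2 - arctan (t / (real k + 1 / 2))) / t) \<longlonglongrightarrow> pi / (2 * t)"
    proof -
      have "(\<lambda>k. (pi / 2 - arctan (t / (real k + 1 / 2))) / t) \<longlonglongrightarrow> pi * inverse t / 2"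
        using t by real_asymp
      moreover have "pi * inverse t / 2 = pi / (2 * t)"
        using t by (simp add: field_simps)
      ultimately show ?thesis by (simp only:)
    qed
    show "\<forall>\<^sub>F k in sequentially. (pi / 2 - arctan (t / (real k + 1 / 2))) / t \<le> G k"
      "\<forall>\<^sub>F k in sequentially. G k \<le> pi / (2 * t)" "(\<lambda>_. pi / (2 * t)) \<longlonglongrightarrow> pi / (2 * t)"
      using G by auto
  qed
  have diff: "\<bar>lattice_term 0 t m n - h m n\<bar> \<le> 1 / (12 * t ^ 2) / (real (Suc m) * real (Suc n)) ^ 2" for m n
  proof -
    let ?u = "u m n" and ?P = "real (Suc m) * real (Suc n)"
    have n1: "norm ?u \<ge> 1"
      using abs_Re_le_cmod[of ?u] by (simp add: u_def)
    then have n2: "norm (?u ^ 2) \<ge> 1" by (simp add: norm_power one_le_power)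
    have Im: "Im ?u \<noteq> 0" using t by (simp add: u_def)
    have nz: "?u \<noteq> 0" "?u - 1 / 2 \<noteq> 0" "?u + 1 / 2 \<noteq> 0"
      using Im by (auto simp: complex_eq_iff)
    have factor: "?u ^ 2 - 1 / 4 = (?u - 1 / 2) * (?u + 1 / 2)"
      by (simp add: algebra_simps power2_eq_square)
    have nz': "?u ^ 2 - 1 / 4 \<noteq> 0" unfolding factor using nz by simp
    have "lattice_term 0 t m n - h m n = Re (1 / ?u ^ 2 - (1 / (?u - 1 / 2) - 1 / (?u + 1 / 2)))"
    proof -
      have "of_nat n + 1 / 2 + \<i> * of_real (real (Suc m) * t) = ?u - 1 / 2"
        "of_nat (Suc n) + 1 / 2 + \<i> * of_real (real (Suc m) * t) = ?u + 1 / 2"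
        by (simp_all add: u_def complex_eq_iff)
      then have "h m n = Re (1 / (?u - 1 / 2)) - Re (1 / (?u + 1 / 2))"
        unfolding h_def g_eq by (simp only:)
      moreover have "lattice_term 0 t m n = Re (1 / ?u ^ 2)"
        unfolding lattice_term_def u_def by (simp only: mult_0_right add_0)
      ultimately show ?thesis by (simp only: minus_complex.sel)
    qed
    \<comment> \<open>The subtraction improves the decay from order 2 to order 4, which is enough
      for absolute convergence.\<close>
    also have "1 / ?u ^ 2 - (1 / (?u - 1 / 2) - 1 / (?u + 1 / 2)) = - (1 / 4) / (?u ^ 2 * (?u ^ 2 - 1 / 4))"
    proof -
      have "1 / (?u - 1 / 2) - 1 / (?u + 1 / 2) = 1 / (?u ^ 2 - 1 / 4)"
        using nz unfolding factor by (simp add: diff_frac_eq)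
      moreover have "1 / ?u ^ 2 - 1 / (?u ^ 2 - 1 / 4) = - (1 / 4) / (?u ^ 2 * (?u ^ 2 - 1 / 4))"
        using nz(1) nz' by (simp add: diff_frac_eq)
      ultimately show ?thesis by (simp only:)
    qed
    also have "\<bar>Re \<dots>\<bar> \<le> norm \<dots>" by (rule abs_Re_le_cmod)
    also have "\<dots> = 1 / 4 / (norm (?u ^ 2) * norm (?u ^ 2 - 1 / 4))"
      by (simp add: norm_divide norm_mult)
    also have "\<dots> \<le> 1 / 4 / (norm (?u ^ 2) * (3 / 4 * norm (?u ^ 2)))"
    proof -
      have "norm (?u ^ 2 - 1 / 4) \<ge> norm (?u ^ 2) - norm (1 / 4 :: complex)"
        by (rule norm_triangle_ineq2)
      then have *: "norm (?u ^ 2 - 1 / 4) \<ge> 3 / 4 * norm (?u ^ 2)" using n2 by simp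
      then have "norm (?u ^ 2) * (3 / 4 * norm (?u ^ 2)) \<le> norm (?u ^ 2) * norm (?u ^ 2 - 1 / 4)"
        by (rule mult_left_mono) simp
      moreover have "0 < norm (?u ^ 2) * (3 / 4 * norm (?u ^ 2))"
        using n2 by (intro mult_pos_pos) auto
      ultimately show ?thesis by (intro frac_le) simp_all
    qed
    also have "\<dots> = 1 / 3 / norm (?u ^ 2) ^ 2" by (simp add: power2_eq_square)
    also have "\<dots> \<le> 1 / 3 / (2 * t * ?P) ^ 2"
    proof -
      have "(2 * t * ?P) ^ 2 \<le> norm (?u ^ 2) ^ 2"
        unfolding norm_power u_def using t by (intro power_mono norm_lattice_ge) auto
      moreover have "0 < (2 * t * ?P) ^ 2" using t by simp
      ultimately show ?thesis by (intro frac_le) simp_all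
    qed
    also have "\<dots> = 1 / (12 * t ^ 2) / ?P ^ 2" by (simp add: power_mult_distrib)
    finally show ?thesis .
  qed
  have summ: "(\<lambda>(m, n). lattice_term 0 t m n - h m n) summable_on (UNIV \<times> UNIV)"
    using diff by (rule summable_on_inverse_square_product_comparison)
  have row_h: "h m sums g 0 m" for m
  proof -
    have "(\<lambda>k. g k m) \<longlonglongrightarrow> 0"
      unfolding g_def by real_asymp
    from telescope_sums'[OF this] show ?thesis by (simp add: h_def [abs_def])
  qed
  have col_h: "(\<lambda>m. h m n) sums (G n - G (Suc n))" for n
    unfolding h_def by (intro sums_diff G)
  have row: "lattice_term 0 t m sums (\<Sum>n. lattice_term 0 t m n)" for m
    using sums_lattice_row[OF t, of 0 m] by (auto intro: summable_sums sums_summable)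
  have inv: "lattice_term 0 t n m = - lattice_term 0 (1 / t) m n / t ^ 2" for m n
    using lattice_term_inverse[OF t, of 0 m n] t by (simp add: power2_eq_square)
  have "lattice_term 0 (1 / t) n sums (\<Sum>m. lattice_term 0 (1 / t) n m)" for n
    using sums_lattice_row[of "1 / t" 0 n] t by (auto intro: summable_sums sums_summable)
  from sums_divide[OF sums_minus[OF this], where c = "t ^ 2"]
  have col: "(\<lambda>m. lattice_term 0 t m n) sums (- (\<Sum>m. lattice_term 0 (1 / t) n m) / t ^ 2)" for n
    by (simp only: inv)
  \<comment> \<open>By rows the comparison series sums to \<open>G 0\<close>. By columns it sums to
    \<open>G 0\<close> minus the limit of \<open>G\<close>, because the columns \<open>G n\<close>
    tend to \<open>pi / (2 * t)\<close> and not to 0; this is the source of the anomaly of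
    \<open>E2\<close>.\<close>
  obtain S where S: "(\<lambda>m. (\<Sum>n. lattice_term 0 t m n) - g 0 m) sums S"
    "(\<lambda>n. - (\<Sum>m. lattice_term 0 (1 / t) n m) / t ^ 2 - (G n - G (Suc n))) sums S"
    using iterated_sums_swap[OF summ sums_diff[OF row row_h] sums_diff[OF col col_h]] by blast
  have "S = lattice_value 0 t - G 0"
    by (rule sums_unique2[OF S(1) sums_diff[OF sums_sums_lattice_row[OF t] G(1)]])
  moreover have "S = - lattice_value 0 (1 / t) / t ^ 2 - (G 0 - pi / (2 * t))"
    by (rule sums_unique2[OF S(2)], intro sums_diff sums_divide sums_minus sums_sums_lattice_row telescope_sums'[OF G_lim])
       (use t in simp)
  ultimately show ?thesis using t by (simp add: field_simps power2_eq_square)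
qed

section \<open>Transformation laws of the Eisenstein series for real \<open>t\<close>\<close>

definition E2r :: "real \<Rightarrow> real" where
  "E2r t = 1 - 24 * sigma_sum 1 t"

definition E4r :: "real \<Rightarrow> real" where
  "E4r t = 1 + 240 * sigma_sum 3 t"

definition E6r :: "real \<Rightarrow> real" where
  "E6r t = 1 - 504 * sigma_sum 5 t"

text \<open>The full lattice sum of weight \<open>k\<close> is \<open>2 zeta(k)\<close> times the
  Eisenstein series. Removing the two axes subtracts \<open>1\<close> and
  \<open>1 / (\<i> * t)^k\<close> from the series, and the quadrant is a quarter of the rest; hence
  the factor \<open>zeta(k) / 2\<close>.\<close>

lemma lattice_value_Eisenstein:
  "lattice_value 0 t = pi ^ 2 / 12 * (E2r t - 1 + 1 / t ^ 2)"
  "lattice_value 1 t = pi ^ 4 / 180 * (E4r t - 1 - 1 / t ^ 4)"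
  "lattice_value 2 t = pi ^ 6 / 1890 * (E6r t - 1 + 1 / t ^ 6)"
  by (simp_all add: lattice_value_def E2r_def E4r_def E6r_def zeta_even_values fact_numeral
        power_mult_distrib right_diff_distrib flip: One_nat_def)

text \<open>The inversion interchanges the two axis terms, so they drop out. The correction
  \<open>pi / (2 * t)\<close>, multiplied by \<open>t ^ 2\<close> and divided by
  \<open>pi ^ 2 / 12\<close>, becomes \<open>6 * t / pi\<close>.\<close>

lemma E2r_inverse:
  assumes "t > 0"
  shows "E2r (1 / t) = - (t ^ 2) * E2r t + 6 * t / pi"
proof -
  have "- (t ^ 2) * (pi ^ 2 / 12 * X - pi / (2 * t)) = pi ^ 2 / 12 * (- (t ^ 2) * X + 6 * t / pi)" for X
    using assms by (simp add: field_simps power2_eq_square)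
  then have "pi ^ 2 / 12 * (E2r (1 / t) - 1 + t ^ 2) = pi ^ 2 / 12 * (- (t ^ 2) * (E2r t - 1 + 1 / t ^ 2) + 6 * t / pi)"
    using lattice_value_inverse_0[OF assms]
    unfolding lattice_value_Eisenstein by (simp add: power_one_over)
  then have "E2r (1 / t) - 1 + t ^ 2 = - (t ^ 2) * (E2r t - 1 + 1 / t ^ 2) + 6 * t / pi"
    by (subst (asm) mult_cancel_left) auto
  then show ?thesis using assms by (simp add: algebra_simps)
qed

lemma E4r_inverse:
  assumes "t > 0"
  shows "E4r (1 / t) = t ^ 4 * E4r t"
proof -
  have "pi ^ 4 / 180 * (E4r (1 / t) - 1 - t ^ 4) = pi ^ 4 / 180 * (t ^ 4 * (E4r t - 1 - 1 / t ^ 4))"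
    using lattice_value_inverse[OF assms, of 1]
    unfolding lattice_value_Eisenstein by (simp add: power_one_over)
  then have "E4r (1 / t) - 1 - t ^ 4 = t ^ 4 * (E4r t - 1 - 1 / t ^ 4)"
    by (subst (asm) mult_cancel_left) auto
  then show ?thesis using assms by (simp add: algebra_simps)
qed

lemma E6r_inverse:
  assumes "t > 0"
  shows "E6r (1 / t) = - (t ^ 6) * E6r t"
proof -
  have "pi ^ 6 / 1890 * (E6r (1 / t) - 1 + t ^ 6) = pi ^ 6 / 1890 * (- (t ^ 6) * (E6r t - 1 + 1 / t ^ 6))"
    using lattice_value_inverse[OF assms, of 2]
    unfolding lattice_value_Eisenstein by (simp add: power_one_over)
  then have "E6r (1 / t) - 1 + t ^ 6 = - (t ^ 6) * (E6r t - 1 + 1 / t ^ 6)"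
    by (subst (asm) mult_cancel_left) auto
  then show ?thesis using assms by (simp add: algebra_simps)
qed

section \<open>Inversion of the thetanull functions\<close>

lemma cos_multiple_power_expansion:
  "(2 * cos x) ^ (2 * m) = real (2 * m choose m) + 2 * (\<Sum>d\<in>{1..m}. real (2 * m choose (m + d)) * cos (2 * real d * x))"
proof -
  define f where "f = (\<lambda>j. real (2 * m choose j) * cos (2 * (real j - real m) * x))"
  have e: "complex_of_real (2 * cos x) = cis x + cis (- x)"
    by (simp add: complex_eq_iff)
  have "complex_of_real ((2 * cos x) ^ (2 * m)) = (cis x + cis (- x)) ^ (2 * m)"
    by (simp only: of_real_power e)
  also have "\<dots> = (\<Sum>j\<le>2 * m. of_nat (2 * m choose j) * cis x ^ j * cis (- x) ^ (2 * m - j))"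
    by (rule binomial_ring)
  also have "\<dots> = (\<Sum>j\<le>2 * m. of_nat (2 * m choose j) * cis (2 * (real j - real m) * x))"
  proof (rule sum.cong)
    fix j assume j: "j \<in> {..2 * m}"
    have "cis x ^ j * cis (- x) ^ (2 * m - j) = cis (real j * x + real (2 * m - j) * (- x))"
      by (simp only: Complex.DeMoivre cis_mult)
    also have "real j * x + real (2 * m - j) * (- x) = 2 * (real j - real m) * x"
      using j by (simp add: of_nat_diff algebra_simps)
    finally show "of_nat (2 * m choose j) * cis x ^ j * cis (- x) ^ (2 * m - j) =
        of_nat (2 * m choose j) * cis (2 * (real j - real m) * x)" by (simp add: mult.assoc)
  qed simp
  finally have "Re (complex_of_real ((2 * cos x) ^ (2 * m))) = (\<Sum>j\<le>2 * m. f j)"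
    by (simp only: f_def Re_sum) simp
  then have "(2 * cos x) ^ (2 * m) = (\<Sum>j\<le>2 * m. f j)"
    by (simp only: Re_complex_of_real)
  also have "{..2 * m} = (\<lambda>d. m - d) ` {1..m} \<union> ({m} \<union> (\<lambda>d. m + d) ` {1..m})"
  proof (intro equalityI subsetI)
    fix j assume "j \<in> {..2 * m}"
    then show "j \<in> (\<lambda>d. m - d) ` {1..m} \<union> ({m} \<union> (\<lambda>d. m + d) ` {1..m})"
    proof (cases j m rule: linorder_cases)
      case less
      then have "j = m - (m - j)" "m - j \<in> {1..m}" by auto
      then show ?thesis by blast
    next
      case greater
      with \<open>j \<in> {..2 * m}\<close> have "j = m + (j - m)" "j - m \<in> {1..m}" by auto
      then show ?thesis by blast
    qed simp
  qed auto
  also have "(\<Sum>j\<in>\<dots>. f j) = (\<Sum>j\<in>(\<lambda>d. m - d) ` {1..m}. f j) + (\<Sum>j\<in>{m} \<union> (\<lambda>d. m + d) ` {1..m}. f j)"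
    by (rule sum.union_disjoint) auto
  also have "(\<Sum>j\<in>{m} \<union> (\<lambda>d. m + d) ` {1..m}. f j) = f m + (\<Sum>j\<in>(\<lambda>d. m + d) ` {1..m}. f j)"
    by (subst sum.union_disjoint) auto
  also have "(\<Sum>j\<in>(\<lambda>d. m + d) ` {1..m}. f j) = (\<Sum>d\<in>{1..m}. f (m + d))"
    by (subst sum.reindex) (auto simp: inj_on_def)
  also have "(\<Sum>j\<in>(\<lambda>d. m - d) ` {1..m}. f j) = (\<Sum>d\<in>{1..m}. f (m - d))"
    by (subst sum.reindex) (auto simp: inj_on_def)
  also have "(\<Sum>d\<in>{1..m}. f (m - d)) = (\<Sum>d\<in>{1..m}. f (m + d))"
  proof (rule sum.cong)
    fix d assume d: "d \<in> {1..m}"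
    have "2 * m choose (m - d) = 2 * m choose (m + d)"
      using d by (subst binomial_symmetric) auto
    moreover have "cos (2 * (real (m - d) - real m) * x) = cos (2 * (real (m + d) - real m) * x)"
      using d cos_minus[of "2 * real d * x"] by (simp add: of_nat_diff)
    ultimately show "f (m - d) = f (m + d)" by (simp add: f_def)
  qed simp
  finally show ?thesis by (simp add: f_def sum_distrib_left)
qed

lemma sum_cos_roots_of_unity:
  assumes N: "N > 0"
  shows "(\<Sum>k<N. cos (2 * real d * ((real k + a) * pi / real N))) =
     (if N dvd d then real N * cos (2 * pi * a * real (d div N)) else 0)"
proof (cases "N dvd d")
  case True
  then obtain v where v: "d = N * v" by auto
  have "cos (2 * real d * ((real k + a) * pi / real N)) = cos (2 * pi * a * real v)" for k
  proof -
    have "2 * real d * ((real k + a) * pi / real N) = 2 * pi * a * real v + 2 * real (v * k) * pi"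
      using N by (simp add: v field_simps)
    then show ?thesis using cos.periodic_simps by (simp add: cos_add del: of_nat_mult)
  qed
  then show ?thesis using N v by simp
next
  case False
  \<comment> \<open>The sum is the real part of a geometric series in this root of unity, which
    differs from 1 exactly because \<open>N\<close> does not divide \<open>d\<close>.\<close>
  define w where "w = cis (2 * pi * real d / real N)"
  have wN: "w ^ N = 1"
    using N by (simp add: w_def Complex.DeMoivre complex_eq_iff)
  have w1: "w \<noteq> 1"
  proof
    assume "w = 1"
    then have "cos (2 * pi * real d / real N) = 1" by (auto simp: w_def complex_eq_iff)
    then obtain n :: int where "2 * pi * real d / real N = of_int n * 2 * pi"
      by (auto simp: cos_one_2pi_int)
    then have "real d = of_int n * real N" using N by (simp add: field_simps)
    then have "int d = n * int N" by (metis of_int_eq_iff of_int_mult of_int_of_nat_eq)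
    then have "int N dvd int d" by simp
    with False show False by simp
  qed
  have "cos (2 * real d * ((real k + a) * pi / real N)) = Re (cis (2 * pi * real d / real N * a) * w ^ k)" for k
  proof -
    have "2 * real d * ((real k + a) * pi / real N) = 2 * pi * real d / real N * a + real k * (2 * pi * real d / real N)"
      by (simp add: ring_distribs add_divide_distrib mult_ac)
    then show ?thesis
      by (simp only: w_def Complex.DeMoivre cis_mult cis.sel)
  qed
  then have "(\<Sum>k<N. cos (2 * real d * ((real k + a) * pi / real N))) = Re (\<Sum>k<N. cis (2 * pi * real d / real N * a) * w ^ k)"
    by (simp only: Re_sum)
  also have "(\<Sum>k<N. cis (2 * pi * real d / real N * a) * w ^ k) = 0"
    using geometric_sum[OF w1, of N] wN by (simp flip: sum_distrib_left)
  finally show ?thesis using False by simp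
qed

text \<open>Orthogonality keeps only the frequencies divisible by \<open>N\<close>. The series on
  the right has finitely many nonzero terms, since the binomial coefficients vanish beyond
  \<open>2 * m\<close>; its infinite form is what dominated convergence needs.\<close>

lemma sum_cos_power:
  assumes N: "N > 0"
  shows "(\<Sum>k<N. cos ((real k + a) * pi / real N) ^ (2 * m)) =
    real N * (real (2 * m choose m) / 4 ^ m) *
      (1 + 2 * (\<Sum>v. cos (2 * pi * a * real (Suc v)) * (real (2 * m choose (m + N * Suc v)) / real (2 * m choose m))))"
proof -
  define C where "C = (\<lambda>d. real (2 * m choose (m + d)))"
  have C0: "C 0 > 0" by (simp add: C_def)
  have "4 ^ m * (\<Sum>k<N. cos ((real k + a) * pi / real N) ^ (2 * m)) = (\<Sum>k<N. (2 * cos ((real k + a) * pi / real N)) ^ (2 * m))"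
    by (simp add: power_mult_distrib sum_distrib_left power_mult)
  also have "\<dots> = real N * C 0 + 2 * (\<Sum>d\<in>{1..m}. C d * (\<Sum>k<N. cos (2 * real d * ((real k + a) * pi / real N))))"
    unfolding cos_multiple_power_expansion
    by (simp add: sum.distrib C_def sum_distrib_left mult.assoc) (rule sum.swap)
  also have "(\<Sum>d\<in>{1..m}. C d * (\<Sum>k<N. cos (2 * real d * ((real k + a) * pi / real N)))) =
      (\<Sum>d\<in>{1..m}. if N dvd d then C d * (real N * cos (2 * pi * a * real (d div N))) else 0)"
    unfolding sum_cos_roots_of_unity[OF N] by (intro sum.cong) auto
  also have "\<dots> = (\<Sum>d | d \<in> {1..m} \<and> N dvd d. C d * (real N * cos (2 * pi * a * real (d div N))))"
    by (rule sum.inter_filter [symmetric]) simp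
  also have "\<dots> = (\<Sum>v<m div N. C (N * Suc v) * (real N * cos (2 * pi * a * real (Suc v))))"
  proof (rule sum.reindex_bij_witness[of _ "\<lambda>v. N * Suc v" "\<lambda>d. d div N - 1"])
    fix d assume d: "d \<in> {d. d \<in> {1..m} \<and> N dvd d}"
    then have "d div N \<ge> 1" using N by (auto simp: div_greater_zero_iff dvd_imp_le Suc_le_eq)
    moreover have "d div N \<le> m div N" using d by (auto intro: div_le_mono)
    ultimately show "d div N - 1 \<in> {..<m div N}" by auto
    show *: "N * Suc (d div N - 1) = d" using d \<open>d div N \<ge> 1\<close> by simp
    show "C (N * Suc (d div N - 1)) * (real N * cos (2 * pi * a * real (Suc (d div N - 1)))) =
       C d * (real N * cos (2 * pi * a * real (d div N)))"
      using * \<open>d div N \<ge> 1\<close> by (simp del: mult_Suc_right)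
  next
    fix v assume "v \<in> {..<m div N}"
    then have "Suc v \<le> m div N" by simp
    then have "N * Suc v \<le> N * (m div N)" by (rule mult_le_mono2)
    also have "\<dots> \<le> m" by simp
    finally show "N * Suc v \<in> {d. d \<in> {1..m} \<and> N dvd d}" using N by auto
    show "N * Suc v div N - 1 = v" using N by simp
  qed
  also have "\<dots> = real N * C 0 * (\<Sum>v<m div N. cos (2 * pi * a * real (Suc v)) * (C (N * Suc v) / C 0))"
    using C0 by (simp add: sum_distrib_left field_simps)
  also have "(\<Sum>v<m div N. cos (2 * pi * a * real (Suc v)) * (C (N * Suc v) / C 0)) = (\<Sum>v. cos (2 * pi * a * real (Suc v)) * (C (N * Suc v) / C 0))"
  proof (rule suminf_finite [symmetric])
    fix v assume "v \<notin> {..<m div N}"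
    then have "m div N < Suc v" by simp
    then have "m < N * Suc v" using N by (simp add: div_less_iff_less_mult mult.commute)
    then have "C (N * Suc v) = 0" by (simp add: C_def binomial_eq_0 del: mult_Suc_right)
    then show "cos (2 * pi * a * real (Suc v)) * (C (N * Suc v) / C 0) = 0" by simp
  qed simp
  finally show ?thesis
    by (simp add: C_def field_simps)
qed

text \<open>The ratio is the product of \<open>(m - i) / (m + i + 1)\<close> over
  \<open>i < j\<close>. Each factor equals \<open>1 - y\<close> and \<open>1 / (1 + x)\<close> with
  numerators \<open>2 * i + 1\<close>; the estimates by \<open>exp (- y)\<close> and
  \<open>exp (- x)\<close>, with the denominators replaced by the extreme values
  \<open>m + j\<close> and \<open>m - j\<close>, add up because the odd numbers sum to
  \<open>j ^ 2\<close>.\<close>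

lemma central_binomial_ratio_bounds:
  assumes "j \<le> m"
  shows "j < m \<Longrightarrow> exp (- (real j ^ 2 / (real m - real j))) \<le> real (2 * m choose (m + j)) / real (2 * m choose m)"
    and "real (2 * m choose (m + j)) / real (2 * m choose m) \<le> exp (- (real j ^ 2 / (real m + real j)))"
proof -
  define r where "r = (\<lambda>j. real (2 * m choose (m + j)) / real (2 * m choose m))"
  have r0: "r 0 = 1" by (simp add: r_def)
  have rS: "r (Suc i) = r i * ((real m - real i) / (real m + real i + 1))" if "i < m" for i
  proof -
    have "Suc (m + i) * (2 * m choose Suc (m + i)) = (2 * m - (m + i)) * (2 * m choose (m + i))"
      using binomial_absorb_comp[of "2 * m" "m + i"] binomial_absorption[of "m + i" "2 * m"]
      by simp
    then have "real (Suc (m + i)) * real (2 * m choose Suc (m + i)) = real (2 * m - (m + i)) * real (2 * m choose (m + i))"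
      by (simp only: of_nat_mult [symmetric])
    moreover have "real (2 * m - (m + i)) = real m - real i" using that by (simp add: of_nat_diff)
    ultimately have "real (2 * m choose Suc (m + i)) = real (2 * m choose (m + i)) * ((real m - real i) / (real m + real i + 1))"
      by (simp add: field_simps)
    then show ?thesis by (simp add: r_def)
  qed
  have "(j < m \<longrightarrow> exp (- (real i ^ 2 / (real m - real j))) \<le> r i) \<and> r i \<le> exp (- (real i ^ 2 / (real m + real j)))" if "i \<le> j" for i
    using that
  proof (induction i)
    case (Suc i)
    have i: "i < m" "real i + 1 \<le> real j" "real j \<le> real m" using Suc assms by auto
    define x where "x = (2 * real i + 1) / (real m - real i)"
    define y where "y = (2 * real i + 1) / (real m + real i + 1)"
    have f: "(real m - real i) / (real m + real i + 1) = 1 - y" "(real m - real i) / (real m + real i + 1) = 1 / (1 + x)"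
      using i by (simp_all add: x_def y_def field_simps)
    have x0: "x \<ge> 0" using i by (simp add: x_def)
    have "1 - y \<le> exp (- y)" using exp_ge_add_one_self[of "- y"] by simp
    also have "\<dots> \<le> exp (- ((2 * real i + 1) / (real m + real j)))"
      unfolding y_def using i by (auto intro!: divide_left_mono)
    finally have up: "(real m - real i) / (real m + real i + 1) \<le> exp (- ((2 * real i + 1) / (real m + real j)))"
      by (simp add: f(1))
    have low: "exp (- ((2 * real i + 1) / (real m - real j))) \<le> (real m - real i) / (real m + real i + 1)" if "j < m"
    proof -
      have "exp (- ((2 * real i + 1) / (real m - real j))) \<le> exp (- x)"
        unfolding x_def using i that by (auto intro!: divide_left_mono)
      also have "\<dots> = 1 / exp x" by (simp add: exp_minus inverse_eq_divide)
      also have "\<dots> \<le> 1 / (1 + x)" using exp_ge_add_one_self[of x] x0 by (intro divide_left_mono) auto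
      finally show ?thesis
        by (simp add: f(2))
    qed
    have pos: "0 \<le> (real m - real i) / (real m + real i + 1)" using i by auto
    have r0: "0 \<le> r i" by (simp add: r_def)
    have split: "exp (- (real (Suc i) ^ 2 / D)) = exp (- (real i ^ 2 / D)) * exp (- ((2 * real i + 1) / D))" for D
      by (simp add: power2_eq_square algebra_simps add_divide_distrib flip: exp_add)
    show ?case
      using Suc low up pos r0 unfolding rS[OF i(1)] split by (intro conjI impI mult_mono) auto
  qed (simp add: r0)
  from this[of j] show "j < m \<Longrightarrow> exp (- (real j ^ 2 / (real m - real j))) \<le> real (2 * m choose (m + j)) / real (2 * m choose m)"
    "real (2 * m choose (m + j)) / real (2 * m choose m) \<le> exp (- (real j ^ 2 / (real m + real j)))"
    by (auto simp: r_def)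
qed

text \<open>The expression is the reciprocal of the partial product of Wallis.\<close>

lemma central_binomial_asymptotic:
  "(\<lambda>m. (real (2 * m choose m) / 4 ^ m) ^ 2 * (2 * real m + 1)) \<longlonglongrightarrow> 2 / pi"
proof -
  have "(\<Prod>k=1..n. (4 * real k ^ 2) / (4 * real k ^ 2 - 1)) = 1 / ((real (2 * n choose n) / 4 ^ n) ^ 2 * (2 * real n + 1))" for n
  proof (induction n)
    case (Suc n)
    have "real (2 * Suc n choose Suc n) * (real n + 1) = 2 * (2 * real n + 1) * real (2 * n choose n)"
    proof -
      have "Suc n * (2 * Suc n choose Suc n) = 2 * (Suc n * (2 * n + 1 choose n))"
        using Suc_times_binomial[of n "2 * n + 1"] by simp
      also have "2 * n + 1 choose n = 2 * n + 1 choose Suc n"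
        using binomial_symmetric[of n "2 * n + 1"] by simp
      also have "Suc n * (2 * n + 1 choose Suc n) = (2 * n + 1) * (2 * n choose n)"
        using Suc_times_binomial[of n "2 * n"] by simp
      finally have "real (Suc n * (2 * Suc n choose Suc n)) = real (2 * ((2 * n + 1) * (2 * n choose n)))"
        by (simp only:)
      then show ?thesis by (simp only: of_nat_mult of_nat_add of_nat_Suc) (simp add: algebra_simps)
    qed
    then have c: "real (2 * Suc n choose Suc n) = 2 * (2 * real n + 1) * real (2 * n choose n) / (real n + 1)"
      by (simp add: field_simps)
    define b where "b = real (2 * n choose n) / 4 ^ n"
    have b: "b > 0" by (simp add: b_def)
    have bS: "real (2 * Suc n choose Suc n) / 4 ^ Suc n = b * (2 * real n + 1) / (2 * (real n + 1))"
      unfolding c by (simp add: b_def divide_simps) (simp add: algebra_simps)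
    have "4 * real (Suc n) ^ 2 / (4 * real (Suc n) ^ 2 - 1) = (2 * (real n + 1)) ^ 2 / ((2 * real n + 1) * (2 * real n + 3))"
      by (simp add: power2_eq_square algebra_simps)
    then have "(\<Prod>k=1..Suc n. (4 * real k ^ 2) / (4 * real k ^ 2 - 1)) =
        1 / (b ^ 2 * (2 * real n + 1)) * ((2 * (real n + 1)) ^ 2 / ((2 * real n + 1) * (2 * real n + 3)))"
      using Suc by (simp add: b_def)
    also have "\<dots> = 1 / ((b * (2 * real n + 1) / (2 * (real n + 1))) ^ 2 * (2 * real (Suc n) + 1))"
      using b by (simp add: power_mult_distrib power_divide) (simp add: algebra_simps power2_eq_square)
    finally show ?case unfolding bS .
  qed simp
  with wallis have "(\<lambda>n. 1 / ((real (2 * n choose n) / 4 ^ n) ^ 2 * (2 * real n + 1))) \<longlonglongrightarrow> pi / 2"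
    by simp
  from tendsto_inverse[OF this] show ?thesis by (simp add: inverse_eq_divide)
qed

lemma summable_exp_square:
  assumes "c > 0"
  shows "summable (\<lambda>n. exp (- (c * real n ^ 2)))"
proof (rule summable_comparison_test')
  show "summable (\<lambda>n. exp (- c) ^ n)"
    using assms by (intro summable_geometric) auto
  fix n :: nat
  have "real n * 1 \<le> real n * real n" by (cases n) (auto intro!: mult_left_mono)
  then have "c * real n \<le> c * real n ^ 2" using assms by (intro mult_left_mono) (auto simp: power2_eq_square)
  then show "norm (exp (- (c * real n ^ 2))) \<le> exp (- c) ^ n"
    by (simp add: mult.commute flip: exp_of_nat_mult)
qed

text \<open>The product \<open>cos x * exp (x ^ 2 / 2)\<close> decreases because
  \<open>x * cos x \<le> sin x\<close>. This gives a Gaussian majorant for the powers of the cosine,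
  uniform in the number of angles.\<close>

lemma cos_le_exp:
  assumes "0 \<le> x" "x \<le> pi / 2"
  shows "cos x \<le> exp (- (x ^ 2 / 2))"
proof -
  have mono: "x * cos x \<le> sin x" if "0 \<le> x" "x \<le> pi / 2" for x :: real
  proof -
    have "(\<lambda>x. sin x - x * cos x) 0 \<le> (\<lambda>x. sin x - x * cos x) x"
    proof (rule DERIV_nonneg_imp_nondecreasing[OF that(1)])
      fix y assume y: "0 \<le> y" "y \<le> x"
      have "((\<lambda>x. sin x - x * cos x) has_real_derivative y * sin y) (at y)"
        by (auto intro!: derivative_eq_intros)
      moreover have "0 \<le> y * sin y" using y that by (intro mult_nonneg_nonneg sin_ge_zero) auto
      ultimately show "\<exists>D. ((\<lambda>x. sin x - x * cos x) has_real_derivative D) (at y) \<and> 0 \<le> D" by blast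
    qed
    then show ?thesis by simp
  qed
  have "(\<lambda>x. cos x * exp (x ^ 2 / 2)) x \<le> (\<lambda>x. cos x * exp (x ^ 2 / 2)) 0"
  proof (rule DERIV_nonpos_imp_nonincreasing[OF assms(1)])
    fix y assume y: "0 \<le> y" "y \<le> x"
    have "((\<lambda>x. cos x * exp (x ^ 2 / 2)) has_real_derivative (y * cos y - sin y) * exp (y ^ 2 / 2)) (at y)"
      by (auto intro!: derivative_eq_intros simp: algebra_simps)
    moreover have "(y * cos y - sin y) * exp (y ^ 2 / 2) \<le> 0"
      using mono[of y] y assms by (intro mult_nonpos_nonneg) auto
    ultimately show "\<exists>D. ((\<lambda>x. cos x * exp (x ^ 2 / 2)) has_real_derivative D) (at y) \<and> D \<le> 0" by blast
  qed
  then show ?thesis by (simp add: exp_minus field_simps)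
qed

text \<open>
  With \<open>N = 2L\<close> equidistant angles the exponent \<open>m \<sim> N\<^sup>2 t / \<pi>\<close> makes \<open>cos (b \<pi> / N)\<^sup>2\<^sup>m\<close> tend to
  \<open>exp (- \<pi> t b\<^sup>2)\<close> and the binomial ratio at distance \<open>N v\<close> from the centre tend to \<open>exp (- \<pi> v\<^sup>2 / t)\<close>.
\<close>

definition polya_exponent :: "real \<Rightarrow> nat \<Rightarrow> nat" where
  "polya_exponent t L = nat \<lfloor>4 * t * real L ^ 2 / pi\<rfloor>"

context
  fixes t :: real
  assumes t: "t > 0"
begin

lemma polya_exponent_bounds:
  "real (polya_exponent t L) \<le> 4 * t * real L ^ 2 / pi" "real (polya_exponent t L) > 4 * t * real L ^ 2 / pi - 1"
  using t by (auto simp: polya_exponent_def)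

lemma polya_exponent_limit: "(\<lambda>L. real (polya_exponent t L) / real L ^ 2) \<longlonglongrightarrow> 4 * t / pi"
proof (rule tendsto_sandwich)
  show "(\<lambda>L. 4 * t / pi - 1 / real L ^ 2) \<longlonglongrightarrow> 4 * t / pi" by real_asymp
  show "\<forall>\<^sub>F L in sequentially. 4 * t / pi - 1 / real L ^ 2 \<le> real (polya_exponent t L) / real L ^ 2"
    using eventually_gt_at_top[of 0]
  proof eventually_elim
    case (elim L)
    have "4 * t / pi - 1 / real L ^ 2 = (4 * t * real L ^ 2 / pi - 1) / real L ^ 2"
      using elim by (simp add: diff_divide_distrib)
    also have "\<dots> \<le> real (polya_exponent t L) / real L ^ 2"
      using polya_exponent_bounds(2)[of L] by (intro divide_right_mono) auto
    finally show ?case .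
  qed
  show "\<forall>\<^sub>F L in sequentially. real (polya_exponent t L) / real L ^ 2 \<le> 4 * t / pi"
    using eventually_gt_at_top[of 0]
  proof eventually_elim
    case (elim L)
    then show ?case using polya_exponent_bounds(1)[of L] by (simp add: field_simps)
  qed
qed simp

lemma polya_exponent_at_top: "filterlim (polya_exponent t) at_top sequentially"
proof -
  have "filterlim (\<lambda>L. 4 * t * real L ^ 2 / pi - 1) at_top sequentially"
    using t by real_asymp
  then have "filterlim (\<lambda>L. real (polya_exponent t L)) at_top sequentially"
    by (rule filterlim_at_top_mono) (use polya_exponent_bounds(2) in \<open>auto intro: less_imp_le always_eventually\<close>)
  then show ?thesis by (simp add: filterlim_sequentially_iff_filterlim_real)
qed

lemma eventually_polya_exponent_ge: "\<forall>\<^sub>F L in sequentially. real (polya_exponent t L) \<ge> 2 * t * real L ^ 2 / pi"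
proof -
  have "\<forall>\<^sub>F L in sequentially. 2 * t * real L ^ 2 / pi \<le> 4 * t * real L ^ 2 / pi - 1"
    using t by real_asymp
  then show ?thesis
    by eventually_elim (use polya_exponent_bounds(2) in \<open>force intro: order_trans less_imp_le\<close>)
qed

lemma cos_power_polya_limit:
  "(\<lambda>L. cos (b * pi / real (2 * L)) ^ (2 * polya_exponent t L)) \<longlonglongrightarrow> exp (- (pi * t * b ^ 2))"
proof -
  have "(\<lambda>L. real L ^ 2 * (2 * ln (cos (b * pi / (2 * real L))))) \<longlonglongrightarrow> - ((b * pi / 2) ^ 2)"
  proof (cases "b = 0")
    case False
    have "(\<lambda>L. real L ^ 2 * (2 * ln (cos (c / real L)))) \<longlonglongrightarrow> - (c * c)" for c :: real
      by real_asymp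
    from this[of "b * pi / 2"] show ?thesis by (simp add: power2_eq_square)
  qed simp
  from tendsto_mult[OF polya_exponent_limit this]
  have "(\<lambda>L. real (polya_exponent t L) / real L ^ 2 * (real L ^ 2 * (2 * ln (cos (b * pi / (2 * real L))))))
      \<longlonglongrightarrow> - (pi * t * b ^ 2)"
  proof (rule back_subst[of "\<lambda>c. _ \<longlonglongrightarrow> c"])
    show "4 * t / pi * - ((b * pi / 2) ^ 2) = - (pi * t * b ^ 2)"
      by (simp add: power2_eq_square)
  qed
  from tendsto_exp[OF this]
  show ?thesis
  proof (rule Lim_transform_eventually)
    have "(\<lambda>L. cos (b * pi / (2 * real L))) \<longlonglongrightarrow> cos 0"
      by (intro tendsto_cos) real_asymp
    then have "\<forall>\<^sub>F L in sequentially. cos (b * pi / (2 * real L)) > 0"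
      by (rule order_tendstoD) simp
    then show "\<forall>\<^sub>F L in sequentially. exp (real (polya_exponent t L) / real L ^ 2 * (real L ^ 2 * (2 * ln (cos (b * pi / (2 * real L)))))) =
        cos (b * pi / real (2 * L)) ^ (2 * polya_exponent t L)"
      using eventually_gt_at_top[of 0]
    proof eventually_elim
      case (elim L)
      have "real (polya_exponent t L) / real L ^ 2 * (real L ^ 2 * (2 * ln (cos (b * pi / (2 * real L))))) =
         real (2 * polya_exponent t L) * ln (cos (b * pi / (2 * real L)))"
        using elim by simp
      also have "exp \<dots> = cos (b * pi / (2 * real L)) ^ (2 * polya_exponent t L)"
        unfolding exp_of_nat_mult using elim by simp
      finally show ?case by simp
    qed
  qed
qed

text \<open>The exponent has half the rate of the limit because only half of the asymptotic size of
  \<open>polya_exponent\<close> is used; any positive rate would yield a summable majorant.\<close>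

lemma cos_power_polya_bound:
  assumes "0 \<le> b" "b \<le> real L" "L > 0" "real (polya_exponent t L) \<ge> 2 * t * real L ^ 2 / pi"
  shows "\<bar>cos (b * pi / real (2 * L)) ^ (2 * polya_exponent t L)\<bar> \<le> exp (- (pi * t / 2 * b ^ 2))"
proof -
  let ?x = "b * pi / real (2 * L)"
  have x: "0 \<le> ?x" "?x \<le> pi / 2" using assms by (auto simp: field_simps)
  have c: "0 \<le> cos ?x" using x by (intro cos_ge_zero) auto
  have "cos ?x ^ (2 * polya_exponent t L) \<le> exp (- (?x ^ 2 / 2)) ^ (2 * polya_exponent t L)"
    using x c by (intro power_mono cos_le_exp) auto
  also have "\<dots> = exp (- (?x ^ 2 * real (polya_exponent t L)))"
    by (simp flip: exp_of_nat_mult)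
  also have "\<dots> \<le> exp (- (?x ^ 2 * (2 * t * real L ^ 2 / pi)))"
    unfolding exp_le_cancel_iff neg_le_iff_le using assms(4) by (rule mult_left_mono) simp
  also have "?x ^ 2 * (2 * t * real L ^ 2 / pi) = pi * t / 2 * b ^ 2"
    using assms(3) by (simp add: field_simps power2_eq_square)
  finally show ?thesis using c by (simp add: zero_le_power)
qed

text \<open>Tannery's theorem. The cutoff keeps the angle in \<open>[0, pi / 2]\<close>, the only
  range where the Gaussian majorant of the cosine holds.\<close>

lemma polya_cos_sum_limit:
  assumes "0 < b" "b \<le> 1"
  shows "(\<lambda>L. \<Sum>k. if real k + b \<le> real L then cos ((real k + b) * pi / real (2 * L)) ^ (2 * polya_exponent t L) else 0)
           \<longlonglongrightarrow> (\<Sum>k. exp (- (pi * t * (real k + b) ^ 2)))"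
proof (rule tannerys_theorem[THEN conjunct2, THEN conjunct2])
  fix k :: nat
  show "(\<lambda>L. if real k + b \<le> real L then cos ((real k + b) * pi / real (2 * L)) ^ (2 * polya_exponent t L) else 0)
        \<longlonglongrightarrow> exp (- (pi * t * (real k + b) ^ 2))"
    using cos_power_polya_limit
  proof (rule Lim_transform_eventually)
    have "\<forall>\<^sub>F L in sequentially. real k + b \<le> real L" by real_asymp
    then show "\<forall>\<^sub>F L in sequentially. cos ((real k + b) * pi / real (2 * L)) ^ (2 * polya_exponent t L) =
       (if real k + b \<le> real L then cos ((real k + b) * pi / real (2 * L)) ^ (2 * polya_exponent t L) else 0)"
      by eventually_elim simp
  qed
next
  have ev: "\<forall>\<^sub>F L in sequentially. \<forall>k. norm (if real k + b \<le> real L then cos ((real k + b) * pi / real (2 * L)) ^ (2 * polya_exponent t L) else 0)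
        \<le> exp (- (pi * t / 2 * real k ^ 2))"
    using eventually_polya_exponent_ge eventually_gt_at_top[of 0]
  proof eventually_elim
    case (elim L)
    show ?case
    proof
      fix k :: nat
      show "norm (if real k + b \<le> real L then cos ((real k + b) * pi / real (2 * L)) ^ (2 * polya_exponent t L) else 0)
        \<le> exp (- (pi * t / 2 * real k ^ 2))"
      proof (cases "real k + b \<le> real L")
        case True
        have "\<bar>cos ((real k + b) * pi / real (2 * L)) ^ (2 * polya_exponent t L)\<bar> \<le> exp (- (pi * t / 2 * (real k + b) ^ 2))"
          using elim True assms by (intro cos_power_polya_bound) auto
        also have "\<dots> \<le> exp (- (pi * t / 2 * real k ^ 2))"
          using assms t by (simp add: mult_left_mono power_mono)
        finally show ?thesis using True by simp
      qed simp
    qed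
  qed
  show "\<forall>\<^sub>F (k, L) in at_top \<times>\<^sub>F sequentially. norm (if real k + b \<le> real L then cos ((real k + b) * pi / real (2 * L)) ^ (2 * polya_exponent t L) else 0)
        \<le> exp (- (pi * t / 2 * real k ^ 2))"
    unfolding eventually_prod_filter
    by (rule exI[of _ "\<lambda>_. True"], rule exI, intro conjI, simp, rule ev) auto
  show "summable (\<lambda>k. exp (- (pi * t / 2 * real k ^ 2)))"
    using t by (intro summable_exp_square) auto
qed auto

lemma polya_binomial_term_limit:
  assumes "v > 0"
  shows "(\<lambda>L. real (2 * polya_exponent t L choose (polya_exponent t L + 2 * L * v)) / real (2 * polya_exponent t L choose polya_exponent t L))
     \<longlonglongrightarrow> exp (- (pi / t * real v ^ 2))"
proof -
  let ?m = "polya_exponent t"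
  define x where "x = (\<lambda>L. real (?m L) / real L ^ 2)"
  have x: "x \<longlonglongrightarrow> 4 * t / pi" unfolding x_def by (rule polya_exponent_limit)
  have y: "(\<lambda>L. 2 * real v / real L) \<longlonglongrightarrow> 0" by real_asymp
  have lim: "4 * real v ^ 2 / (4 * t / pi - 0) = pi / t * real v ^ 2" "4 * real v ^ 2 / (4 * t / pi + 0) = pi / t * real v ^ 2"
    by simp_all
  have eq: "real (2 * L * v) ^ 2 / (real (?m L) - real (2 * L * v)) = 4 * real v ^ 2 / (x L - 2 * real v / real L)"
    "real (2 * L * v) ^ 2 / (real (?m L) + real (2 * L * v)) = 4 * real v ^ 2 / (x L + 2 * real v / real L)" if "L > 0" for L
  proof -
    have e: "real (?m L) = real L ^ 2 * x L" "real (2 * L * v) = real L ^ 2 * (2 * real v / real L)"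
      using that by (simp_all add: x_def power2_eq_square)
    show "real (2 * L * v) ^ 2 / (real (?m L) - real (2 * L * v)) = 4 * real v ^ 2 / (x L - 2 * real v / real L)"
      "real (2 * L * v) ^ 2 / (real (?m L) + real (2 * L * v)) = 4 * real v ^ 2 / (x L + 2 * real v / real L)"
      unfolding e unfolding right_diff_distrib[symmetric] distrib_left[symmetric]
      using that by (simp_all add: power2_eq_square)
  qed
  have "(\<lambda>L. x L - 2 * real v / real L) \<longlonglongrightarrow> 4 * t / pi - 0" by (intro tendsto_intros x y)
  then have "\<forall>\<^sub>F L in sequentially. x L - 2 * real v / real L > 0"
    by (rule order_tendstoD) (use t in simp)
  then have ev: "\<forall>\<^sub>F L in sequentially. 2 * L * v < ?m L \<and> L > 0"
    using eventually_gt_at_top[of 0]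
  proof eventually_elim
    case (elim L)
    then have "real (2 * L * v) < real (?m L)" by (simp add: x_def field_simps power2_eq_square)
    with elim show ?case by (simp only: of_nat_less_iff)
  qed
  show ?thesis
  proof (rule tendsto_sandwich)
    show "(\<lambda>L. exp (- (4 * real v ^ 2 / (x L - 2 * real v / real L)))) \<longlonglongrightarrow> exp (- (pi / t * real v ^ 2))"
      unfolding lim(1) [symmetric] using t by (intro tendsto_intros x y) auto
    show "(\<lambda>L. exp (- (4 * real v ^ 2 / (x L + 2 * real v / real L)))) \<longlonglongrightarrow> exp (- (pi / t * real v ^ 2))"
      unfolding lim(2) [symmetric] using t by (intro tendsto_intros x y) auto
    show "\<forall>\<^sub>F L in sequentially. exp (- (4 * real v ^ 2 / (x L - 2 * real v / real L))) \<le>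
        real (2 * ?m L choose (?m L + 2 * L * v)) / real (2 * ?m L choose ?m L)"
      using ev by eventually_elim (use central_binomial_ratio_bounds(1) eq less_imp_le in metis)
    show "\<forall>\<^sub>F L in sequentially. real (2 * ?m L choose (?m L + 2 * L * v)) / real (2 * ?m L choose ?m L) \<le>
        exp (- (4 * real v ^ 2 / (x L + 2 * real v / real L)))"
      using ev by eventually_elim (use central_binomial_ratio_bounds(2) eq less_imp_le in metis)
  qed
qed

text \<open>Within the support \<open>2 * L * v \<le> m\<close> the denominator
  \<open>m + 2 * L * v\<close> is at most \<open>2 * m\<close>, and \<open>m\<close> is at most
  \<open>4 * t * L ^ 2 / pi\<close>; outside it the coefficient is zero.\<close>

lemma polya_binomial_bound:
  "real (2 * polya_exponent t L choose (polya_exponent t L + 2 * L * v)) / real (2 * polya_exponent t L choose polya_exponent t L)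
     \<le> exp (- (pi / (2 * t) * real v ^ 2))" if L: "L > 0"
proof -
  let ?m = "polya_exponent t L"
  consider "2 * L * v \<le> ?m" "?m > 0" | "v = 0" | "2 * L * v > ?m" using L by fastforce
  then show ?thesis
  proof cases
    case 1
    have "pi * real ?m \<le> 4 * t * real L ^ 2"
      using polya_exponent_bounds(1)[of L] by (simp add: field_simps)
    then have "pi * real ?m * real v ^ 2 \<le> 4 * t * real L ^ 2 * real v ^ 2"
      by (intro mult_right_mono) auto
    then have "pi / (2 * t) * real v ^ 2 \<le> real (2 * L * v) ^ 2 / (2 * real ?m)"
      using t 1 by (simp add: divide_simps power_mult_distrib) (simp add: mult_ac)
    also have "\<dots> \<le> real (2 * L * v) ^ 2 / (real ?m + real (2 * L * v))"
      using 1 by (intro divide_left_mono) (auto simp flip: of_nat_mult of_nat_add)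
    finally show ?thesis
      using central_binomial_ratio_bounds(2)[OF 1(1)] by (meson exp_le_cancel_iff neg_le_iff_le order_trans)
  qed (simp_all add: binomial_eq_0)
qed

end

text \<open>The normalised central coefficient behaves like \<open>1 / sqrt (pi * m)\<close>, and
  \<open>pi * m\<close> is asymptotic to \<open>(2 * L) ^ 2 * t\<close>.\<close>

lemma central_binomial_scaled_limit:
  assumes t: "t > 0"
  shows "(\<lambda>L. real (2 * L) * (real (2 * polya_exponent t L choose polya_exponent t L) / 4 ^ polya_exponent t L)) \<longlonglongrightarrow> 1 / sqrt t"
proof -
  let ?m = "polya_exponent t"
  define c where "c = (\<lambda>m. real (2 * m choose m) / 4 ^ m)"
  have c: "(\<lambda>L. c (?m L) ^ 2 * (2 * real (?m L) + 1)) \<longlonglongrightarrow> 2 / pi"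
    using filterlim_compose[OF central_binomial_asymptotic polya_exponent_at_top[OF t]] by (simp add: c_def)
  have "(\<lambda>L. 1 / real L ^ 2) \<longlonglongrightarrow> 0" by real_asymp
  then have d: "(\<lambda>L. 2 * (real (?m L) / real L ^ 2) + 1 / real L ^ 2) \<longlonglongrightarrow> 2 * (4 * t / pi) + 0"
    by (intro tendsto_intros polya_exponent_limit t)
  have "(\<lambda>L. c (?m L) ^ 2 * (2 * real (?m L) + 1) * 4 / (2 * (real (?m L) / real L ^ 2) + 1 / real L ^ 2)) \<longlonglongrightarrow> 2 / pi * 4 / (2 * (4 * t / pi) + 0)"
    by (intro tendsto_divide tendsto_mult c d tendsto_const) (use t in auto)
  then have "(\<lambda>L. c (?m L) ^ 2 * (2 * real (?m L) + 1) * 4 / (2 * (real (?m L) / real L ^ 2) + 1 / real L ^ 2)) \<longlonglongrightarrow> 1 / t"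
    by simp
  then have "(\<lambda>L. sqrt (c (?m L) ^ 2 * (2 * real (?m L) + 1) * 4 / (2 * (real (?m L) / real L ^ 2) + 1 / real L ^ 2))) \<longlonglongrightarrow> sqrt (1 / t)"
    by (rule tendsto_real_sqrt)
  then have "(\<lambda>L. real (2 * L) * c (?m L)) \<longlonglongrightarrow> sqrt (1 / t)"
  proof (rule Lim_transform_eventually)
    show "\<forall>\<^sub>F L in sequentially. sqrt (c (?m L) ^ 2 * (2 * real (?m L) + 1) * 4 / (2 * (real (?m L) / real L ^ 2) + 1 / real L ^ 2)) = real (2 * L) * c (?m L)"
      using eventually_gt_at_top[of 0]
    proof eventually_elim
      case (elim L)
      have "2 * (real (?m L) / real L ^ 2) + 1 / real L ^ 2 = (2 * real (?m L) + 1) / real L ^ 2"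
        by (simp add: add_divide_distrib)
      then have "c (?m L) ^ 2 * (2 * real (?m L) + 1) * 4 / (2 * (real (?m L) / real L ^ 2) + 1 / real L ^ 2) = (real (2 * L) * c (?m L)) ^ 2"
        using elim by (simp add: power_mult_distrib)
      then show ?case by (simp add: c_def)
    qed
  qed
  then show ?thesis by (simp add: c_def real_sqrt_divide)
qed

lemma polya_sum_limit:
  assumes t: "t > 0"
  shows "(\<lambda>L. \<Sum>k<2 * L. cos ((real k + a) * pi / real (2 * L)) ^ (2 * polya_exponent t L)) \<longlonglongrightarrow>
     1 / sqrt t * (1 + 2 * (\<Sum>v. cos (2 * pi * a * real (Suc v)) * exp (- (pi / t * real (Suc v) ^ 2))))"
proof -
  let ?m = "polya_exponent t"
  let ?r = "\<lambda>v L. real (2 * ?m L choose (?m L + 2 * L * Suc v)) / real (2 * ?m L choose ?m L)"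
  have "(\<lambda>L. \<Sum>v. cos (2 * pi * a * real (Suc v)) * ?r v L) \<longlonglongrightarrow>
      (\<Sum>v. cos (2 * pi * a * real (Suc v)) * exp (- (pi / t * real (Suc v) ^ 2)))"
  proof (rule tannerys_theorem[THEN conjunct2, THEN conjunct2])
    show "(\<lambda>L. cos (2 * pi * a * real (Suc v)) * ?r v L) \<longlonglongrightarrow> cos (2 * pi * a * real (Suc v)) * exp (- (pi / t * real (Suc v) ^ 2))" for v
      by (intro tendsto_mult tendsto_const polya_binomial_term_limit t) simp
    have "norm (cos (2 * pi * a * real (Suc v)) * ?r v L) \<le> exp (- (pi / (2 * t) * real (Suc v) ^ 2))" if "L > 0" for v L
    proof -
      have "norm (cos (2 * pi * a * real (Suc v)) * ?r v L) \<le> 1 * exp (- (pi / (2 * t) * real (Suc v) ^ 2))"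
        unfolding norm_mult using polya_binomial_bound[OF t that, of "Suc v"]
        by (intro mult_mono) (auto simp del: mult_Suc_right)
      then show ?thesis by simp
    qed
    then show "\<forall>\<^sub>F (v, L) in at_top \<times>\<^sub>F sequentially. norm (cos (2 * pi * a * real (Suc v)) * ?r v L) \<le> exp (- (pi / (2 * t) * real (Suc v) ^ 2))"
      unfolding eventually_prod_filter
      by (intro exI[of _ "\<lambda>_. True"] exI[of _ "\<lambda>L. L > 0"] conjI eventually_gt_at_top) auto
    show "summable (\<lambda>v. exp (- (pi / (2 * t) * real (Suc v) ^ 2)))"
      using summable_exp_square[of "pi / (2 * t)"] t by (subst summable_Suc_iff) auto
  qed auto
  then have "(\<lambda>L. real (2 * L) * (real (2 * ?m L choose ?m L) / 4 ^ ?m L) * (1 + 2 * (\<Sum>v. cos (2 * pi * a * real (Suc v)) * ?r v L))) \<longlonglongrightarrow>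
     1 / sqrt t * (1 + 2 * (\<Sum>v. cos (2 * pi * a * real (Suc v)) * exp (- (pi / t * real (Suc v) ^ 2))))"
    by (intro tendsto_intros central_binomial_scaled_limit t)
  then show ?thesis
  proof (rule Lim_transform_eventually)
    show "\<forall>\<^sub>F L in sequentially. real (2 * L) * (real (2 * ?m L choose ?m L) / 4 ^ ?m L) * (1 + 2 * (\<Sum>v. cos (2 * pi * a * real (Suc v)) * ?r v L)) =
       (\<Sum>k<2 * L. cos ((real k + a) * pi / real (2 * L)) ^ (2 * ?m L))"
      using eventually_gt_at_top[of 0]
      by eventually_elim (rule sum_cos_power[symmetric], simp)
  qed
qed

lemma sum_lessThan_double_reflect:
  fixes f :: "nat \<Rightarrow> 'a :: comm_monoid_add"
  shows "(\<Sum>k<2 * L. f k) = (\<Sum>k<L. f k) + (\<Sum>k<L. f (2 * L - 1 - k))"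
proof -
  have "(\<Sum>k<2 * L. f k) = (\<Sum>k<L. f k) + (\<Sum>k\<in>{L..<2 * L}. f k)"
    by (subst sum.union_disjoint [symmetric]) (auto intro: sum.cong)
  also have "(\<Sum>k\<in>{L..<2 * L}. f k) = (\<Sum>k<L. f (2 * L - 1 - k))"
    by (rule sum.reindex_bij_witness[of _ "\<lambda>k. 2 * L - 1 - k" "\<lambda>k. 2 * L - 1 - k"]) auto
  finally show ?thesis .
qed

text \<open>The angle \<open>x\<close> becomes \<open>pi - x\<close>, which changes only the sign of
  the cosine. The upper half of the angles with offset \<open>a\<close> thus repeats the lower half
  with offset \<open>1 - a\<close>: offset 0 goes to 1, offset \<open>1 / 2\<close> to
  itself.\<close>

lemma cos_power_reflect:
  assumes "k < L"
  shows "cos ((real (2 * L - 1 - k) + a) * pi / real (2 * L)) ^ (2 * m) = cos ((real k + (1 - a)) * pi / real (2 * L)) ^ (2 * m)"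
proof -
  have "(real (2 * L - 1 - k) + a) * pi / real (2 * L) = pi - (real k + (1 - a)) * pi / real (2 * L)"
    using assms by (simp add: of_nat_diff field_simps)
  then show ?thesis by simp
qed

lemma suminf_if_le_eq_sum:
  fixes f :: "nat \<Rightarrow> real"
  assumes "0 < b" "b \<le> 1"
  shows "(\<Sum>k. if real k + b \<le> real L then f k else 0) = (\<Sum>k<L. f k)"
proof -
  have iff: "real k + b \<le> real L \<longleftrightarrow> k < L" for k
  proof
    assume "real k + b \<le> real L"
    then have "real k < real L" using assms by linarith
    then show "k < L" by simp
  next
    assume "k < L"
    then have "real k + 1 \<le> real L" by linarith
    then show "real k + b \<le> real L" using assms by linarith
  qed
  show ?thesis unfolding iff by (subst suminf_finite[of "{..<L}"]) auto
qed

section \<open>The theta series for real \<open>t\<close> and their inversion\<close>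

definition th3 :: "real \<Rightarrow> real" where
  "th3 t = 1 + 2 * (\<Sum>n. exp (- (pi * t * real (Suc n) ^ 2)))"

definition th4 :: "real \<Rightarrow> real" where
  "th4 t = 1 + 2 * (\<Sum>n. (-1) ^ Suc n * exp (- (pi * t * real (Suc n) ^ 2)))"

definition th2 :: "real \<Rightarrow> real" where
  "th2 t = 2 * (\<Sum>n. exp (- (pi * t * (real n + 1 / 2) ^ 2)))"

lemma th3_inverse:
  assumes t: "t > 0"
  shows "th3 (1 / t) = sqrt t * th3 t"
proof -
  let ?m = "polya_exponent t"
  let ?f = "\<lambda>L b k. cos ((real k + b) * pi / real (2 * L)) ^ (2 * ?m L)"
  have "(\<lambda>L. 1 + 2 * (\<Sum>k. if real k + 1 \<le> real L then ?f L 1 k else 0)) \<longlonglongrightarrow> th3 t"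
    unfolding th3_def using polya_cos_sum_limit[OF t, of 1] by (intro tendsto_intros) (simp_all add: add.commute)
  moreover have "(\<lambda>L. 1 + 2 * (\<Sum>k. if real k + 1 \<le> real L then ?f L 1 k else 0)) \<longlonglongrightarrow> 1 / sqrt t * th3 (1 / t)"
  proof (rule Lim_transform_eventually)
    show "(\<lambda>L. \<Sum>k<2 * L. ?f L 0 k) \<longlonglongrightarrow> 1 / sqrt t * th3 (1 / t)"
      using polya_sum_limit[OF t, of 0] by (simp add: th3_def)
    have "\<forall>\<^sub>F L in sequentially. ?m L \<ge> 1"
      using polya_exponent_at_top[OF t] unfolding filterlim_at_top by blast
    then show "\<forall>\<^sub>F L in sequentially. (\<Sum>k<2 * L. ?f L 0 k) = 1 + 2 * (\<Sum>k. if real k + 1 \<le> real L then ?f L 1 k else 0)"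
      using eventually_gt_at_top[of 0]
    proof eventually_elim
      case (elim L)
      have "(\<Sum>k<2 * L. ?f L 0 k) = (\<Sum>k<L. ?f L 0 k) + (\<Sum>k<L. ?f L 1 k)"
        unfolding sum_lessThan_double_reflect by (intro arg_cong2[where f = "(+)"] sum.cong refl) (rule trans[OF cos_power_reflect], simp_all)
      \<comment> \<open>The end terms are \<open>cos 0 = 1\<close>, the term \<open>n = 0\<close> of
        the theta series, and a power of \<open>cos (pi / 2) = 0\<close>, which vanishes because the
        exponent is positive.\<close>
      also have "(\<Sum>k<L. ?f L 0 k) + ?f L 0 L = ?f L 0 0 + (\<Sum>k<L. ?f L 0 (Suc k))"
        using sum.lessThan_Suc_shift[of "?f L 0" L] by simp
      then have "(\<Sum>k<L. ?f L 0 k) = 1 + (\<Sum>k<L. ?f L 1 k)"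
        using elim by (simp add: zero_power add.commute)
      finally show ?case
        using suminf_if_le_eq_sum[of 1 L "?f L 1"] by simp
    qed
  qed
  ultimately have "th3 t = 1 / sqrt t * th3 (1 / t)" by (rule LIMSEQ_unique)
  then show ?thesis using t by (simp add: field_simps)
qed

lemma th4_inverse:
  assumes t: "t > 0"
  shows "th4 (1 / t) = sqrt t * th2 t"
proof -
  let ?m = "polya_exponent t"
  let ?f = "\<lambda>L b k. cos ((real k + b) * pi / real (2 * L)) ^ (2 * ?m L)"
  have "(\<lambda>L. 2 * (\<Sum>k. if real k + 1 / 2 \<le> real L then ?f L (1 / 2) k else 0)) \<longlonglongrightarrow> th2 t"
    unfolding th2_def by (intro tendsto_intros polya_cos_sum_limit[OF t]) auto
  moreover have "(\<lambda>L. 2 * (\<Sum>k. if real k + 1 / 2 \<le> real L then ?f L (1 / 2) k else 0)) \<longlonglongrightarrow> 1 / sqrt t * th4 (1 / t)"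
  proof (rule Lim_transform_eventually)
    \<comment> \<open>The half-integral offset produces the shifted squares of \<open>th2\<close> on
      one side and the alternating sign of \<open>th4\<close> on the other.\<close>
    have "cos (2 * pi * (1 / 2) * real (Suc v)) = (-1) ^ Suc v" for v
      using cos_npi[of "Suc v"] by (simp add: mult.commute)
    then show "(\<lambda>L. \<Sum>k<2 * L. ?f L (1 / 2) k) \<longlonglongrightarrow> 1 / sqrt t * th4 (1 / t)"
      using polya_sum_limit[OF t, of "1 / 2"] by (simp only: th4_def) simp
    show "\<forall>\<^sub>F L in sequentially. (\<Sum>k<2 * L. ?f L (1 / 2) k) = 2 * (\<Sum>k. if real k + 1 / 2 \<le> real L then ?f L (1 / 2) k else 0)"
    proof (rule always_eventually, rule allI)
      fix L
      have "(\<Sum>k<2 * L. ?f L (1 / 2) k) = (\<Sum>k<L. ?f L (1 / 2) k) + (\<Sum>k<L. ?f L (1 / 2) k)"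
        unfolding sum_lessThan_double_reflect by (intro arg_cong2[where f = "(+)"] sum.cong refl) (rule trans[OF cos_power_reflect], simp_all)
      then show "(\<Sum>k<2 * L. ?f L (1 / 2) k) = 2 * (\<Sum>k. if real k + 1 / 2 \<le> real L then ?f L (1 / 2) k else 0)"
        using suminf_if_le_eq_sum[of "1 / 2" L "?f L (1 / 2)"] by simp
    qed
  qed
  ultimately have "th2 t = 1 / sqrt t * th4 (1 / t)" by (rule LIMSEQ_unique)
  then show ?thesis using t by (simp add: field_simps)
qed

section \<open>Restriction to the imaginary axis\<close>

lemma qpow_imaginary: "qpow (\<i> * complex_of_real t) r = complex_of_real (exp (- (pi * t * r)))"
  by (simp add: qpow_def exp_of_real [symmetric] mult_ac)

lemma sigma_series_imaginary:
  assumes "t > 0"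
  shows "sigma_series j (\<i> * complex_of_real t) = complex_of_real (sigma_sum j t)"
proof -
  have "summable (\<lambda>n. real (divisor_sigma j (Suc n)) * exp (- 2 * pi * t) ^ Suc n)"
    using summable_Suc_iff[of "\<lambda>n. real (divisor_sigma j n) * exp (- 2 * pi * t) ^ n"]
      summable_sigma[of "exp (- 2 * pi * t)" j] assms by simp
  then have "(\<lambda>n. complex_of_real (real (divisor_sigma j (Suc n)) * exp (- 2 * pi * t) ^ Suc n)) sums complex_of_real (sigma_sum j t)"
    unfolding sigma_sum_def by (intro sums_of_real summable_sums)
  moreover have "qpow (\<i> * complex_of_real t) (2 * real (Suc n)) = complex_of_real (exp (- 2 * pi * t) ^ Suc n)" for n
  proof -
    have "- (pi * t * (2 * real (Suc n))) = real (Suc n) * (- 2 * pi * t)" by simp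
    then show ?thesis unfolding qpow_imaginary by (simp only: exp_of_nat_mult)
  qed
  ultimately show ?thesis
    unfolding sigma_series_def by (simp only: of_real_mult of_real_of_nat_eq sums_iff)
qed

lemma has_sum_int_split:
  fixes g :: "int \<Rightarrow> real"
  assumes "summable (\<lambda>n. norm (g (int n)))" "(\<lambda>n. g (int n)) sums a"
  assumes "summable (\<lambda>n. norm (g (- int (Suc n))))" "(\<lambda>n. g (- int (Suc n))) sums b"
  shows "(g has_sum (a + b)) UNIV"
proof -
  have "((\<lambda>n. g (int n)) has_sum a) UNIV"
    using assms by (intro norm_summable_imp_has_sum)
  then have 1: "(g has_sum a) (range int)"
    by (subst has_sum_reindex) (auto simp: o_def)
  have "((\<lambda>n. g (- int (Suc n))) has_sum b) UNIV"
    using assms by (intro norm_summable_imp_has_sum)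
  then have 2: "(g has_sum b) (range (\<lambda>n. - int (Suc n)))"
    by (subst has_sum_reindex) (auto simp: o_def inj_on_def)
  have "UNIV = range int \<union> range (\<lambda>n. - int (Suc n))"
    using int_cases by blast
  with has_sum_Un_disjoint[OF 1 2] show ?thesis by fastforce
qed

lemma infsum_int_of_real:
  fixes g :: "int \<Rightarrow> real"
  assumes "summable (\<lambda>n. norm (g (int n)))" "(\<lambda>n. g (int n)) sums a"
  assumes "summable (\<lambda>n. norm (g (- int (Suc n))))" "(\<lambda>n. g (- int (Suc n))) sums b"
  shows "(\<Sum>\<^sub>\<infinity>n. complex_of_real (g n)) = complex_of_real (a + b)"
  using has_sum_int_split[OF assms] by (intro infsumI) (rule has_sum_of_real)

lemma summable_theta:
  assumes "t > 0"
  shows "summable (\<lambda>n. exp (- (pi * t * real n ^ 2)))" "summable (\<lambda>n. exp (- (pi * t * real (Suc n) ^ 2)))"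
    "summable (\<lambda>n. exp (- (pi * t * (real n + 1 / 2) ^ 2)))"
proof -
  show 1: "summable (\<lambda>n. exp (- (pi * t * real n ^ 2)))"
    using assms by (intro summable_exp_square) auto
  then show "summable (\<lambda>n. exp (- (pi * t * real (Suc n) ^ 2)))"
    by (subst summable_Suc_iff)
  show "summable (\<lambda>n. exp (- (pi * t * (real n + 1 / 2) ^ 2)))"
  proof (rule summable_comparison_test'[OF 1, of 0])
    fix n :: nat
    have "pi * t * real n ^ 2 \<le> pi * t * (real n + 1 / 2) ^ 2"
      using assms by (intro mult_left_mono power_mono) auto
    then show "norm (exp (- (pi * t * (real n + 1 / 2) ^ 2))) \<le> exp (- (pi * t * real n ^ 2))"
      by simp
  qed
qed

lemma theta_imaginary:
  assumes t: "t > 0"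
  shows "theta2 (\<i> * complex_of_real t) = complex_of_real (th2 t)"
    and "theta3 (\<i> * complex_of_real t) = complex_of_real (th3 t)"
    and "theta4 (\<i> * complex_of_real t) = complex_of_real (th4 t)"
proof -
  have sgn: "(\<lambda>n. (-1) ^ Suc n * exp (- (pi * t * real (Suc n) ^ 2))) sums (\<Sum>n. (-1) ^ Suc n * exp (- (pi * t * real (Suc n) ^ 2)))"
    by (rule summable_sums[OF summable_norm_cancel]) (use summable_theta[OF t] in \<open>simp add: abs_mult\<close>)
  have "(\<Sum>\<^sub>\<infinity>n. complex_of_real (exp (- (pi * t * (real_of_int n + 1 / 2) ^ 2)))) =
      complex_of_real ((\<Sum>n. exp (- (pi * t * (real n + 1 / 2) ^ 2))) + (\<Sum>n. exp (- (pi * t * (real n + 1 / 2) ^ 2))))"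
  proof (rule infsum_int_of_real)
    \<comment> \<open>The symmetry is \<open>n\<close> to \<open>- n - 1\<close>, without a fixed
      point, so the two halves of the series are equal and no central term remains.\<close>
    have neg: "(real_of_int (- int (Suc n)) + 1 / 2) ^ 2 = (real n + 1 / 2) ^ 2" for n
      by (simp add: power2_eq_square algebra_simps)
    show "summable (\<lambda>n. norm (exp (- (pi * t * (real_of_int (int n) + 1 / 2)\<^sup>2))))"
      "(\<lambda>n. exp (- (pi * t * (real_of_int (int n) + 1 / 2)\<^sup>2))) sums (\<Sum>n. exp (- (pi * t * (real n + 1 / 2) ^ 2)))"
      "summable (\<lambda>n. norm (exp (- (pi * t * (real_of_int (- int (Suc n)) + 1 / 2)\<^sup>2))))"
      "(\<lambda>n. exp (- (pi * t * (real_of_int (- int (Suc n)) + 1 / 2)\<^sup>2))) sums (\<Sum>n. exp (- (pi * t * (real n + 1 / 2) ^ 2)))"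
      unfolding neg using summable_theta[OF t] by (auto intro: summable_sums)
  qed
  then show "theta2 (\<i> * complex_of_real t) = complex_of_real (th2 t)"
    unfolding theta2_def qpow_imaginary th2_def by simp
  have "(\<Sum>\<^sub>\<infinity>n. complex_of_real (exp (- (pi * t * (real_of_int n) ^ 2)))) =
      complex_of_real ((\<Sum>n. exp (- (pi * t * real n ^ 2))) + (\<Sum>n. exp (- (pi * t * real (Suc n) ^ 2))))"
  proof (rule infsum_int_of_real)
    have neg: "(real_of_int (- int (Suc n))) ^ 2 = real (Suc n) ^ 2" for n
      by (simp add: power2_eq_square algebra_simps)
    show "summable (\<lambda>n. norm (exp (- (pi * t * (real_of_int (int n))\<^sup>2))))"
      "(\<lambda>n. exp (- (pi * t * (real_of_int (int n))\<^sup>2))) sums (\<Sum>n. exp (- (pi * t * real n ^ 2)))"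
      "summable (\<lambda>n. norm (exp (- (pi * t * (real_of_int (- int (Suc n)))\<^sup>2))))"
      "(\<lambda>n. exp (- (pi * t * (real_of_int (- int (Suc n)))\<^sup>2))) sums (\<Sum>n. exp (- (pi * t * real (Suc n) ^ 2)))"
      unfolding neg using summable_theta[OF t] by (auto intro: summable_sums)
  qed
  moreover have "(\<Sum>n. exp (- (pi * t * real n ^ 2))) = 1 + (\<Sum>n. exp (- (pi * t * real (Suc n) ^ 2)))"
    using suminf_split_head[OF summable_theta(1)[OF t]] by simp
  ultimately show "theta3 (\<i> * complex_of_real t) = complex_of_real (th3 t)"
    unfolding theta3_def qpow_imaginary th3_def by simp
  let ?g = "\<lambda>n::int. (-1) powi n * exp (- (pi * t * (real_of_int n) ^ 2))"
  have "(\<Sum>\<^sub>\<infinity>n. complex_of_real (?g n)) =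
      complex_of_real ((\<Sum>n. (-1) ^ n * exp (- (pi * t * real n ^ 2))) + (\<Sum>n. (-1) ^ Suc n * exp (- (pi * t * real (Suc n) ^ 2))))"
  proof (rule infsum_int_of_real)
    have neg: "?g (- int (Suc n)) = (-1) ^ Suc n * exp (- (pi * t * real (Suc n) ^ 2))" for n
    proof -
      have "(-1 :: real) powi (- int (Suc n)) = (-1) ^ Suc n"
        by (simp only: power_int_minus power_int_of_nat) (cases "even n"; simp)
      moreover have "(real_of_int (- int (Suc n))) ^ 2 = real (Suc n) ^ 2"
        by (simp add: power2_eq_square algebra_simps)
      ultimately show ?thesis by (simp only:)
    qed
    have pos: "?g (int n) = (-1) ^ n * exp (- (pi * t * real n ^ 2))" for n by simp
    show s: "summable (\<lambda>n. norm (?g (int n)))" "summable (\<lambda>n. norm (?g (- int (Suc n))))"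
      unfolding neg pos using summable_theta[OF t] by (simp_all add: abs_mult)
    show "(\<lambda>n. ?g (int n)) sums (\<Sum>n. (-1) ^ n * exp (- (pi * t * real n ^ 2)))"
      using s(1) unfolding pos by (rule summable_sums[OF summable_norm_cancel])
    show "(\<lambda>n. ?g (- int (Suc n))) sums (\<Sum>n. (-1) ^ Suc n * exp (- (pi * t * real (Suc n) ^ 2)))"
      unfolding neg by (rule sgn)
  qed
  moreover have "(\<Sum>n. (-1) ^ n * exp (- (pi * t * real n ^ 2))) = 1 + (\<Sum>n. (-1) ^ Suc n * exp (- (pi * t * real (Suc n) ^ 2)))"
  proof -
    have "summable (\<lambda>n. (-1) ^ n * exp (- (pi * t * real n ^ 2)))"
      by (rule summable_norm_cancel) (use summable_theta[OF t] in \<open>simp add: abs_mult\<close>)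
    from suminf_split_head[OF this] show ?thesis by simp
  qed
  moreover have "(\<Sum>\<^sub>\<infinity>n. complex_of_real (?g n)) = theta4 (\<i> * complex_of_real t)"
    unfolding theta4_def qpow_imaginary by (simp add: of_real_power_int)
  ultimately have "theta4 (\<i> * complex_of_real t) = complex_of_real (1 + (\<Sum>n. (-1) ^ Suc n * exp (- (pi * t * real (Suc n) ^ 2)))
      + (\<Sum>n. (-1) ^ Suc n * exp (- (pi * t * real (Suc n) ^ 2))))"
    by (simp only:)
  then show "theta4 (\<i> * complex_of_real t) = complex_of_real (th4 t)"
    unfolding th4_def by (simp only: mult_2 add.assoc)
qed

definition phi0r :: "real \<Rightarrow> real" where
  "phi0r t = 1728 * ((E2r t * E4r t - E6r t) ^ 2 / (E4r t ^ 3 - E6r t ^ 2))"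

definition psir :: "real \<Rightarrow> real" where
  "psir t = 128 * ((th3 t ^ 4 + th4 t ^ 4) / th2 t ^ 8 + (th4 t ^ 4 - th2 t ^ 4) / th3 t ^ 8)"

lemma A_B_real:
  assumes t: "t > 0"
  shows "A t = complex_of_real (- (t ^ 2 * phi0r (1 / t)) - 36 / pi ^ 2 * psir t)"
    and "B t = complex_of_real (- (t ^ 2 * phi0r (1 / t)) + 36 / pi ^ 2 * psir t)"
proof -
  have E: "E2 (\<i> * complex_of_real s) = complex_of_real (E2r s)" "E4 (\<i> * complex_of_real s) = complex_of_real (E4r s)"
    "E6 (\<i> * complex_of_real s) = complex_of_real (E6r s)" if "s > 0" for s
    using that by (simp_all add: E2_def E4_def E6_def E2r_def E4r_def E6r_def sigma_series_imaginary)
  have "\<i> / complex_of_real t = \<i> * complex_of_real (1 / t)" by simp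
  then have phi: "phi0 (\<i> / complex_of_real t) = complex_of_real (phi0r (1 / t))"
    using t by (simp only: phi0_def E[of "1 / t"] zero_less_divide_1_iff) (simp add: phi0r_def)
  have psi: "psiI (\<i> * complex_of_real t) = complex_of_real (psir t)"
    unfolding psiI_def theta_imaginary[OF t] by (simp add: psir_def)
  show "A t = complex_of_real (- (t ^ 2 * phi0r (1 / t)) - 36 / pi ^ 2 * psir t)"
    "B t = complex_of_real (- (t ^ 2 * phi0r (1 / t)) + 36 / pi ^ 2 * psir t)"
    unfolding A_def B_def phi psi by simp_all
qed

section \<open>Estimates for small nome\<close>

text \<open>Both bounds are read off from the series for \<open>pi ^ 2 / 6\<close>. Seven is the
  least number of terms exceeding \<open>3 / 2\<close>; above, the terms from the second on are
  dominated by a telescoping series of sum \<open>2 / 3\<close>, which gives exactly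
  \<open>5 / 3\<close>.\<close>

lemma pi_squared_bounds: "pi ^ 2 > 9" "pi ^ 2 \<le> 10"
proof -
  have s: "(\<lambda>n. 1 / real (Suc n) ^ 2) sums (pi ^ 2 / 6)"
    using sums_zeta_even[of 0] by (simp add: zeta_even_values power2_eq_square)
  have "(\<Sum>n<7. 1 / real (Suc n) ^ 2) \<le> (\<Sum>n. 1 / real (Suc n) ^ 2)"
    by (rule sum_le_suminf) (use s in \<open>auto simp: sums_iff\<close>)
  also have "\<dots> = pi ^ 2 / 6" using s by (simp add: sums_iff)
  finally show "pi ^ 2 > 9" by (simp add: eval_nat_numeral)
  have 1: "(\<lambda>n. 1 / real (Suc (Suc n)) ^ 2) sums (pi ^ 2 / 6 - 1)"
    using s by (subst sums_Suc_iff[of "\<lambda>n. 1 / real (Suc n) ^ 2"]) simp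
  have "(\<lambda>n. 1 / (real n + 3 / 2)) \<longlonglongrightarrow> 0" by real_asymp
  from telescope_sums'[OF this]
  have 2: "(\<lambda>n. 1 / (real n + 3 / 2) - 1 / (real (Suc n) + 3 / 2)) sums (2 / 3)" by simp
  have "1 / real (Suc (Suc n)) ^ 2 \<le> 1 / (real n + 3 / 2) - 1 / (real (Suc n) + 3 / 2)" for n
  proof -
    have "1 / (real n + 3 / 2) - 1 / (real (Suc n) + 3 / 2) = 1 / ((real n + 3 / 2) * (real (Suc n) + 3 / 2))"
      by (simp add: field_simps)
    moreover have "(real n + 3 / 2) * (real (Suc n) + 3 / 2) \<le> real (Suc (Suc n)) ^ 2"
      by (simp add: power2_eq_square algebra_simps)
    ultimately show ?thesis by (simp add: frac_le)
  qed
  from sums_le[OF this 1 2] show "pi ^ 2 \<le> 10" by simp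
qed

lemma pi_gt_3: "pi > 3"
proof (rule ccontr)
  assume "\<not> pi > 3"
  then have "pi ^ 2 \<le> 3 ^ 2" by (intro power_mono) auto
  then show False using pi_squared_bounds(1) by simp
qed

lemma exp_3_ge_20: "exp (3 :: real) \<ge> 20"
proof -
  have "(\<Sum>n<6. inverse (fact n) * 1 ^ n) \<le> (\<Sum>n. inverse (fact n) * (1 :: real) ^ n)"
    by (rule sum_le_suminf[OF summable_exp]) auto
  \<comment> \<open>The sum of the first six terms of the series; five would give a cube below
    20.\<close>
  then have "exp (1 :: real) \<ge> 163 / 60"
    by (simp add: exp_def eval_nat_numeral scaleR_conv_of_real)
  then have "exp (1 :: real) ^ 3 \<ge> (163 / 60) ^ 3" by (intro power_mono) auto
  moreover have "(20 :: real) \<le> (163 / 60) ^ 3" by (simp add: power3_eq_cube)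
  moreover have "exp (1 :: real) ^ 3 = exp 3" by (simp flip: exp_of_nat_mult)
  ultimately show ?thesis by linarith
qed

text \<open>The tangent of the exponential at 3. The bound is for the factor \<open>pi * t\<close>,
  which comes from the anomaly of \<open>E2\<close> and is not bounded for
  \<open>t \<ge> 1\<close>.\<close>

lemma mult_exp_minus_le:
  assumes "(u :: real) \<ge> 3"
  shows "u * exp (- u) \<le> 3 / 20"
proof -
  have "20 * (1 + (u - 3)) \<le> exp 3 * exp (u - 3)"
    using exp_3_ge_20 assms by (intro mult_mono exp_ge_add_one_self) auto
  also have "\<dots> = exp u" by (simp flip: exp_add)
  finally have "3 * (20 * (1 + (u - 3))) \<le> 3 * exp u" by simp
  moreover have "20 * u \<le> 3 * (20 * (1 + (u - 3)))" using assms by simp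
  ultimately have "20 * u \<le> 3 * exp u" by (rule order_trans[rotated])
  then show ?thesis by (simp add: exp_minus field_simps)
qed

lemma nome_le:
  assumes "s \<ge> 1"
  shows "exp (- (pi * s)) \<le> 1 / 20"
proof -
  have "3 * 1 \<le> pi * s" using assms pi_gt_3 by (intro mult_mono) auto
  then have "exp 3 \<le> exp (pi * s)" by simp
  then have "20 \<le> exp (pi * s)" using exp_3_ge_20 by linarith
  then show ?thesis by (simp add: exp_minus field_simps)
qed

text \<open>Each step multiplies the left side by at most \<open>(4 / 3) ^ 6\<close>, which is less
  than 6. The tail of a divisor series is thereby dominated by a geometric one of ratio
  \<open>6 * y\<close>.\<close>

lemma power_le_geometric:
  assumes "j \<le> 5"
  shows "real (i + 3) ^ Suc j \<le> 3 ^ Suc j * 6 ^ i"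
proof (induction i)
  case (Suc i)
  have "real (Suc i + 3) \<le> 4 / 3 * real (i + 3)" by simp
  then have "real (Suc i + 3) ^ Suc j \<le> (4 / 3 * real (i + 3)) ^ Suc j" by (intro power_mono) auto
  also have "\<dots> = (4 / 3) ^ Suc j * real (i + 3) ^ Suc j" by (rule power_mult_distrib)
  also have "\<dots> \<le> (4 / 3) ^ 6 * (3 ^ Suc j * 6 ^ i)"
    using assms Suc by (intro mult_mono power_increasing) auto
  also have "\<dots> \<le> 6 * (3 ^ Suc j * 6 ^ i)" by (intro mult_right_mono) (auto simp: eval_nat_numeral)
  finally show ?case by simp
qed simp

text \<open>Two terms are kept exactly. The factor \<open>102 / 100\<close> bounds
  \<open>1 / (1 - 6 * y)\<close> for \<open>y \<le> 1 / 400\<close>.\<close>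

lemma sigma_sum_bounds:
  assumes "j \<le> 5" and y: "y = exp (- 2 * pi * s)" "y \<le> 1 / 400"
  shows "y + (1 + 2 ^ j) * y ^ 2 \<le> sigma_sum j s"
    and "sigma_sum j s \<le> y + (1 + 2 ^ j) * y ^ 2 + 102 / 100 * 3 ^ Suc j * y ^ 3"
proof -
  have y0: "0 < y" by (simp add: y)
  define f where "f = (\<lambda>n. real (divisor_sigma j (Suc n)) * y ^ Suc n)"
  have sf: "summable f"
    unfolding f_def using summable_Suc_iff[of "\<lambda>n. real (divisor_sigma j n) * y ^ n"] summable_sigma[of y j] y0 y(2) by simp
  have d: "divisor_sigma j (Suc 0) = 1" "divisor_sigma j 2 = 1 + 2 ^ j"
  proof -
    have "{d::nat. d dvd 2} = {1, 2}"
      using two_is_prime_nat by (auto simp: prime_nat_iff)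
    then show "divisor_sigma j (Suc 0) = 1" "divisor_sigma j 2 = 1 + 2 ^ j"
      by (simp_all add: divisor_sigma_def)
  qed
  have split: "sigma_sum j s = (\<Sum>n. f (n + 2)) + (y + (1 + 2 ^ j) * y ^ 2)"
  proof -
    have "sigma_sum j s = suminf f" by (simp add: sigma_sum_def f_def y(1))
    also have "\<dots> = (\<Sum>n. f (n + 2)) + (\<Sum>n<2. f n)" by (rule suminf_split_initial_segment[OF sf])
    also have "(\<Sum>n<2. f n) = y + (1 + 2 ^ j) * y ^ 2"
      using d by (simp add: f_def eval_nat_numeral)
    finally show ?thesis .
  qed
  have sf2: "summable (\<lambda>n. f (n + 2))" using sf by (subst summable_iff_shift)
  have "0 \<le> (\<Sum>n. f (n + 2))"
    by (rule suminf_nonneg[OF sf2]) (use y0 in \<open>simp add: f_def\<close>)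
  then show "y + (1 + 2 ^ j) * y ^ 2 \<le> sigma_sum j s" using split by simp
  have le: "f (n + 2) \<le> 3 ^ Suc j * y ^ 3 * (6 * y) ^ n" for n
  proof -
    have "real (divisor_sigma j (n + 3)) \<le> real (n + 3) ^ Suc j"
      using divisor_sigma_le[of j "n + 3", folded of_nat_le_iff[where 'a = real]] by (simp only: of_nat_power)
    also have "\<dots> \<le> 3 ^ Suc j * 6 ^ n" by (rule power_le_geometric[OF assms(1)])
    finally have "real (divisor_sigma j (n + 3)) * y ^ (n + 3) \<le> 3 ^ Suc j * 6 ^ n * y ^ (n + 3)"
      using y0 by (intro mult_right_mono) auto
    then show ?thesis
      by (simp add: f_def power_add power_mult_distrib mult_ac eval_nat_numeral)
  qed
  have g: "(\<lambda>n. 3 ^ Suc j * y ^ 3 * (6 * y) ^ n) sums (3 ^ Suc j * y ^ 3 * (1 / (1 - 6 * y)))"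
    using y0 y(2) by (intro sums_mult geometric_sums) auto
  have "(\<Sum>n. f (n + 2)) \<le> 3 ^ Suc j * y ^ 3 * (1 / (1 - 6 * y))"
    by (rule sums_le[OF le summable_sums[OF sf2] g])
  also have "\<dots> \<le> 3 ^ Suc j * y ^ 3 * (102 / 100)"
    using y0 y(2) by (intro mult_left_mono) (auto simp: field_simps)
  finally show "sigma_sum j s \<le> y + (1 + 2 ^ j) * y ^ 2 + 102 / 100 * 3 ^ Suc j * y ^ 3"
    using split by (simp add: mult_ac)
qed

text \<open>The quadratic coefficients 72, 2160 and 16632 are the exact ones, 24, 240 and 504 times
  \<open>1 + 2 ^ j\<close>. The larger ones 75, 2232 and 17640 absorb the tail by
  \<open>y ^ 3 \<le> y ^ 2 / 400\<close>.\<close>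

lemma Eisenstein_bounds:
  assumes "y = exp (- 2 * pi * s)" "y \<le> 1 / 400"
  shows "1 - 24 * y - 75 * y ^ 2 \<le> E2r s" "E2r s \<le> 1 - 24 * y - 72 * y ^ 2"
    "1 + 240 * y + 2160 * y ^ 2 \<le> E4r s" "E4r s \<le> 1 + 240 * y + 2232 * y ^ 2"
    "1 - 504 * y - 17640 * y ^ 2 \<le> E6r s" "E6r s \<le> 1 - 504 * y - 16632 * y ^ 2"
proof -
  have y0: "0 < y" by (simp add: assms)
  have y3: "y ^ 3 \<le> 1 / 400 * y ^ 2"
    using mult_right_mono[OF assms(2), of "y ^ 2"] by (simp add: power3_eq_cube power2_eq_square)
  have y2: "0 \<le> y ^ 2" by simp
  show "1 - 24 * y - 75 * y ^ 2 \<le> E2r s" "E2r s \<le> 1 - 24 * y - 72 * y ^ 2"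
    "1 + 240 * y + 2160 * y ^ 2 \<le> E4r s" "E4r s \<le> 1 + 240 * y + 2232 * y ^ 2"
    "1 - 504 * y - 17640 * y ^ 2 \<le> E6r s" "E6r s \<le> 1 - 504 * y - 16632 * y ^ 2"
    using sigma_sum_bounds[OF _ assms, of 1] sigma_sum_bounds[OF _ assms, of 3] sigma_sum_bounds[OF _ assms, of 5] y3 y2
    unfolding E2r_def E4r_def E6r_def by (simp_all add: algebra_simps)
qed

text \<open>The inversion at the fixed point forces \<open>E6r 1 = 0\<close>, and the series is
  monotone. The truncations cannot show this sign: at \<open>y = 1 / 400\<close> already
  \<open>1 - 504 * y\<close> is negative.\<close>

lemma E6r_nonneg:
  assumes "s \<ge> 1"
  shows "E6r s \<ge> 0"
proof -
  have "sigma_sum 5 s \<le> sigma_sum 5 1"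
    unfolding sigma_sum_def
  proof (rule suminf_le)
    have sm: "summable (\<lambda>n. real (divisor_sigma 5 (Suc n)) * exp (- 2 * pi * s) ^ Suc n)" if "s \<ge> 1" for s
      using summable_Suc_iff[of "\<lambda>n. real (divisor_sigma 5 n) * exp (- 2 * pi * s) ^ n"]
        summable_sigma[of "exp (- 2 * pi * s)" 5] that by simp
    show "summable (\<lambda>n. real (divisor_sigma 5 (Suc n)) * exp (- 2 * pi * s) ^ Suc n)"
      "summable (\<lambda>n. real (divisor_sigma 5 (Suc n)) * exp (- 2 * pi * 1) ^ Suc n)"
      using sm assms by blast+
    show "real (divisor_sigma 5 (Suc n)) * exp (- 2 * pi * s) ^ Suc n \<le> real (divisor_sigma 5 (Suc n)) * exp (- 2 * pi * 1) ^ Suc n" for n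
      using assms by (intro mult_left_mono power_mono) auto
  qed
  moreover have "E6r 1 = 0" using E6r_inverse[of 1] by simp
  ultimately show ?thesis by (simp add: E6r_def)
qed

text \<open>Squaring the upper bound of \<open>E6r\<close> is justified by its sign. As the
  truncations are exact up to \<open>y ^ 2\<close>, the polynomial difference reproduces
  \<open>1728 * (y - 24 * y ^ 2)\<close>, and what remains has positive coefficients.\<close>

lemma discriminant_lower_bound:
  assumes s: "s \<ge> 1" and y: "y = exp (- 2 * pi * s)" "y \<le> 1 / 400"
  shows "1728 * (y * (1 - 24 * y)) \<le> E4r s ^ 3 - E6r s ^ 2"
proof -
  have y0: "0 < y" by (simp add: y)
  have "(1 + 240 * y + 2160 * y ^ 2) ^ 3 \<le> E4r s ^ 3"
    using Eisenstein_bounds(3)[OF y] y0 by (intro power_mono) auto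
  moreover have "E6r s ^ 2 \<le> (1 - 504 * y - 16632 * y ^ 2) ^ 2"
    using Eisenstein_bounds(6)[OF y] E6r_nonneg[OF s] by (intro power_mono) auto
  moreover have "(1 + 240 * y + 2160 * y ^ 2) ^ 3 - (1 - 504 * y - 16632 * y ^ 2) ^ 2 - 1728 * (y * (1 - 24 * y)) =
      169344 * y ^ 3 + 110621376 * y ^ 4 + 3359232000 * y ^ 5 + 10077696000 * y ^ 6"
    by (simp add: algebra_simps eval_nat_numeral)
  moreover have "0 \<le> 169344 * y ^ 3 + 110621376 * y ^ 4 + 3359232000 * y ^ 5 + 10077696000 * y ^ 6"
    using y0 by simp
  ultimately show ?thesis by linarith
qed

text \<open>The constant terms cancel and the linear ones give \<open>216 + 504 = 720\<close>. The
  factor \<open>1 + 20 * y\<close> leaves room above the true expansion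
  \<open>720 * (y + 18 * y ^ 2 + ...)\<close>.\<close>

lemma E2E4_minus_E6_bounds:
  assumes y: "y = exp (- 2 * pi * s)" "y \<le> 1 / 400"
  shows "720 * y \<le> E2r s * E4r s - E6r s" "E2r s * E4r s - E6r s \<le> 720 * y * (1 + 20 * y)"
proof -
  note E = Eisenstein_bounds[OF y]
  have y0: "0 < y" by (simp add: y)
  have y2: "y ^ 2 \<le> 1 / 400 * y" using mult_right_mono[OF y(2), of y] y0 by (simp add: power2_eq_square)
  have y3: "y ^ 3 \<le> 1 / 400 * y ^ 2"
    using mult_right_mono[OF y(2), of "y ^ 2"] by (simp add: power3_eq_cube power2_eq_square)
  have y4: "y ^ 4 \<le> 1 / 400 * y ^ 3"
    using mult_right_mono[OF y(2), of "y ^ 3"] y0 by (simp add: eval_nat_numeral)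
  have nn: "0 \<le> y ^ 2" "0 \<le> y ^ 3" "0 \<le> y ^ 4" using y0 by auto
  have "(1 - 24 * y - 75 * y ^ 2) * (1 + 240 * y + 2160 * y ^ 2) \<le> E2r s * E4r s"
    using E y0 y2 y(2) by (intro mult_mono) auto
  moreover have "(1 - 24 * y - 75 * y ^ 2) * (1 + 240 * y + 2160 * y ^ 2) =
      1 + 216 * y - 3675 * y ^ 2 - 69840 * y ^ 3 - 162000 * y ^ 4"
    by (simp add: algebra_simps eval_nat_numeral)
  ultimately show "720 * y \<le> E2r s * E4r s - E6r s"
    using E(6) y3 y4 nn by linarith
  have "E2r s * E4r s \<le> (1 - 24 * y) * (1 + 240 * y + 2232 * y ^ 2)"
    using E y0 y2 y(2) nn by (intro mult_mono) auto
  moreover have "(1 - 24 * y) * (1 + 240 * y + 2232 * y ^ 2) = 1 + 216 * y - 3528 * y ^ 2 - 53568 * y ^ 3"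
    by (simp add: algebra_simps eval_nat_numeral)
  moreover have "720 * y * (1 + 20 * y) = 720 * y + 14400 * y ^ 2"
    by (simp add: algebra_simps eval_nat_numeral)
  ultimately show "E2r s * E4r s - E6r s \<le> 720 * y * (1 + 20 * y)"
    using E(5) nn by linarith
qed

section \<open>Truncated theta series and lower bounds for \<open>psi_I\<close>\<close>

context
  fixes s q :: real
  assumes q_eq: "q = exp (- (pi * s))" and q_le: "q \<le> 1 / 20"
begin

lemma nome_pos: "0 < q"
  by (simp add: q_eq)

lemma nome_power_le: "q ^ 2 \<le> 1 / 400" "q ^ 2 \<le> 1 / 20 * q" "q ^ 4 \<le> 1 / 8000 * q" "q ^ 4 \<le> 1 / 400 * q ^ 2"
proof -
  have "q ^ 2 \<le> (1 / 20) ^ 2" using nome_pos q_le by (intro power_mono) auto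
  then show 2: "q ^ 2 \<le> 1 / 400" by (simp add: power2_eq_square)
  show "q ^ 2 \<le> 1 / 20 * q" using mult_right_mono[OF q_le, of q] nome_pos by (simp add: power2_eq_square)
  have "q ^ 3 \<le> (1 / 20) ^ 3" using nome_pos q_le by (intro power_mono) auto
  then have "q ^ 3 * q \<le> 1 / 8000 * q" using nome_pos by (intro mult_right_mono) (auto simp: power3_eq_cube)
  then show "q ^ 4 \<le> 1 / 8000 * q" by (simp add: eval_nat_numeral mult_ac)
  have "q ^ 2 * q ^ 2 \<le> 1 / 400 * q ^ 2" using 2 by (intro mult_right_mono) auto
  then show "q ^ 4 \<le> 1 / 400 * q ^ 2" by (simp add: eval_nat_numeral mult_ac)
qed

lemma exp_square_eq: "exp (- (pi * s * real n ^ 2)) = q ^ n ^ 2"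
  by (simp add: q_eq mult_ac flip: exp_of_nat_mult)

lemma nome_squares:
  "(\<lambda>n. q ^ (Suc n) ^ 2) sums (\<Sum>n. q ^ (Suc n) ^ 2)"
  "(\<Sum>n. q ^ (Suc (Suc n)) ^ 2) \<le> 3 / 2 * q ^ 4"
  "(\<lambda>n. q ^ (Suc (Suc n)) ^ 2) sums (\<Sum>n. q ^ (Suc (Suc n)) ^ 2)"
proof -
  have le: "q ^ (Suc (Suc n)) ^ 2 \<le> q ^ 4 * q ^ n" for n
  proof -
    have "4 + n \<le> (Suc (Suc n)) ^ 2" by (simp add: power2_eq_square)
    then show ?thesis
      using nome_pos q_le by (subst power_add [symmetric]) (intro power_decreasing, auto)
  qed
  have g: "(\<lambda>n. q ^ 4 * q ^ n) sums (q ^ 4 * (1 / (1 - q)))"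
    using nome_pos q_le by (intro sums_mult geometric_sums) auto
  have sm: "summable (\<lambda>n. q ^ (Suc (Suc n)) ^ 2)"
    by (rule summable_comparison_test'[OF sums_summable[OF g], of 0]) (use le nome_pos in auto)
  then show sums: "(\<lambda>n. q ^ (Suc (Suc n)) ^ 2) sums (\<Sum>n. q ^ (Suc (Suc n)) ^ 2)"
    by (rule summable_sums)
  have "(\<Sum>n. q ^ (Suc (Suc n)) ^ 2) \<le> q ^ 4 * (1 / (1 - q))"
    by (rule sums_le[OF le sums g])
  also have "\<dots> \<le> q ^ 4 * (3 / 2)"
    using q_le by (intro mult_left_mono) (auto simp: field_simps)
  finally show "(\<Sum>n. q ^ (Suc (Suc n)) ^ 2) \<le> 3 / 2 * q ^ 4" by simp
  show "(\<lambda>n. q ^ (Suc n) ^ 2) sums (\<Sum>n. q ^ (Suc n) ^ 2)"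
    using sm summable_Suc_iff[of "\<lambda>n. q ^ (Suc n) ^ 2"] by (intro summable_sums) simp
qed

lemma th3_ge: "1 + 2 * q \<le> th3 s"
proof -
  have "q \<le> (\<Sum>n. q ^ (Suc n) ^ 2)"
    using sum_le_suminf[OF sums_summable[OF nome_squares(1)], of "{0}"] nome_pos by simp
  then show ?thesis
    unfolding th3_def exp_square_eq by simp
qed

lemma th4_bounds: "1 - 2 * q - 3 * q ^ 4 \<le> th4 s" "th4 s \<le> 1 - 2 * q + 3 * q ^ 4"
proof -
  let ?f = "\<lambda>n. (-1) ^ Suc n * q ^ (Suc n) ^ 2"
  have "summable (\<lambda>n. norm (?f n))"
    using sums_summable[OF nome_squares(1)] nome_pos by (simp add: abs_mult)
  then have sm: "summable ?f" by (rule summable_norm_cancel)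
  have norms: "summable (\<lambda>n. norm (?f (Suc n)))"
    using sums_summable[OF nome_squares(3)] nome_pos by (simp add: abs_mult del: power_Suc)
  have "norm (\<Sum>n. ?f (Suc n)) \<le> (\<Sum>n. norm (?f (Suc n)))"
    using norms by (rule summable_norm)
  also have "\<dots> = (\<Sum>n. q ^ (Suc (Suc n)) ^ 2)"
    using nome_pos by (simp add: abs_mult power_abs)
  also have "\<dots> \<le> 3 / 2 * q ^ 4" by (rule nome_squares(2))
  finally have "\<bar>\<Sum>n. ?f (Suc n)\<bar> \<le> 3 / 2 * q ^ 4" by simp
  moreover have "(\<Sum>n. ?f n) = (\<Sum>n. ?f (Suc n)) - q"
    using suminf_split_head[OF sm] by simp
  moreover have "th4 s = 1 + 2 * (\<Sum>n. ?f n)"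
    unfolding th4_def exp_square_eq ..
  ultimately show "1 - 2 * q - 3 * q ^ 4 \<le> th4 s" "th4 s \<le> 1 - 2 * q + 3 * q ^ 4"
    by (auto simp: abs_le_iff)
qed

text \<open>From \<open>(n + 1/2)^2 = 1/4 + (n^2 + n)\<close> the series is \<open>2 q^(1/4)\<close>
  times one in \<open>q ^ (n ^ 2 + n)\<close>, which lies between 1 and the geometric series in
  \<open>q ^ 2\<close>. The fourth power disposes of the fractional exponent.\<close>

lemma th2_power4_bounds: "16 * q \<le> th2 s ^ 4" "th2 s ^ 4 \<le> 16 * q / (1 - q ^ 2) ^ 4" "0 < th2 s"
proof -
  let ?g = "\<lambda>n. q ^ (n ^ 2 + n)"
  have qq: "q ^ 2 < 1"
    using nome_power_le(1) by linarith
  have le: "?g n \<le> (q ^ 2) ^ n" for n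
  proof -
    have "2 * n \<le> n ^ 2 + n" by (cases n) (auto simp: power2_eq_square)
    then show ?thesis
      using nome_pos q_le unfolding power_mult [symmetric] by (intro power_decreasing) auto
  qed
  have geo: "(\<lambda>n. (q ^ 2) ^ n) sums (1 / (1 - q ^ 2))"
    using qq nome_pos by (intro geometric_sums) auto
  have sm: "summable ?g"
    by (rule summable_comparison_test'[OF sums_summable[OF geo], of 0]) (use le nome_pos in auto)
  have up: "suminf ?g \<le> 1 / (1 - q ^ 2)"
    by (rule sums_le[OF le summable_sums[OF sm] geo])
  have low: "1 \<le> suminf ?g"
    using sum_le_suminf[OF sm, of "{0}"] nome_pos by simp
  have "exp (- (pi * s * (real n + 1 / 2) ^ 2)) = exp (- (pi * s / 4)) * ?g n" for n
  proof -
    have "- (pi * s * (real n + 1 / 2) ^ 2) = - (pi * s / 4) + real (n ^ 2 + n) * (- (pi * s))"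
      by (simp add: power2_eq_square algebra_simps)
    then show ?thesis by (simp only: exp_add exp_of_nat_mult q_eq)
  qed
  then have th2: "th2 s = 2 * exp (- (pi * s / 4)) * suminf ?g"
    using suminf_mult[OF sm, of "exp (- (pi * s / 4))"] by (simp add: th2_def)
  have "exp (- (pi * s / 4)) ^ 4 = q"
    by (simp add: q_eq flip: exp_of_nat_mult)
  then have th24: "th2 s ^ 4 = 16 * q * suminf ?g ^ 4"
    by (simp add: th2 power_mult_distrib)
  show "16 * q \<le> th2 s ^ 4"
    unfolding th24 using low nome_pos one_le_power[OF low, of 4] by simp
  have "suminf ?g ^ 4 \<le> (1 / (1 - q ^ 2)) ^ 4"
    using up low by (intro power_mono) auto
  then have "16 * q * suminf ?g ^ 4 \<le> 16 * q * (1 / (1 - q ^ 2)) ^ 4"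
    using nome_pos by (intro mult_left_mono) auto
  then show "th2 s ^ 4 \<le> 16 * q / (1 - q ^ 2) ^ 4"
    by (simp add: th24 power_divide)
  show "0 < th2 s" unfolding th2 using low by simp
qed

lemma psir_lower_bound: "1 / q ^ 2 - 104 \<le> psir s"
proof -
  define y where "y = q ^ 2"
  note q0 = nome_pos
  have y: "0 < y" "y \<le> 1 / 400" using q0 nome_power_le by (auto simp: y_def)
  have th4: "0 < th4 s" using th4_bounds(1) nome_power_le q_le by linarith
  have th3: "1 \<le> th3 s" using th3_ge q0 by linarith
  \<comment> \<open>In the sum of the two fourth powers the odd powers of \<open>q\<close> cancel;
    the term \<open>32 * q ^ 4\<close> pays for the error \<open>12 * q ^ 4\<close> of
    \<open>th4\<close>.\<close>
  have "2 + 48 * y \<le> th3 s ^ 4 + th4 s ^ 4"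
  proof -
    have "(1 + 2 * q) ^ 4 \<le> th3 s ^ 4" using th3_ge q0 by (intro power_mono) auto
    moreover have "(1 + 2 * q) ^ 4 = 1 + 8 * q + 24 * q ^ 2 + 32 * q ^ 3 + 16 * q ^ 4"
      by (simp add: algebra_simps eval_nat_numeral)
    moreover have "(1 - 2 * q - 3 * q ^ 4) ^ 4 \<le> th4 s ^ 4"
      using th4_bounds(1) nome_power_le q_le by (intro power_mono) auto
    moreover have "(1 - 2 * q - 3 * q ^ 4) ^ 4 \<ge> (1 - 2 * q) ^ 4 - 12 * q ^ 4"
    proof -
      define a d where "a = 1 - 2 * q" and "d = 3 * q ^ 4"
      have a: "0 \<le> a" "a \<le> 1" "0 \<le> d" "d \<le> a" using q0 q_le nome_power_le by (auto simp: a_def d_def)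
      have "a ^ 4 - (a - d) ^ 4 = d * (a ^ 3 + a ^ 2 * (a - d) + a * (a - d) ^ 2 + (a - d) ^ 3)"
        by (simp add: algebra_simps eval_nat_numeral)
      also have "\<dots> \<le> d * (1 + 1 * 1 + 1 * 1 + 1)"
        using a by (intro mult_left_mono add_mono mult_mono power_le_one) auto
      finally show ?thesis by (simp add: a_def d_def)
    qed
    moreover have "(1 - 2 * q) ^ 4 = 1 - 8 * q + 24 * q ^ 2 - 32 * q ^ 3 + 16 * q ^ 4"
      by (simp add: algebra_simps eval_nat_numeral)
    moreover have "0 \<le> q ^ 4" using q0 by simp
    ultimately show ?thesis unfolding y_def by linarith
  qed
  \<comment> \<open>The true coefficient is 8. The generous 24 matches
    \<open>2 + 48 * y = 2 * (1 + 24 * y)\<close>, so that the quotient collapses to exactly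
    \<open>1 / (128 * y)\<close>.\<close>
  moreover have "th2 s ^ 8 \<le> 256 * y * (1 + 24 * y)"
  proof -
    have "th2 s ^ 8 = (th2 s ^ 4) ^ 2" by (simp flip: power_mult)
    also have "\<dots> \<le> (16 * q / (1 - q ^ 2) ^ 4) ^ 2"
      using th2_power4_bounds by (intro power_mono) auto
    also have "\<dots> = 256 * y * (1 / (1 - y) ^ 8)"
      by (simp add: y_def power_divide power_mult_distrib flip: power_mult)
    also have "\<dots> \<le> 256 * y * (1 + 24 * y)"
    proof -
      have "1 + 8 * (- y) \<le> (1 + - y) ^ 8"
        using Bernoulli_inequality[of "- y" 8] y by simp
      moreover have "1 \<le> (1 + 24 * y) * (1 + 8 * (- y))"
      proof -
        have "(1 + 24 * y) * (1 + 8 * (- y)) = 1 + y * (16 - 192 * y)" by (simp add: algebra_simps)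
        moreover have "0 \<le> y * (16 - 192 * y)" using y by (intro mult_nonneg_nonneg) auto
        ultimately show ?thesis by linarith
      qed
      moreover have "(1 + 24 * y) * (1 + 8 * (- y)) \<le> (1 + 24 * y) * (1 + - y) ^ 8"
        using calculation(1) y by (intro mult_left_mono) auto
      ultimately have "1 \<le> (1 + 24 * y) * (1 - y) ^ 8" by simp
      moreover have "0 < (1 - y) ^ 8" using y by simp
      ultimately have "1 / (1 - y) ^ 8 \<le> 1 + 24 * y" by (simp add: pos_divide_le_eq)
      then show ?thesis using y by (intro mult_left_mono) auto
    qed
    finally show ?thesis .
  qed
  ultimately have "(2 + 48 * y) / (256 * y * (1 + 24 * y)) \<le> (th3 s ^ 4 + th4 s ^ 4) / th2 s ^ 8"
    using th2_power4_bounds(3) y by (intro frac_le) auto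
  moreover have "(2 + 48 * y) / (256 * y * (1 + 24 * y)) = 1 / (128 * y)"
    using y by (simp add: divide_simps)
  ultimately have "128 * (1 / (128 * y)) \<le> 128 * ((th3 s ^ 4 + th4 s ^ 4) / th2 s ^ 8)"
    by (intro mult_left_mono) simp_all
  then have first: "1 / y \<le> 128 * ((th3 s ^ 4 + th4 s ^ 4) / th2 s ^ 8)" by simp
  \<comment> \<open>The true value is near 1 for small \<open>q\<close>, but a crude bound suffices:
    \<open>th4 ^ 4\<close> is dropped, and \<open>128 * 13 / 16\<close> is the constant 104.\<close>
  have "- (13 / 16) \<le> (th4 s ^ 4 - th2 s ^ 4) / th3 s ^ 8"
  proof -
    have "th2 s ^ 4 \<le> 13 / 16"
    proof -
      have "1 + 4 * (- y) \<le> (1 + - y) ^ 4"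
        using Bernoulli_inequality[of "- y" 4] y by simp
      then have "99 / 100 \<le> (1 - y) ^ 4" using y by simp
      then have "16 * q / (1 - y) ^ 4 \<le> 16 * (1 / 20) / (99 / 100)"
        using q0 q_le by (intro frac_le) auto
      then show ?thesis using th2_power4_bounds(2) by (simp add: y_def)
    qed
    then have "- (13 / 16) \<le> th4 s ^ 4 - th2 s ^ 4" using th4 zero_le_power[of "th4 s" 4] by linarith
    moreover have "1 \<le> th3 s ^ 8" using th3 by (rule one_le_power)
    ultimately have "- (13 / 16) * th3 s ^ 8 \<le> th4 s ^ 4 - th2 s ^ 4"
      using mult_left_mono[of 1 "th3 s ^ 8" "13 / 16"] by linarith
    then show ?thesis using \<open>1 \<le> th3 s ^ 8\<close> by (subst pos_le_divide_eq) auto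
  qed
  with first show ?thesis unfolding psir_def y_def distrib_left by linarith
qed

text \<open>This is \<open>psi_I\<close> after inversion, with \<open>th2\<close> and
  \<open>th4\<close> exchanged and without the factor 128. The constant terms cancel, so every
  factor is bounded to first order by Bernoulli's inequality; part of the true \<open>80 * q\<close>
  is given up.\<close>

lemma psir_dual_lower_bound:
  "60 * q + 120 * q ^ 2 \<le> (th3 s ^ 4 + th2 s ^ 4) / th4 s ^ 8 + (th2 s ^ 4 - th4 s ^ 4) / th3 s ^ 8"
proof -
  note q0 = nome_pos
  have th4: "0 < th4 s" using th4_bounds(1) nome_power_le q_le by linarith
  have th3: "1 \<le> th3 s" using th3_ge q0 by linarith
  \<comment> \<open>Slightly less than \<open>2 * q\<close>, so that \<open>1 - a\<close> bounds
    \<open>th4\<close> in spite of the error \<open>3 * q ^ 4\<close>. The later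
    \<open>239 / 10\<close> likewise lies just below \<open>4 * 1.99 + 16\<close>.\<close>
  define a where "a = 199 / 100 * q"
  have a: "0 < a" "a \<le> 1 / 10" using q0 q_le by (auto simp: a_def)
  have th4a: "th4 s \<le> 1 - a" using th4_bounds(2) nome_power_le(3) q0 unfolding a_def by linarith
  have inv: "th4 s ^ n * (1 + real n * a) \<le> 1" for n
  proof -
    have "th4 s ^ n * (1 + real n * a) \<le> (1 - a) ^ n * (1 + a) ^ n"
      using th4 th4a a Bernoulli_inequality[of a n] by (intro mult_mono power_mono) auto
    also have "\<dots> = (1 - a ^ 2) ^ n" by (simp add: algebra_simps power2_eq_square flip: power_mult_distrib)
    also have "\<dots> \<le> 1"
      using a power_mono[of a 1 2] by (intro power_le_one) auto
    finally show ?thesis .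
  qed
  have "(1 + 24 * q) * (1 + 8 * a) \<le> (th3 s ^ 4 + th2 s ^ 4) / th4 s ^ 8"
  proof -
    have "1 + 4 * (2 * q) \<le> (1 + 2 * q) ^ 4"
      using Bernoulli_inequality[of "2 * q" 4] q0 by simp
    moreover have "(1 + 2 * q) ^ 4 \<le> th3 s ^ 4" using th3_ge q0 by (intro power_mono) auto
    ultimately have 1: "1 + 24 * q \<le> th3 s ^ 4 + th2 s ^ 4"
      using th2_power4_bounds(1) by linarith
    have "(1 + 24 * q) * (1 + 8 * a) * th4 s ^ 8 = (1 + 24 * q) * (th4 s ^ 8 * (1 + real 8 * a))" by simp
    also have "\<dots> \<le> (1 + 24 * q) * 1" using q0 inv[of 8] by (intro mult_left_mono) auto
    finally show ?thesis using 1 th4 by (subst pos_le_divide_eq) auto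
  qed
  moreover have "- (1 / (1 + 239 / 10 * q)) \<le> (th2 s ^ 4 - th4 s ^ 4) / th3 s ^ 8"
  proof -
    have "1 + 8 * (2 * q) \<le> (1 + 2 * q) ^ 8"
      using Bernoulli_inequality[of "2 * q" 8] q0 by simp
    also have "\<dots> \<le> th3 s ^ 8" using th3_ge q0 by (intro power_mono) auto
    finally have t8: "1 + 16 * q \<le> th3 s ^ 8" by simp
    have "th4 s ^ 4 * (1 + 239 / 10 * q) \<le> th4 s ^ 4 * ((1 + real 4 * a) * (1 + 16 * q))"
      using th4 q0 by (intro mult_left_mono) (auto simp: a_def algebra_simps)
    also have "\<dots> \<le> 1 * (1 + 16 * q)"
      unfolding mult.assoc [symmetric] using inv[of 4] q0 by (intro mult_right_mono) auto
    also have "\<dots> \<le> th3 s ^ 8" using t8 by simp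
    finally have "th4 s ^ 4 / th3 s ^ 8 \<le> 1 / (1 + 239 / 10 * q)"
      using q0 t8 by (simp add: divide_simps)
    moreover have "- (th4 s ^ 4 / th3 s ^ 8) \<le> (th2 s ^ 4 - th4 s ^ 4) / th3 s ^ 8"
      using th2_power4_bounds(1) q0 t8 by (simp add: diff_divide_distrib)
    ultimately show ?thesis by linarith
  qed
  moreover have "60 * q + 120 * q ^ 2 \<le> (1 + 24 * q) * (1 + 8 * a) - 1 / (1 + 239 / 10 * q)"
  proof -
    define b where "b = 1 + 239 / 10 * q"
    have b: "0 < b" using q0 by (simp add: b_def)
    \<comment> \<open>After division by \<open>q\<close> a quadratic polynomial without real zeros
      is left. It is written as a square centred near its minimum \<open>q = 0.0174\<close> plus a
      polynomial with positive coefficients.\<close>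
    have "((1 + 24 * q) * (1 + 8 * a) - (60 * q + 120 * q ^ 2)) * b - 1 =
       q * (626 / 1000 * (100 * q - 174 / 100) ^ 2 + (3712 / 1000 * q ^ 2 + 16 / 1000 * q + 19247224 / 10000000))"
      by (simp add: a_def b_def algebra_simps power2_eq_square)
    also have "\<dots> \<ge> 0"
      using q0 by (intro mult_nonneg_nonneg add_nonneg_nonneg) auto
    finally have "1 \<le> ((1 + 24 * q) * (1 + 8 * a) - (60 * q + 120 * q ^ 2)) * b" by simp
    then have "1 / b \<le> (1 + 24 * q) * (1 + 8 * a) - (60 * q + 120 * q ^ 2)"
      using b by (simp add: pos_divide_le_eq)
    then show ?thesis by (simp add: b_def)
  qed
  ultimately show ?thesis by linarith
qed

end

section \<open>Comparison of the two sides\<close>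

lemma nome_square:
  "exp (- (pi * s)) ^ 2 = exp (- 2 * pi * s)"
  by (simp flip: exp_double)

lemma discriminant_pos:
  assumes "s \<ge> 1"
  shows "0 < E4r s ^ 3 - E6r s ^ 2"
proof -
  define q where "q = exp (- (pi * s))"
  have q: "0 < q" "q \<le> 1 / 20" using nome_le[OF assms] by (auto simp: q_def)
  have y: "q ^ 2 = exp (- 2 * pi * s)" "q ^ 2 \<le> 1 / 400"
    using nome_power_le[OF q_def q(2)] by (auto simp: q_def nome_square)
  have "0 < 1728 * (q ^ 2 * (1 - 24 * q ^ 2))" using q y(2) by simp
  also have "\<dots> \<le> E4r s ^ 3 - E6r s ^ 2"
    by (rule discriminant_lower_bound[OF assms y])
  finally show ?thesis .
qed

text \<open>The modular parts of the numerator have weight 6, and the anomaly of \<open>E2\<close>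
  contributes one power of \<open>t\<close> less. After taking out \<open>t ^ 5\<close>, the powers
  \<open>t ^ 2\<close>, \<open>t ^ 10\<close> and the \<open>t ^ 12\<close> of the denominator
  cancel.\<close>

lemma phi0r_inverse:
  assumes "t > 0"
  shows "t ^ 2 * phi0r (1 / t) =
    1728 * ((6 / pi * E4r t - t * (E2r t * E4r t - E6r t)) ^ 2 / (E4r t ^ 3 - E6r t ^ 2))"
proof -
  have num: "E2r (1 / t) * E4r (1 / t) - E6r (1 / t) = t ^ 5 * (6 / pi * E4r t - t * (E2r t * E4r t - E6r t))"
    unfolding E2r_inverse[OF assms] E4r_inverse[OF assms] E6r_inverse[OF assms]
    by (simp add: algebra_simps eval_nat_numeral)
  have den: "E4r (1 / t) ^ 3 - E6r (1 / t) ^ 2 = t ^ 12 * (E4r t ^ 3 - E6r t ^ 2)"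
    unfolding E4r_inverse[OF assms] E6r_inverse[OF assms]
    by (simp add: power_mult_distrib algebra_simps flip: power_mult)
  have "t ^ 2 * (t ^ 5 * X) ^ 2 = t ^ 12 * X ^ 2" for X
    by (simp add: power_mult_distrib flip: power_mult power_add mult.assoc)
  then have fr: "t ^ 2 * ((t ^ 5 * X) ^ 2 / (t ^ 12 * Y)) = X ^ 2 / Y" for X Y
    using assms by (simp add: times_divide_eq_right)
  show ?thesis
    unfolding phi0r_def num den mult.left_commute[of "t ^ 2" 1728] fr ..
qed

lemma phi0r_psir_ge_1:
  assumes t: "t \<ge> 1"
  shows "0 \<le> phi0r (1 / t)" "0 < psir t" "t ^ 2 * phi0r (1 / t) < 36 / pi ^ 2 * psir t"
proof -
  define q where "q = exp (- (pi * t))"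
  define y where "y = q ^ 2"
  define D where "D = E2r t * E4r t - E6r t"
  define M where "M = E4r t ^ 3 - E6r t ^ 2"
  have q: "0 < q" "q \<le> 1 / 20" using nome_le[OF t] by (auto simp: q_def)
  have y: "y = exp (- 2 * pi * t)" "y \<le> 1 / 400"
    using nome_power_le[OF q_def q(2)] by (auto simp: y_def q_def nome_square)
  have y0: "0 < y" using q by (simp add: y_def)
  have pt: "3 \<le> pi * t" using mult_mono[of 3 pi 1 t] t pi_gt_3 by simp
  note E = Eisenstein_bounds[OF y]
  note DD = E2E4_minus_E6_bounds[OF y, folded D_def]
  have M: "1728 * (y * (1 - 24 * y)) \<le> M" unfolding M_def by (rule discriminant_lower_bound[OF t y])
  have M0: "0 < M" unfolding M_def by (rule discriminant_pos[OF t])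
  define N where "N = E4r t - pi * t / 6 * D"
  have inv: "t ^ 2 * phi0r (1 / t) = 36 / pi ^ 2 * (1728 * (N ^ 2 / M))"
  proof -
    have "6 / pi * E4r t - t * D = 6 / pi * N" by (simp add: N_def field_simps)
    then have "t ^ 2 * phi0r (1 / t) = 1728 * ((6 / pi * N) ^ 2 / M)"
      using phi0r_inverse[of t] t by (simp add: D_def M_def)
    then show ?thesis by (simp add: power_mult_distrib power_divide)
  qed
  have psi: "1 / y - 104 \<le> psir t" unfolding y_def by (rule psir_lower_bound[OF q_def q(2)])
  have "400 \<le> 1 / y" using y0 y(2) by (simp add: field_simps)
  with psi show "0 < psir t" by simp
  have "0 \<le> t ^ 2 * phi0r (1 / t)" unfolding inv using M0 by simp
  then show "0 \<le> phi0r (1 / t)" using t by (simp add: zero_le_mult_iff)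
  \<comment> \<open>With \<open>pi * t \<ge> 3\<close> the subtracted part is at least
    \<open>360 * y\<close>, against \<open>240 * y\<close> from \<open>E4r\<close> and less than
    \<open>6 * y\<close> from its quadratic term.\<close>
  have "N \<le> 1 - 100 * y"
  proof -
    have "3 / 6 * (720 * y) \<le> pi * t / 6 * D" using pt DD(1) y0 by (intro mult_mono) auto
    moreover have "y ^ 2 \<le> 1 / 400 * y" using mult_right_mono[OF y(2), of y] y0 by (simp add: power2_eq_square)
    ultimately show ?thesis unfolding N_def using E(4) y0 by linarith
  qed
  \<comment> \<open>Needed to square the upper bound. One factor \<open>q\<close> of
    \<open>y\<close> tames \<open>pi * t\<close>; the other supplies \<open>1 / 20\<close>.\<close>
  moreover have "0 \<le> N"
  proof -
    have "pi * t / 6 * D \<le> pi * t / 6 * (720 * y * (1 + 20 * y))"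
      using DD(2) pt by (intro mult_left_mono) auto
    also have "\<dots> = 120 * ((pi * t) * q) * q * (1 + 20 * y)" by (simp add: y_def power2_eq_square)
    also have "\<dots> \<le> 120 * (3 / 20) * (1 / 20) * (1 + 20 * (1 / 400))"
      using mult_exp_minus_le[OF pt] q y y0 pt by (intro mult_mono) (auto simp: q_def)
    also have "\<dots> \<le> 1" by simp
    finally show ?thesis unfolding N_def using E(3) y0 zero_le_power2[of y] by linarith
  qed
  ultimately have "N ^ 2 \<le> (1 - 100 * y) ^ 2" by (intro power_mono)
  also have "\<dots> = 1 - 200 * y + 10000 * y * y" by (simp add: power2_eq_square algebra_simps)
  also have "\<dots> \<le> 1 - 175 * y" using mult_right_mono[OF y(2), of y] y0 by simp
  also have "\<dots> < (1 - 104 * y) * (1 - 24 * y)"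
  proof -
    have "(1 - 104 * y) * (1 - 24 * y) = 1 - 175 * y + y * (47 + 2496 * y)" by (simp add: algebra_simps)
    moreover have "0 < y * (47 + 2496 * y)" using y0 by (intro mult_pos_pos) auto
    ultimately show ?thesis by linarith
  qed
  also have "\<dots> = (1 / y - 104) * (y * (1 - 24 * y))" using y0 by (simp add: field_simps)
  also have "\<dots> \<le> psir t * (M / 1728)"
    using psi M y y0 \<open>0 < psir t\<close> by (intro mult_mono) auto
  finally have "1728 * (N ^ 2 / M) < psir t"
    using M0 by (simp add: pos_divide_less_eq)
  then show "t ^ 2 * phi0r (1 / t) < 36 / pi ^ 2 * psir t"
    unfolding inv by (intro mult_strict_left_mono) auto
qed

lemma phi0r_psir_le_1:
  assumes t: "0 < t" "t \<le> 1"
  shows "0 \<le> phi0r (1 / t)" "0 < psir t" "t ^ 2 * phi0r (1 / t) < 36 / pi ^ 2 * psir t"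
proof -
  define s where "s = 1 / t"
  have s: "s \<ge> 1" using t by (simp add: s_def)
  define q where "q = exp (- (pi * s))"
  define y where "y = q ^ 2"
  define D where "D = E2r s * E4r s - E6r s"
  define M where "M = E4r s ^ 3 - E6r s ^ 2"
  have q: "0 < q" "q \<le> 1 / 20" using nome_le[OF s] by (auto simp: q_def)
  have y: "y = exp (- 2 * pi * s)" "y \<le> 1 / 400"
    using nome_power_le[OF q_def q(2)] by (auto simp: y_def q_def nome_square)
  have y0: "0 < y" using q by (simp add: y_def)
  note DD = E2E4_minus_E6_bounds[OF y, folded D_def]
  have M: "1728 * (y * (1 - 24 * y)) \<le> M" unfolding M_def by (rule discriminant_lower_bound[OF s y])
  have M0: "0 < M" unfolding M_def by (rule discriminant_pos[OF s])
  have phi: "phi0r s = 1728 * (D ^ 2 / M)" by (simp add: phi0r_def D_def M_def)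
  show "0 \<le> phi0r (1 / t)" using M0 phi by (simp flip: s_def)
  define R where "R = (th3 s ^ 4 + th2 s ^ 4) / th4 s ^ 8 + (th2 s ^ 4 - th4 s ^ 4) / th3 s ^ 8"
  have R: "60 * q + 120 * q ^ 2 \<le> R"
    unfolding R_def by (rule psir_dual_lower_bound[OF q_def q(2)])
  have psi: "psir t = t ^ 2 * (128 * R)"
  proof -
    have s0: "0 < s" using s by simp
    have th: "th3 t = sqrt s * th3 s" "th4 t = sqrt s * th2 s" "th2 t = sqrt s * th4 s"
    proof -
      show "th3 t = sqrt s * th3 s" "th4 t = sqrt s * th2 s"
        using th3_inverse[OF s0] th4_inverse[OF s0] by (simp_all add: s_def)
      \<comment> \<open>The inversion leads from \<open>th4\<close> to \<open>th2\<close>, so the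
        formula for \<open>th2 t\<close> comes from applying it at \<open>t\<close> instead of
        \<open>s\<close>.\<close>
      have "th4 s = sqrt t * th2 t" using th4_inverse[OF t(1)] by (simp add: s_def)
      then show "th2 t = sqrt s * th4 s" using t by (simp add: s_def real_sqrt_divide)
    qed
    have p4: "(sqrt s * x) ^ 4 = s ^ 2 * x ^ 4" "(sqrt s * x) ^ 8 = s ^ 4 * x ^ 8" for x
    proof -
      have "sqrt s ^ 4 = (sqrt s ^ 2) ^ 2" "sqrt s ^ 8 = (sqrt s ^ 2) ^ 4" by (simp_all flip: power_mult)
      then show "(sqrt s * x) ^ 4 = s ^ 2 * x ^ 4" "(sqrt s * x) ^ 8 = s ^ 4 * x ^ 8"
        using s0 by (simp_all add: power_mult_distrib)
    qed
    have fr: "s ^ 2 * a / (s ^ 4 * b) = t ^ 2 * (a / b)" for a b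
      using t by (simp add: s_def field_simps eval_nat_numeral)
    have "psir t = 128 * (s ^ 2 * (th3 s ^ 4 + th2 s ^ 4) / (s ^ 4 * th4 s ^ 8) + s ^ 2 * (th2 s ^ 4 - th4 s ^ 4) / (s ^ 4 * th3 s ^ 8))"
      unfolding psir_def th p4 by (simp add: algebra_simps)
    then show ?thesis unfolding fr R_def by (simp add: algebra_simps)
  qed
  have "0 < 60 * q + 120 * q ^ 2" using q by (intro add_pos_pos) auto
  with R have R0: "0 < R" by linarith
  then show "0 < psir t" using t psi by simp
  have "phi0r s \<le> 1728 * ((720 * y * (1 + 20 * y)) ^ 2 / (1728 * (y * (1 - 24 * y))))"
  proof -
    have "0 \<le> D" using DD(1) y0 by linarith
    then show ?thesis
      unfolding phi using DD(2) y0 M y(2) by (intro mult_left_mono frac_le power_mono) auto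
  qed
  also have "\<dots> = 518400 * y * ((1 + 20 * y) ^ 2 / (1 - 24 * y))"
  proof -
    have "1728 * ((720 * y * c) ^ 2 / (1728 * (y * d))) = 518400 * y * (c ^ 2 / d)" for c d
      using y0 by (simp add: power2_eq_square)
    then show ?thesis .
  qed
  also have "\<dots> \<le> 518400 * y * ((1 + 20 * (1 / 400)) ^ 2 / (1 - 24 * (1 / 400)))"
    using y0 y by (intro mult_left_mono frac_le power_mono) auto
  also have "\<dots> \<le> 608100 * y" using y0 by (simp add: power2_eq_square)
  \<comment> \<open>The margin is narrow: by \<open>q \<le> 1 / 20\<close> the difference of the
    quadratic terms, \<open>552804 * q ^ 2\<close>, is at most \<open>27640.2 * q\<close>, against
    \<open>27648 * q\<close>. The quadratic term of the lower bound is essential here. The factor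
    \<open>18 / 5\<close> is \<open>36 / 10\<close>, from \<open>pi ^ 2 \<le> 10\<close>.\<close>
  also have "\<dots> < 18 / 5 * (128 * (60 * q + 120 * q ^ 2))"
    using mult_right_mono[OF q(2), of q] q by (simp add: y_def power2_eq_square)
  also have "\<dots> \<le> 18 / 5 * (128 * R)" using R by simp
  also have "\<dots> \<le> 36 / pi ^ 2 * (128 * R)"
    using pi_squared_bounds R0 by (intro mult_right_mono) (auto simp: field_simps)
  finally have "t ^ 2 * phi0r s < t ^ 2 * (36 / pi ^ 2 * (128 * R))"
    using t by (intro mult_strict_left_mono) auto
  then show "t ^ 2 * phi0r (1 / t) < 36 / pi ^ 2 * psir t"
    by (simp add: psi s_def mult_ac)
qed

theorem theorem1:
  fixes t :: real
  assumes "t > 0"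
  shows "(A t \<in> \<real> \<and> Re (A t) < 0) \<and> (B t \<in> \<real> \<and> Re (B t) > 0)"
proof -
  have "0 \<le> phi0r (1 / t)" "0 < psir t" "t ^ 2 * phi0r (1 / t) < 36 / pi ^ 2 * psir t"
    using phi0r_psir_ge_1[of t] phi0r_psir_le_1[of t] assms by linarith+
  moreover from this have "0 \<le> t ^ 2 * phi0r (1 / t)" "0 < 36 / pi ^ 2 * psir t"
    by simp_all
  ultimately show ?thesis
    unfolding A_B_real[OF assms] by (simp only: Reals_of_real Re_complex_of_real simp_thms) (intro conjI; linarith)
qed

end
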